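(* Assume that $0<\alpha<2$ and $u\in L_\alpha\cap C^{1,1}_{loc}$ is a nonnegative solution of $$(-\Delta)^{\alpha/2}u(x)=u^p(x),\qquad x\in\mathbb{R}^n .$$ Then: (i) In the critical case $p=\frac{n+\alpha}{n-\alpha}$, $u$ is radially symmetric and monotone decreasing about some point. (ii) In the subcritical case $1<p<\frac{n+\alpha}{n-\alpha}$, $u\equiv 0$.
   Context: $L_\alpha=\{u:\mathbb{R}^n\to\mathbb{R} : \int_{\mathbb{R}^n}\frac{|u(x)|}{1+|x|^{n+\alpha}}\,dx<\infty\}$. $C^{1,1}_{loc}$ denotes differentiable functions with locally Lipschitz gradient. For $u\in L_\alpha\cap C^{1,1}_{loc}$, the fractional Laplacian is defined pointwise by $$(-\Delta)^{\alpha/2}u(x)=C_{n,\alpha}\lim_{\epsilon\to0}\int_{\mathbb{R}^n\setminus B_\epsilon(x)}\frac{u(x)-u(z)}{|x-z|^{n+\alpha}}\,dz,$$ where $C_{n,\alpha}$ is a normalization constant and $B_\epsilon(x)$ is the ball of radius $\epsilon$ centered at $x$. *)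

theory Defs
  imports "HOL-Analysis.Analysis"
begin

definition L_space :: "real \<Rightarrow> ('a::euclidean_space \<Rightarrow> real) set" where
  "L_space \<alpha> = {u. u \<in> borel_measurable lebesgue \<and>
     integrable lebesgue (\<lambda>x. \<bar>u x\<bar> / (1 + norm x powr (real DIM('a) + \<alpha>)))}"

definition C11_loc :: "('a::euclidean_space \<Rightarrow> real) set" where
  "C11_loc = {u. \<exists>g :: 'a \<Rightarrow> 'a. (\<forall>x. GDERIV u x :> g x) \<and>
     (\<forall>x. \<exists>r>0. \<exists>K. K-lipschitz_on (ball x r) g)}"

text \<open>The value is given as a relation, in the style of \<^const>\<open>has_derivative\<close>, so that an
  equation for the fractional Laplacian includes the convergence of the principal value
  (which is automatic for functions in \<^const>\<open>L_space\<close> and \<^const>\<open>C11_loc\<close>).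
  The parameter \<open>C\<close> is the normalization constant.\<close>

definition has_frac_laplacian ::
  "real \<Rightarrow> real \<Rightarrow> ('a::euclidean_space \<Rightarrow> real) \<Rightarrow> 'a \<Rightarrow> real \<Rightarrow> bool" where
  "has_frac_laplacian C \<alpha> u x l \<longleftrightarrow>
     ((\<lambda>\<epsilon>. C * (LINT z : - ball x \<epsilon> | lebesgue.
            (u x - u z) / norm (x - z) powr (real DIM('a) + \<alpha>))) \<longlongrightarrow> l) (at_right 0)"

text \<open>Decreasing is meant in the non-strict sense: the zero function is a nonnegative solution
  of the equations considered.\<close>

definition radially_decreasing_about :: "'a::euclidean_space \<Rightarrow> ('a \<Rightarrow> real) \<Rightarrow> bool" where
  "radially_decreasing_about x0 u \<longleftrightarrow>
     (\<exists>\<phi> :: real \<Rightarrow> real. antimono_on {0..} \<phi> \<and> (\<forall>x. u x = \<phi> (norm (x - x0))))"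

end

theory Submission
  imports Defs
begin

text \<open>
  The proof is the method of moving spheres. For the Kelvin transform
  \<open>u\<^sub>r(y) = (r/|y|)\<^bsup>n-\<alpha>\<^esup> u(r\<^sup>2y/|y|\<^sup>2)\<close> the difference \<open>u\<^sub>r - u\<close> is antisymmetric under inversion in
  the sphere of radius \<open>r\<close>, and the part of the kernel reflected at that sphere is smaller than the
  kernel itself, so \<open>u\<^sub>r - u\<close> satisfies a maximum principle in the ball. The singularity of \<open>u\<^sub>r\<close> at
  the centre is neutralised by adding \<open>\<epsilon>\<close> times the transform of a constant, which is
  \<open>\<alpha>\<close>-harmonic and tends to infinity there. Starting from small \<open>r\<close> one obtains for every centre
  either \<open>u\<^sub>r \<ge> u\<close> in the ball for all \<open>r\<close>, or \<open>u\<^sub>r = u\<close> for some \<open>r\<close>. The first alternative at all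
  centres makes \<open>u\<close> constant, which the equation forbids. The second alternative at one centre fixes the
  decay of \<open>u\<close> and thereby excludes the first at all others; it also forces \<open>p\<close> to be critical.
  Comparing the expansions of \<open>u\<close> at infinity from different centres then shows that
  \<open>u\<^bsup>-2/(n-\<alpha>)\<^esup>\<close> is a quadratic polynomial \<open>c|x - x\<^sub>0|\<^sup>2 + k\<close>.
\<close>

section \<open>A coordinate type of dimension \<open>DIM('a)\<close>\<close>

text \<open>Inversions fit this equation because \<open>|Jy - Jz| = r^2 |y - z| / (|y| |z|)\<close>:
  the kernel is reproduced up to powers of \<open>r/|y|\<close> and \<open>r/|z|\<close>. The Kelvin
  transform then solves the equation with an extra weight
  \<open>(r/|y|)^(n+\<alpha>-p(n-\<alpha>))\<close>, which is at least 1 inside the sphere up to the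
  critical exponent. The main obstacle is that no decay of \<open>u\<close> is given, hence nothing
  is known about the transform near the centre. Lower bounds there must come from the sign of the
  operator: at a too small minimum near the puncture, the mass of a distant annulus would make the
  principal value negative. Near the sphere, where the difference vanishes, no boundary point lemma
  is used: the kernel mass beyond the sphere, seen from distance \<open>d\<close>, is at least of
  order \<open>d^(-\<alpha>)\<close>, which beats the Lipschitz constant of \<open>t^p\<close> and
  keeps negative minima away. A second difficulty lies in the principal values: the image of a ball
  about \<open>y\<close> is not centred at the image of \<open>y\<close>, so each change of
  variables has to replace an off-centre region by a ball.\<close>

text \<open>The change of variables theorem of the library is stated for \<open>real ^ 'n\<close> with a well-ordered
  index type. Indexing by the canonical basis makes it available for an arbitrary Euclidean space.\<close>

typedef (overloaded) ('a::euclidean_space) basis_index = "Basis :: 'a set"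
  using SOME_Basis by blast

lemma finite_UNIV_basis_index: "finite (UNIV :: 'a::euclidean_space basis_index set)"
proof -
  have "(UNIV :: 'a basis_index set) = Abs_basis_index ` Basis"
    by (rule type_definition.univ[OF type_definition_basis_index])
  then show ?thesis by (metis finite_Basis finite_imageI)
qed

instance basis_index :: (euclidean_space) finite
  by standard (rule finite_UNIV_basis_index)

definition basis_index_enum :: "'a::euclidean_space basis_index \<Rightarrow> nat" where
  "basis_index_enum = (SOME f. inj f)"

lemma inj_basis_index_enum: "inj (basis_index_enum :: 'a::euclidean_space basis_index \<Rightarrow> nat)"
proof -
  have "\<exists>f :: 'a basis_index \<Rightarrow> nat. inj f"
    using finite_imp_inj_to_nat_seg[OF finite_UNIV_basis_index] by metis
  then show ?thesis unfolding basis_index_enum_def by (rule someI_ex)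
qed

instantiation basis_index :: (euclidean_space) wellorder
begin
definition "x \<le> y \<longleftrightarrow> basis_index_enum x \<le> basis_index_enum y"
definition "x < y \<longleftrightarrow> basis_index_enum x < basis_index_enum y"
instance
proof
  fix x y z :: "'a basis_index"
  show "x < y \<longleftrightarrow> x \<le> y \<and> \<not> y \<le> x" "x \<le> x" "x \<le> y \<or> y \<le> x"
    unfolding less_eq_basis_index_def less_basis_index_def by linarith+
  show "x \<le> y \<Longrightarrow> y \<le> z \<Longrightarrow> x \<le> z"
    unfolding less_eq_basis_index_def by linarith
  show "x \<le> y \<Longrightarrow> y \<le> x \<Longrightarrow> x = y"
    unfolding less_eq_basis_index_def by (rule injD[OF inj_basis_index_enum]) linarith
next
  fix P :: "'a basis_index \<Rightarrow> bool" and a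
  assume "\<And>x. (\<And>y. y < x \<Longrightarrow> P y) \<Longrightarrow> P x"
  then show "P a"
    unfolding less_basis_index_def by (rule measure_induct_rule[of basis_index_enum])
qed
end

definition of_coords :: "real ^ ('a::euclidean_space) basis_index \<Rightarrow> 'a" where
  "of_coords v = (\<Sum>i\<in>UNIV. (v $ i) *\<^sub>R Rep_basis_index i)"

lemma Rep_basis_index_Basis [simp]: "Rep_basis_index i \<in> Basis"
  by (rule Rep_basis_index)

lemma range_Rep_basis_index: "range (Rep_basis_index :: 'a::euclidean_space basis_index \<Rightarrow> 'a) = Basis"
  by (rule type_definition.Rep_range[OF type_definition_basis_index])

lemma inner_Rep_basis_index:
  "Rep_basis_index i \<bullet> Rep_basis_index j = (if i = j then 1 else (0::real))"
  by (simp add: inner_Basis Rep_basis_index_inject)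

lemma of_coords_inner: "of_coords v \<bullet> Rep_basis_index i = v $ i"
  by (simp add: of_coords_def inner_sum_left inner_Rep_basis_index if_distrib cong: if_cong)

lemma linear_of_coords: "linear of_coords"
  by (rule linearI) (simp_all add: of_coords_def scaleR_add_left sum.distrib scaleR_sum_right)

lemma inner_of_coords: "of_coords v \<bullet> of_coords w = v \<bullet> w"
proof -
  have "of_coords v \<bullet> of_coords w = (\<Sum>i\<in>UNIV. v $ i * (Rep_basis_index i \<bullet> of_coords w))"
    by (subst (1) of_coords_def) (simp add: inner_sum_left)
  also have "\<dots> = (\<Sum>i\<in>UNIV. v $ i * w $ i)"
    by (simp add: of_coords_inner inner_commute[of "Rep_basis_index _"])
  finally show ?thesis by (simp add: inner_vec_def)
qed

lemma norm_of_coords: "norm (of_coords v) = norm v"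
  by (simp add: norm_eq_sqrt_inner inner_of_coords)

lemma card_basis_index: "CARD('a::euclidean_space basis_index) = DIM('a)"
proof -
  have "inj (Rep_basis_index :: 'a basis_index \<Rightarrow> 'a)"
    by (simp add: inj_def Rep_basis_index_inject)
  from card_image[OF this] show ?thesis
    by (simp add: range_Rep_basis_index)
qed

lemma measurable_of_coords [measurable]: "of_coords \<in> borel_measurable borel"
  by (intro borel_measurable_continuous_onI linear_continuous_on)
     (simp add: linear_of_coords linear_linear)

text \<open>\<open>of_coords\<close> matches coordinates with inner products against the basis, so
  preimages of boxes are boxes with the same side lengths, and \<open>lborel_eqI\<close> asks for
  nothing more.\<close>

lemma lborel_of_coords: "distr lborel borel of_coords = (lborel :: 'a::euclidean_space measure)"
proof (rule lborel_eqI[symmetric])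
  fix l u :: 'a
  assume lu: "\<And>b. b \<in> Basis \<Longrightarrow> l \<bullet> b \<le> u \<bullet> b"
  define l' u' :: "real ^ 'a basis_index"
    where "l' = (\<chi> i. l \<bullet> Rep_basis_index i)" and "u' = (\<chi> i. u \<bullet> Rep_basis_index i)"
  have eq: "of_coords -` box l u = box l' u'"
  proof -
    have "of_coords v \<in> box l u \<longleftrightarrow> v \<in> box l' u'" for v
      unfolding mem_box_cart box_def[of l u] mem_Collect_eq range_Rep_basis_index[symmetric]
      by (auto simp: of_coords_inner l'_def u'_def)
    then show ?thesis by auto
  qed
  have "emeasure (distr lborel borel of_coords) (box l u) = emeasure lborel (box l' u')"
    by (subst emeasure_distr) (auto simp: eq)
  also have "\<dots> = (\<Prod>b\<in>Basis. (u' - l') \<bullet> b)"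
  proof (rule emeasure_lborel_box)
    fix b :: "real ^ 'a basis_index" assume "b \<in> Basis"
    then obtain i where "b = axis i 1" by (auto simp: Basis_vec_def)
    then show "l' \<bullet> b \<le> u' \<bullet> b" by (simp add: inner_axis l'_def u'_def lu)
  qed
  also have "(\<Prod>b\<in>Basis. (u' - l') \<bullet> b) = (\<Prod>i\<in>UNIV. (u - l) \<bullet> Rep_basis_index i)"
  proof -
    have B: "(Basis :: (real ^ 'a basis_index) set) = (\<lambda>i. axis i 1) ` UNIV"
      by (auto simp: Basis_vec_def)
    have "inj (\<lambda>i::'a basis_index. axis i (1::real))"
      by (auto simp: inj_def axis_eq_axis)
    then show ?thesis
      unfolding B by (subst prod.reindex) (auto simp: inner_axis l'_def u'_def inner_diff_left)
  qed
  also have "(\<Prod>i\<in>UNIV. (u - l) \<bullet> Rep_basis_index i) = (\<Prod>b\<in>Basis. (u - l) \<bullet> b)"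
    by (subst range_Rep_basis_index[symmetric], subst prod.reindex)
       (auto simp: inj_def Rep_basis_index_inject)
  finally show "emeasure (distr lborel borel of_coords) (box l u) = (\<Prod>b\<in>Basis. (u - l) \<bullet> b)" .
qed auto

section \<open>Inversion in a sphere\<close>

definition inversion :: "real \<Rightarrow> 'a::real_inner \<Rightarrow> 'a" where
  "inversion r x = (r / norm x)\<^sup>2 *\<^sub>R x"

lemma inversion_0 [simp]: "inversion r 0 = 0"
  by (simp add: inversion_def)

lemma norm_inversion: "norm (inversion r x) = r\<^sup>2 / norm x"
  by (cases "x = 0") (auto simp: inversion_def power2_eq_square)

lemma inversion_eq_0_iff [simp]: "r > 0 \<Longrightarrow> inversion r x = 0 \<longleftrightarrow> x = 0"
  by (auto simp: inversion_def)

lemma inversion_inversion [simp]: "r > 0 \<Longrightarrow> inversion r (inversion r x) = x"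
proof (cases "x = 0")
  case False
  assume r: "r > 0"
  have "inversion r (inversion r x) = ((r / (r\<^sup>2 / norm x))\<^sup>2 * (r / norm x)\<^sup>2) *\<^sub>R x"
    by (simp add: norm_inversion inversion_def[of r "inversion r x"]) (simp add: inversion_def)
  also have "(r / (r\<^sup>2 / norm x))\<^sup>2 * (r / norm x)\<^sup>2 = 1"
    using r False by (simp add: field_simps power2_eq_square)
  finally show ?thesis by simp
qed auto

lemma norm_inversion_diff:
  assumes "x \<noteq> 0" "y \<noteq> 0"
  shows "norm (inversion r x - inversion r y) = r\<^sup>2 * norm (x - y) / (norm x * norm y)"
proof -
  have "(norm (inversion r x - inversion r y))\<^sup>2 = (r\<^sup>2 * norm (x - y) / (norm x * norm y))\<^sup>2"
    using assms
    unfolding power_mult_distrib power_divide inversion_def power2_norm_eq_inner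
    by (simp add: inner_diff_left inner_diff_right inner_commute[of y x])
       (simp add: field_simps eval_nat_numeral)
  then show ?thesis
    by (rule power2_eq_imp_eq) auto
qed

lemma measurable_inversion [measurable]: "inversion r \<in> borel_measurable (borel :: 'a::euclidean_space measure)"
  unfolding inversion_def by measurable

lemma inversion_of_coords: "inversion r (of_coords v) = of_coords (inversion r v)"
  by (simp add: inversion_def norm_of_coords linear_scale[OF linear_of_coords])

lemma has_derivative_inversion:
  fixes x :: "'a::euclidean_space"
  assumes "x \<noteq> 0"
  shows "(inversion r has_derivative
    (\<lambda>h. (r / norm x)\<^sup>2 *\<^sub>R (h - (2 * (x \<bullet> h) / (x \<bullet> x)) *\<^sub>R x))) (at x within S)"
proof -
  have eq: "inversion r = (\<lambda>x. (r\<^sup>2 / (x \<bullet> x)) *\<^sub>R x)"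
    by (auto simp: inversion_def power_divide power2_norm_eq_inner)
  have xx: "x \<bullet> x \<noteq> 0" using assms by simp
  have "((\<lambda>x. x \<bullet> x) has_derivative (\<lambda>h. 2 * (x \<bullet> h))) (at x within S)"
    by (rule has_derivative_eq_rhs[OF has_derivative_inner[OF has_derivative_ident has_derivative_ident]])
       (simp add: inner_commute fun_eq_iff)
  then have "((\<lambda>x. r\<^sup>2 / (x \<bullet> x)) has_derivative (\<lambda>h. - (r\<^sup>2 * (2 * (x \<bullet> h))) / ((x \<bullet> x) * (x \<bullet> x)))) (at x within S)"
    using has_derivative_divide'[where f = "\<lambda>_. r\<^sup>2" and g = "\<lambda>x. x \<bullet> x" and x = x, OF has_derivative_const _ xx] by simp
  from has_derivative_scaleR[OF this has_derivative_ident]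
  have "((\<lambda>x. (r\<^sup>2 / (x \<bullet> x)) *\<^sub>R x) has_derivative
     (\<lambda>h. (r\<^sup>2 / (x \<bullet> x)) *\<^sub>R h + (- (r\<^sup>2 * (2 * (x \<bullet> h))) / ((x \<bullet> x) * (x \<bullet> x))) *\<^sub>R x)) (at x within S)" .
  then show ?thesis unfolding eq
    by (rule has_derivative_eq_rhs)
       (simp add: fun_eq_iff power_divide power2_norm_eq_inner scaleR_diff_right)
qed

text \<open>The map has the form of the derivative of an inversion: \<open>c\<close> times the
  reflection in the hyperplane orthogonal to \<open>x\<close>. A reflection is orthogonal, so only
  the scaling contributes to the determinant.\<close>

lemma det_reflection_scaled:
  fixes x :: "real ^ 'n"
  assumes "x \<noteq> 0"
  shows "\<bar>det (matrix (\<lambda>h. c *\<^sub>R (h - (2 * (x \<bullet> h) / (x \<bullet> x)) *\<^sub>R x)))\<bar> = \<bar>c\<bar> ^ CARD('n)"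
proof -
  define R where "R = (\<lambda>h. h - (2 * (x \<bullet> h) / (x \<bullet> x)) *\<^sub>R x)"
  have lin: "linear R"
    unfolding R_def by (rule linearI) (auto simp: inner_add_right field_simps scaleR_add_left add_divide_distrib scaleR_diff_right)
  have "R v \<bullet> R w = v \<bullet> w" for v w
    using assms unfolding R_def
    by (simp add: inner_diff_left inner_diff_right inner_commute field_simps)
  then have "orthogonal_transformation R"
    using lin by (simp add: orthogonal_transformation_def)
  then have "orthogonal_matrix (matrix R)"
    by (simp add: orthogonal_transformation_matrix)
  then have d: "\<bar>det (matrix R)\<bar> = 1"
    using det_orthogonal_matrix by fastforce
  have "matrix (\<lambda>h. c *\<^sub>R R h) = matrix ((\<lambda>h. c *\<^sub>R h) \<circ> R)" by (simp add: o_def)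
  also have "\<dots> = matrix ((*\<^sub>R) c) ** matrix R"
    using lin by (subst matrix_compose) (auto simp: linear_linear bounded_linear_scaleR_right  bounded_linear.linear)
  finally have "det (matrix (\<lambda>h. c *\<^sub>R R h)) = det (matrix ((*\<^sub>R) c :: real^'n \<Rightarrow> _)) * det (matrix R)"
    by (simp add: det_mul)
  then show ?thesis using d by (simp add: R_def abs_mult power_abs)
qed

text \<open>The density is the Jacobian of the inversion. As the inversion is its own inverse, the
  image measure of a box is the integral of the Jacobian over the inverted box, that is, the volume
  of the box itself.\<close>

lemma distr_inversion_vec:
  assumes r: "r > 0"
  shows "distr (density lborel (\<lambda>x::real^'n::{finite,wellorder}. ennreal ((r / norm x) ^ (2 * CARD('n))))) borel (inversion r) = lborel"
proof (rule lborel_eqI[symmetric])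
  fix l u :: "real^'n::{finite,wellorder}"
  assume lu: "\<And>b. b \<in> Basis \<Longrightarrow> l \<bullet> b \<le> u \<bullet> b"
  let ?w = "\<lambda>x::real^'n::{finite,wellorder}. (r / norm x) ^ (2 * CARD('n))"
  \<comment> \<open>The origin is a null set and has to go: there the inversion is not
    differentiable and takes its default value.\<close>
  define S where "S = inversion r -` box l u - {0}"
  have S[measurable]: "S \<in> sets borel"
    unfolding S_def using measurable_sets_borel[OF measurable_inversion, of "box l u" r] by auto
  have im: "inversion r ` S = box l u - {0}"
    unfolding S_def using r by (auto intro!: image_eqI[where x="inversion r _"])
  have meas: "inversion r ` S \<in> lmeasurable" "measure lebesgue (inversion r ` S) = measure lebesgue (box l u)"
  proof -
    show "inversion r ` S \<in> lmeasurable" unfolding im by (intro fmeasurable_Diff) auto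
    show "measure lebesgue (inversion r ` S) = measure lebesgue (box l u)"
      unfolding im by (rule measure_Diff_null_set) auto
  qed
  have "(inversion r has_derivative
    (\<lambda>h. (r / norm x)\<^sup>2 *\<^sub>R (h - (2 * (x \<bullet> h) / (x \<bullet> x)) *\<^sub>R x))) (at x within S)" if "x \<in> S" for x
    using that by (intro has_derivative_inversion) (auto simp: S_def)
  moreover have "inj_on (inversion r) S"
    using r by (metis inj_on_inverseI inversion_inversion)
  ultimately have "((\<lambda>x. \<bar>det (matrix (\<lambda>h. (r / norm x)\<^sup>2 *\<^sub>R (h - (2 * (x \<bullet> h) / (x \<bullet> x)) *\<^sub>R x)))\<bar>) has_integral
      measure lebesgue (box l u)) S"
    using meas S by (subst has_measure_differentiable_image[symmetric]) auto
  then have "(?w has_integral measure lebesgue (box l u)) S"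
    by (rule has_integral_eq[rotated]) (use r in \<open>auto simp: S_def det_reflection_scaled power_mult power_abs\<close>)
  then have "(\<integral>\<^sup>+x. ennreal (?w x) * indicator S x \<partial>lborel) = measure lebesgue (box l u)"
    by (intro nn_integral_has_integral_lebesgue') (use r in auto)
  moreover have "emeasure (distr (density lborel (\<lambda>x. ennreal (?w x))) borel (inversion r)) (box l u)
     = (\<integral>\<^sup>+x. ennreal (?w x) * indicator (inversion r -` box l u) x \<partial>lborel)"
    using measurable_sets_borel[OF measurable_inversion, of "box l u" r]
    by (subst emeasure_distr) (auto simp: emeasure_density)
  moreover have "(\<integral>\<^sup>+x. ennreal (?w x) * indicator (inversion r -` box l u) x \<partial>lborel) = (\<integral>\<^sup>+x. ennreal (?w x) * indicator S x \<partial>lborel)"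
    by (rule nn_integral_cong) (auto simp: S_def indicator_def)
  ultimately show "emeasure (distr (density lborel (\<lambda>x. ennreal (?w x))) borel (inversion r)) (box l u) = (\<Prod>b\<in>Basis. (u - l) \<bullet> b)"
    using lu by (simp add: measure_lborel_box)
qed auto

lemma nn_integral_inversion:
  fixes f :: "'a::euclidean_space \<Rightarrow> ennreal"
  assumes r: "r > 0" and [measurable]: "f \<in> borel_measurable borel"
  shows "(\<integral>\<^sup>+x. ennreal ((r / norm x) ^ (2 * DIM('a))) * f (inversion r x) \<partial>lborel) = (\<integral>\<^sup>+x. f x \<partial>lborel)"
proof -
  have "(\<integral>\<^sup>+x. ennreal ((r / norm x) ^ (2 * DIM('a))) * f (inversion r x) \<partial>lborel)
     = (\<integral>\<^sup>+v. ennreal ((r / norm v) ^ (2 * DIM('a))) * f (of_coords (inversion r v)) \<partial>lborel)"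
    by (subst lborel_of_coords[symmetric], subst nn_integral_distr)
       (auto simp: norm_of_coords inversion_of_coords)
  also have "\<dots> = (\<integral>\<^sup>+v. f (of_coords v) \<partial>distr (density lborel (\<lambda>x::real^'a basis_index. ennreal ((r / norm x) ^ (2 * CARD('a basis_index))))) borel (inversion r))"
    by (subst nn_integral_distr) (auto simp: nn_integral_density card_basis_index)
  also have "\<dots> = (\<integral>\<^sup>+v. f (of_coords v) \<partial>lborel)"
    by (simp add: distr_inversion_vec r)
  also have "\<dots> = (\<integral>\<^sup>+x. f x \<partial>lborel)"
    by (subst (2) lborel_of_coords[symmetric], subst nn_integral_distr) auto
  finally show ?thesis .
qed

lemma lborel_inversion:
  assumes r: "r > 0"
  shows "distr (density lborel (\<lambda>x::'a::euclidean_space. ennreal ((r / norm x) ^ (2 * DIM('a))))) borel (inversion r) = lborel"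
proof (rule measure_eqI)
  fix A :: "'a set"
  assume "A \<in> sets (distr (density lborel (\<lambda>x::'a. ennreal ((r / norm x) ^ (2 * DIM('a))))) borel (inversion r))"
  then have A: "A \<in> sets borel" by simp
  then have [measurable]: "inversion r -` A \<in> sets borel"
    using measurable_sets_borel[OF measurable_inversion] by blast
  show "emeasure (distr (density lborel (\<lambda>x::'a. ennreal ((r / norm x) ^ (2 * DIM('a))))) borel (inversion r)) A = emeasure lborel A"
    using nn_integral_inversion[OF r, of "indicator A"] A
    by (subst emeasure_distr) (auto simp: emeasure_density indicator_vimage)
qed auto

lemma integrable_inversion_iff:
  fixes f :: "'a::euclidean_space \<Rightarrow> real"
  assumes "r > 0" and [measurable]: "f \<in> borel_measurable borel"
  shows "integrable lborel (\<lambda>x. (r / norm x) ^ (2 * DIM('a)) * f (inversion r x)) \<longleftrightarrow> integrable lborel f"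
proof -
  let ?D = "density lborel (\<lambda>x::'a. ennreal ((r / norm x) ^ (2 * DIM('a))))"
  have "integrable lborel f \<longleftrightarrow> integrable (distr ?D borel (inversion r)) f"
    by (simp only: lborel_inversion[OF assms(1)])
  also have "\<dots> \<longleftrightarrow> integrable ?D (\<lambda>x. f (inversion r x))"
    by (rule integrable_distr_eq) auto
  also have "\<dots> \<longleftrightarrow> integrable lborel (\<lambda>x. (r / norm x) ^ (2 * DIM('a)) * f (inversion r x))"
    using assms(1) by (subst integrable_real_density) auto
  finally show ?thesis ..
qed

lemma integral_inversion:
  fixes f :: "'a::euclidean_space \<Rightarrow> real"
  assumes "r > 0" and [measurable]: "f \<in> borel_measurable borel"
  shows "(\<integral>x. (r / norm x) ^ (2 * DIM('a)) * f (inversion r x) \<partial>lborel) = (\<integral>x. f x \<partial>lborel)"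
proof -
  let ?D = "density lborel (\<lambda>x::'a. ennreal ((r / norm x) ^ (2 * DIM('a))))"
  have "integral\<^sup>L lborel f = integral\<^sup>L (distr ?D borel (inversion r)) f"
    by (simp only: lborel_inversion[OF assms(1)])
  also have "\<dots> = (\<integral>x. f (inversion r x) \<partial>?D)"
    by (rule integral_distr) auto
  also have "\<dots> = (\<integral>x. (r / norm x) ^ (2 * DIM('a)) * f (inversion r x) \<partial>lborel)"
    using assms(1) by (subst integral_real_density) auto
  finally show ?thesis ..
qed

section \<open>The fractional kernel and principal values\<close>

definition kern :: "real \<Rightarrow> 'a::euclidean_space \<Rightarrow> real" where
  "kern \<alpha> z = norm z powr - (real DIM('a) + \<alpha>)"

text \<open>Borel counterpart of \<open>L_space\<close> for signed functions, stable under
  differences, Kelvin transforms and translations. Bochner integrability of the quotient already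
  includes that of its absolute value.\<close>

definition tail_integrable :: "real \<Rightarrow> ('a::euclidean_space \<Rightarrow> real) \<Rightarrow> bool" where
  "tail_integrable \<alpha> f \<longleftrightarrow> f \<in> borel_measurable borel \<and>
     integrable lborel (\<lambda>x. f x / (1 + norm x powr (real DIM('a) + \<alpha>)))"

text \<open>The normalization constant is divided out, and the integral is over
  \<open>lborel\<close>, the measure for which inversion is available as a change of
  variables.\<close>

definition pv :: "real \<Rightarrow> ('a::euclidean_space \<Rightarrow> real) \<Rightarrow> 'a \<Rightarrow> real \<Rightarrow> bool" where
  "pv \<alpha> f y l \<longleftrightarrow>
     ((\<lambda>\<epsilon>. LINT z:- ball y \<epsilon>|lborel. (f y - f z) * kern \<alpha> (y - z)) \<longlongrightarrow> l) (at_right 0)"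

text \<open>At the centre of the sphere both the inversion and the Kelvin transform take the junk
  value \<open>0\<close>, so statements about them exclude that point.\<close>

definition kelvin :: "real \<Rightarrow> real \<Rightarrow> ('a::euclidean_space \<Rightarrow> real) \<Rightarrow> 'a \<Rightarrow> real" where
  "kelvin \<alpha> r f y = (r / norm y) powr (real DIM('a) - \<alpha>) * f (inversion r y)"

lemma kern_nonneg [simp]: "0 \<le> kern \<alpha> z"
  by (simp add: kern_def)

lemma kern_pos [simp]: "0 < kern \<alpha> z \<longleftrightarrow> z \<noteq> 0"
  by (simp add: kern_def)

lemma measurable_kern [measurable]: "kern \<alpha> \<in> borel_measurable borel"
  unfolding kern_def by measurable

lemma measurable_kelvin [measurable]:
  assumes [measurable]: "f \<in> borel_measurable borel"
  shows "kelvin \<alpha> r f \<in> borel_measurable borel"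
  unfolding kelvin_def by measurable

lemma tail_integrableD [measurable_dest]: "tail_integrable \<alpha> f \<Longrightarrow> f \<in> borel_measurable borel"
  by (simp add: tail_integrable_def)

section \<open>Integrability against the weight, and linearity of the principal value\<close>

lemma powr_divide_minus:
  fixes a b :: real
  assumes "0 < a" "0 < b"
  shows "(a / b) powr - x = (b / a) powr x"
  using assms by (simp add: powr_def ln_div algebra_simps)

text \<open>Where \<open>norm x\<close> lies between \<open>2^k\<close> and \<open>2^(k+1)\<close>
  the function is at most \<open>2 powr (- (n + \<alpha>) * k)\<close>, while the ball of radius
  \<open>2^(k+1)\<close> has volume of order \<open>2^(nk)\<close>; the sum is geometric with ratio
  \<open>2 powr - \<alpha>\<close>.\<close>

lemma integrable_weight:
  assumes "0 < \<alpha>"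
  shows "integrable lborel (\<lambda>x::'a::euclidean_space. 1 / (1 + norm x powr (real DIM('a) + \<alpha>)))"
proof (rule integrableI_bounded)
  let ?s = "real DIM('a) + \<alpha>"
  let ?g = "\<lambda>k x. ennreal (2 powr (- ?s * real k)) * indicator (ball (0::'a) (2 ^ Suc k)) x"
  show "(\<lambda>x::'a. 1 / (1 + norm x powr ?s)) \<in> borel_measurable lborel" by measurable
  have term_le: "h k \<le> (\<Sum>k. h k)" for h :: "nat \<Rightarrow> ennreal" and k
    using sum_le_suminf[of h "{k}"] by simp
  have le: "ennreal (norm (1 / (1 + norm x powr ?s))) \<le> (\<Sum>k. ?g k x)" for x :: 'a
  proof -
    obtain k where k: "ennreal (norm (1 / (1 + norm x powr ?s))) \<le> ?g k x"
    proof (cases "norm x < 1")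
      case True
      then have "ennreal (norm (1 / (1 + norm x powr ?s))) \<le> ?g 0 x"
        by (simp add: divide_le_eq add_pos_nonneg)
      then show ?thesis by (rule that)
    next
      case False
      define k where "k = nat \<lfloor>log 2 (norm x)\<rfloor>"
      have l0: "0 \<le> log 2 (norm x)" using False by (intro zero_le_log_cancel_iff[THEN iffD2]) auto
      have "real k \<le> log 2 (norm x)" "log 2 (norm x) < real k + 1"
        using l0 unfolding k_def by linarith+
      moreover have l2: "2 powr log 2 (norm x) = norm x"
        using False by (intro powr_log_cancel) linarith+
      ultimately have a: "2 powr real k \<le> norm x" and b: "norm x < 2 powr (real k + 1)"
        using False powr_mono[of "real k" "log 2 (norm x)" 2] powr_less_mono[of "log 2 (norm x)" "real k + 1" 2]
          l2 by auto
      have "2 powr (?s * real k) = (2 powr real k) powr ?s"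
        by (simp add: powr_powr mult.commute)
      also have "\<dots> \<le> norm x powr ?s"
        using a assms by (intro powr_mono2) auto
      finally have "2 powr (?s * real k) \<le> 1 + norm x powr ?s" by simp
      then have "1 / (1 + norm x powr ?s) \<le> 1 / 2 powr (?s * real k)"
        by (intro divide_left_mono) (auto intro!: mult_pos_pos add_pos_nonneg)
      also have "1 / 2 powr (?s * real k) = 2 powr (- ?s * real k)"
        by (simp only: mult_minus_left powr_minus_divide)
      finally have 1: "1 / (1 + norm x powr ?s) \<le> 2 powr (- ?s * real k)" .
      have "2 powr (real k + 1) = (2::real) ^ Suc k"
        using powr_realpow[of "2::real" "Suc k"] by (simp add: add.commute)
      with b have "x \<in> ball 0 (2 ^ Suc k)" by simp
      then have "ennreal (norm (1 / (1 + norm x powr ?s))) \<le> ?g k x"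
        using 1 by (simp add: ennreal_leI)
      then show ?thesis by (rule that)
    qed
    also have "?g k x \<le> (\<Sum>k. ?g k x)" by (rule term_le)
    finally show ?thesis .
  qed
  have "(\<integral>\<^sup>+(x::'a). ennreal (norm (1 / (1 + norm x powr ?s))) \<partial>lborel) \<le> (\<integral>\<^sup>+x. (\<Sum>k. ?g k x) \<partial>lborel)"
    by (intro nn_integral_mono le)
  also have "\<dots> = (\<Sum>k. \<integral>\<^sup>+x. ?g k x \<partial>lborel)"
  proof (rule nn_integral_suminf)
    show "?g k \<in> borel_measurable lborel" for k
      by (intro borel_measurable_times_ennreal borel_measurable_const borel_measurable_indicator) auto
  qed
  also have "\<dots> = (\<Sum>k. ennreal (unit_ball_vol DIM('a) * 2 ^ DIM('a) * (2 powr - \<alpha>) ^ k))"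
  proof (intro suminf_cong)
    fix k
    have "(\<integral>\<^sup>+x. ?g k x \<partial>lborel) = ennreal (2 powr (- ?s * real k)) * emeasure lborel (ball (0::'a) (2 ^ Suc k))"
      by (rule nn_integral_cmult_indicator) simp
    also have "\<dots> = ennreal (2 powr (- ?s * real k) * (unit_ball_vol DIM('a) * (2 ^ Suc k) ^ DIM('a)))"
      by (simp add: emeasure_ball ennreal_mult'')
    also have "2 powr (- ?s * real k) * (unit_ball_vol DIM('a) * (2 ^ Suc k) ^ DIM('a))
        = unit_ball_vol DIM('a) * 2 ^ DIM('a) * (2 powr - \<alpha>) ^ k"
    proof -
      have "(2 ^ Suc k) ^ DIM('a) = 2 ^ DIM('a) * (2::real) powr (real DIM('a) * real k)"
        by (simp add: powr_realpow[symmetric] power_mult_distrib powr_powr mult.commute)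
      moreover have "(2 powr - \<alpha>) ^ k = (2::real) powr (- \<alpha> * real k)"
        by (simp add: powr_realpow[symmetric] powr_powr)
      moreover have "2 powr (- ?s * real k) * 2 powr (real DIM('a) * real k) = (2::real) powr (- \<alpha> * real k)"
        by (simp add: powr_add[symmetric] algebra_simps)
      ultimately show ?thesis by (simp add: mult_ac)
    qed
    finally show "(\<integral>\<^sup>+x. ?g k x \<partial>lborel) = ennreal (unit_ball_vol DIM('a) * 2 ^ DIM('a) * (2 powr - \<alpha>) ^ k)" .
  qed
  also have "\<dots> < \<infinity>"
  proof -
    have "(2::real) powr - \<alpha> < 1" using assms by (simp add: powr_less_one)
    then have "summable (\<lambda>k. unit_ball_vol DIM('a) * 2 ^ DIM('a) * (2 powr - \<alpha>) ^ k)"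
      by (intro summable_mult summable_geometric) auto
    then show ?thesis
      by (subst suminf_ennreal2) auto
  qed
  finally show "(\<integral>\<^sup>+(x::'a). ennreal (norm (1 / (1 + norm x powr ?s))) \<partial>lborel) < \<infinity>" .
qed

lemma weight_pos [simp]: "0 < 1 + norm x powr s" "1 + norm x powr s \<noteq> 0" "0 \<le> 1 + norm x powr s"
proof -
  show "0 < 1 + norm x powr s" by (simp add: add_pos_nonneg)
  then show "1 + norm x powr s \<noteq> 0" "0 \<le> 1 + norm x powr s" by simp_all
qed

lemma tail_integrable_const: "0 < \<alpha> \<Longrightarrow> tail_integrable \<alpha> (\<lambda>_::'a::euclidean_space. c)"
  using integrable_mult_right[of c, OF integrable_weight[where 'a='a, of \<alpha>]]
  by (auto simp: tail_integrable_def)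

lemma tail_integrable_add:
  "tail_integrable \<alpha> f \<Longrightarrow> tail_integrable \<alpha> g \<Longrightarrow> tail_integrable \<alpha> (\<lambda>x. f x + g x)"
  by (auto simp: tail_integrable_def add_divide_distrib)

lemma tail_integrable_cmult:
  "tail_integrable \<alpha> f \<Longrightarrow> tail_integrable \<alpha> (\<lambda>x. c * f x)"
  by (auto simp: tail_integrable_def times_divide_eq_right[symmetric] simp del: times_divide_eq_right)

lemma tail_integrable_diff:
  "tail_integrable \<alpha> f \<Longrightarrow> tail_integrable \<alpha> g \<Longrightarrow> tail_integrable \<alpha> (\<lambda>x. f x - g x)"
  by (auto simp: tail_integrable_def diff_divide_distrib)

lemma integrable_mult_bounded:
  fixes f g :: "'a \<Rightarrow> real"
  assumes "integrable M f" and [measurable]: "g \<in> borel_measurable M"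
    and "\<And>x. \<bar>g x\<bar> \<le> C"
  shows "integrable M (\<lambda>x. g x * f x)"
proof (rule Bochner_Integration.integrable_bound)
  show "integrable M (\<lambda>x. C * f x)" using assms(1) by simp
  show "(\<lambda>x. g x * f x) \<in> borel_measurable M" using assms(1) by measurable
  show "AE x in M. norm (g x * f x) \<le> norm (C * f x)"
    using assms(3) by (auto simp: abs_mult intro!: AE_I2 mult_right_mono order_trans[OF assms(3)])
qed

lemma set_integrable_tail_kern:
  fixes f :: "'a::euclidean_space \<Rightarrow> real"
  assumes "0 < \<alpha>" and f: "tail_integrable \<alpha> f" and [measurable]: "A \<in> sets borel"
    and e: "0 < e" "A \<subseteq> - ball y e"
  shows "set_integrable lborel A (\<lambda>z. f z * kern \<alpha> (y - z))"
proof -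
  let ?s = "real DIM('a) + \<alpha>"
  \<comment> \<open>Bounds the kernel times the weight. The first summand is the kernel bound at
    distance \<open>e\<close>; the second comes from
    \<open>norm z \<le> (1 + norm y / e) * norm (y - z)\<close>, valid at distance at least
    \<open>e\<close> from \<open>y\<close>.\<close>
  define C where "C = e powr - ?s + (1 + norm y / e) powr ?s"
  define g where "g = (\<lambda>z. indicator A z * kern \<alpha> (y - z) * (1 + norm z powr ?s))"
  have "\<bar>g z\<bar> \<le> C" for z
  proof (cases "z \<in> A")
    case True
    then have ze: "e \<le> norm (y - z)" using e by (auto simp: dist_norm)
    have "norm z \<le> norm (y - z) + norm y"
      using norm_triangle_ineq4[of y "y - z"] by simp
    also have "\<dots> \<le> (1 + norm y / e) * norm (y - z)"
      using mult_left_mono[OF ze, of "norm y / e"] e(1) by (simp add: algebra_simps)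
    finally have "norm z powr ?s \<le> ((1 + norm y / e) * norm (y - z)) powr ?s"
      using assms(1) by (intro powr_mono2) auto
    also have "\<dots> = (1 + norm y / e) powr ?s * norm (y - z) powr ?s"
      using e by (intro powr_mult)
    finally have "norm z powr ?s * kern \<alpha> (y - z) \<le> (1 + norm y / e) powr ?s * norm (y - z) powr ?s * kern \<alpha> (y - z)"
      by (intro mult_right_mono) auto
    also have "\<dots> = (1 + norm y / e) powr ?s"
      using ze e by (simp only: kern_def powr_minus_divide) auto
    finally have 1: "norm z powr ?s * kern \<alpha> (y - z) \<le> (1 + norm y / e) powr ?s" .
    have "kern \<alpha> (y - z) \<le> e powr - ?s"
      unfolding kern_def using ze e assms(1) by (intro powr_mono2') auto
    with 1 show ?thesis using True by (simp add: g_def C_def algebra_simps)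
  qed (auto simp: g_def C_def)
  moreover have "g \<in> borel_measurable lborel" unfolding g_def by measurable
  ultimately have "integrable lborel (\<lambda>z. g z * (f z / (1 + norm z powr ?s)))"
    using f by (intro integrable_mult_bounded[where C=C]) (auto simp: tail_integrable_def)
  moreover have "(\<lambda>z. g z * (f z / (1 + norm z powr ?s))) = (\<lambda>z. indicator A z *\<^sub>R (f z * kern \<alpha> (y - z)))"
    by (auto simp: g_def fun_eq_iff)
  ultimately show ?thesis by (simp add: set_integrable_def)
qed

lemma set_integrable_pv:
  fixes f :: "'a::euclidean_space \<Rightarrow> real"
  assumes "0 < \<alpha>" and "tail_integrable \<alpha> f" and "A \<in> sets borel"
    and "0 < e" "A \<subseteq> - ball y e"
  shows "set_integrable lborel A (\<lambda>z. (f y - f z) * kern \<alpha> (y - z))"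
  using assms by (intro set_integrable_tail_kern tail_integrable_diff tail_integrable_const)

lemma pv_add:
  assumes "0 < \<alpha>" "tail_integrable \<alpha> f" "tail_integrable \<alpha> g" "pv \<alpha> f y l" "pv \<alpha> g y m"
  shows "pv \<alpha> (\<lambda>x. f x + g x) y (l + m)"
proof -
  have "((\<lambda>\<epsilon>. (LINT z:- ball y \<epsilon>|lborel. (f y - f z) * kern \<alpha> (y - z))
          + (LINT z:- ball y \<epsilon>|lborel. (g y - g z) * kern \<alpha> (y - z))) \<longlongrightarrow> l + m) (at_right 0)"
    using assms(4,5) unfolding pv_def by (rule tendsto_add)
  moreover have "\<forall>\<^sub>F \<epsilon> in at_right 0. (LINT z:- ball y \<epsilon>|lborel. (f y - f z) * kern \<alpha> (y - z))
          + (LINT z:- ball y \<epsilon>|lborel. (g y - g z) * kern \<alpha> (y - z))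
       = (LINT z:- ball y \<epsilon>|lborel. ((f y + g y) - (f z + g z)) * kern \<alpha> (y - z))"
    using eventually_at_right_less[of 0]
  proof eventually_elim
    case (elim \<epsilon>)
    have "((f y + g y) - (f z + g z)) * kern \<alpha> (y - z) = (f y - f z) * kern \<alpha> (y - z) + (g y - g z) * kern \<alpha> (y - z)" for z
      by (simp add: algebra_simps)
    then show ?case
      using assms elim by (simp add: set_integral_add set_integrable_pv[where e=\<epsilon>])
  qed
  ultimately show ?thesis unfolding pv_def by (rule Lim_transform_eventually)
qed

lemma pv_cmult:
  assumes "pv \<alpha> f y l"
  shows "pv \<alpha> (\<lambda>x. c * f x) y (c * l)"
proof -
  have "(\<lambda>\<epsilon>. LINT z:- ball y \<epsilon>|lborel. (c * f y - c * f z) * kern \<alpha> (y - z))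
     = (\<lambda>\<epsilon>. c * (LINT z:- ball y \<epsilon>|lborel. (f y - f z) * kern \<alpha> (y - z)))"
    by (simp add: right_diff_distrib[symmetric] mult.assoc)
  then show ?thesis using tendsto_mult_left[OF assms[unfolded pv_def], of c]
    by (simp add: pv_def)
qed

lemma pv_const: "pv \<alpha> (\<lambda>_. c) y 0"
  by (simp add: pv_def)

lemma pv_diff:
  assumes "0 < \<alpha>" "tail_integrable \<alpha> f" "tail_integrable \<alpha> g" "pv \<alpha> f y l" "pv \<alpha> g y m"
  shows "pv \<alpha> (\<lambda>x. f x - g x) y (l - m)"
  using pv_add[OF assms(1,2) tail_integrable_cmult[OF assms(3), of "-1"] assms(4) pv_cmult[OF assms(5), of "-1"]]
  by simp

lemma pv_unique: "pv \<alpha> f y l \<Longrightarrow> pv \<alpha> f y m \<Longrightarrow> l = m"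
  unfolding pv_def by (rule tendsto_unique[rotated]) auto

text \<open>The transform exchanges growth of \<open>f\<close> at infinity with integrability at the
  origin; the class survives because inversion carries the weight to a comparable one.\<close>

lemma tail_integrable_kelvin:
  fixes f :: "'a::euclidean_space \<Rightarrow> real"
  assumes "0 < \<alpha>" "0 < r" and f: "tail_integrable \<alpha> f"
  shows "tail_integrable \<alpha> (kelvin \<alpha> r f)"
proof -
  let ?s = "real DIM('a) + \<alpha>"
  have [measurable]: "f \<in> borel_measurable borel" using f by measurable
  \<comment> \<open>Compares the weight transported by the inversion with the original one. With
    \<open>q = r powr s\<close> and \<open>t = norm z powr s\<close> it equals
    \<open>q (1 + t) / (t + q^2)\<close>, which is at most \<open>q + 1/q\<close>, the constant
    \<open>C\<close>.\<close>
  define h where "h = (\<lambda>z::'a. (r / norm z) powr ?s / (1 + (r\<^sup>2 / norm z) powr ?s) * (1 + norm z powr ?s))"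
  define C where "C = r powr ?s + r powr - ?s"
  have "\<bar>h z\<bar> \<le> C" for z
  proof (cases "z = 0")
    case False
    define t where "t = norm z powr ?s"
    define q where "q = r powr ?s"
    have t: "t > 0" and q: "q > 0" using False assms by (auto simp: t_def q_def)
    have "h z = (q / t) / (1 + q\<^sup>2 / t) * (1 + t)"
      using assms by (simp add: h_def q_def t_def powr_divide powr_power power2_eq_square powr_mult)
    also have "\<dots> = (q + q * t) / (t + q\<^sup>2)" using t q by (simp add: field_simps)
    also have "\<dots> \<le> q + 1 / q"
      using t q by (subst pos_divide_le_eq) (auto simp: field_simps power2_eq_square intro!: add_pos_pos)
    finally have "h z \<le> C" by (simp only: C_def q_def powr_minus_divide)
    moreover have "0 \<le> h z" by (simp add: h_def add_nonneg_nonneg)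
    ultimately show ?thesis by simp
  qed (auto simp: h_def C_def)
  moreover have "h \<in> borel_measurable lborel" unfolding h_def by measurable
  ultimately have "integrable lborel (\<lambda>z. h z * (f z / (1 + norm z powr ?s)))"
    using f by (intro integrable_mult_bounded[where C=C]) (auto simp: tail_integrable_def)
  moreover have "(\<lambda>z. h z * (f z / (1 + norm z powr ?s))) = (\<lambda>z. (r / norm z) powr ?s / (1 + (r\<^sup>2 / norm z) powr ?s) * f z)" (is "_ = ?g")
    by (auto simp: h_def fun_eq_iff)
  ultimately have "integrable lborel ?g" by simp
  then have "integrable lborel (\<lambda>x. (r / norm x) ^ (2 * DIM('a)) * ?g (inversion r x))"
    by (subst integrable_inversion_iff[OF assms(2)]) auto
  moreover have "(r / norm x) ^ (2 * DIM('a)) * ?g (inversion r x) = kelvin \<alpha> r f x / (1 + norm x powr ?s)" for x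
  proof (cases "x = 0")
    case False
    have "(r / norm x) ^ (2 * DIM('a)) = (r / norm x) powr (2 * real DIM('a))"
      using False assms by (subst powr_realpow[symmetric]) auto
    moreover have "r / norm (inversion r x) = norm x / r" "r\<^sup>2 / norm (inversion r x) = norm x"
      using False assms by (auto simp: norm_inversion power2_eq_square)
    moreover have "(r / norm x) powr (2 * real DIM('a)) * (norm x / r) powr ?s = (r / norm x) powr (real DIM('a) - \<alpha>)"
    proof -
      have "(norm x / r) powr ?s = (r / norm x) powr - ?s"
        using False assms by (intro powr_divide_minus[symmetric]) auto
      then show ?thesis by (simp add: powr_add[symmetric])
    qed
    ultimately show ?thesis
      by (simp add: kelvin_def)
  qed (simp add: kelvin_def)
  ultimately have "integrable lborel (\<lambda>x. kelvin \<alpha> r f x / (1 + norm x powr ?s))" by simp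
  then show ?thesis by (simp add: tail_integrable_def)
qed

section \<open>Principal values under inversion\<close>

lemma differentiable_local_bound:
  fixes f :: "'a::real_normed_vector \<Rightarrow> real"
  assumes "f differentiable (at y)"
  obtains M \<rho> where "M \<ge> 0" "\<rho> > 0" "\<And>z. norm (z - y) < \<rho> \<Longrightarrow> \<bar>f y - f z\<bar> \<le> M * norm (z - y)"
proof -
  obtain D where D: "(f has_derivative D) (at y)"
    using assms by (auto simp: differentiable_def)
  then obtain K where K: "K > 0" "\<And>h. norm (D h) \<le> norm h * K"
    using has_derivative_bounded_linear bounded_linear.pos_bounded by blast
  obtain \<rho> where \<rho>: "\<rho> > 0" "\<And>z. norm (z - y) < \<rho> \<Longrightarrow> norm (f z - f y - D (z - y)) \<le> 1 * norm (z - y)"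
    using D unfolding has_derivative_at_alt by (metis zero_less_one)
  have "\<bar>f y - f z\<bar> \<le> (K + 1) * norm (z - y)" if "norm (z - y) < \<rho>" for z
    using \<rho>(2)[OF that] K(2)[of "z - y"] by (auto simp: algebra_simps)
  with K(1) \<rho>(1) show ?thesis by (intro that[of "K + 1" \<rho>]) auto
qed

lemma pow_diff_bound:
  fixes t :: real
  assumes "0 \<le> t" "t \<le> 1"
  shows "(1 + t) ^ n - (1 - t) ^ n \<le> 2 ^ n * real n * t"
proof -
  have "norm (((1 + t) / 2) ^ n - ((1 - t) / 2) ^ n) \<le> real n * norm ((1 + t) / 2 - (1 - t) / 2)"
    using assms by (intro norm_power_diff) auto
  also have "(1 + t) / 2 - (1 - t) / 2 = t" by (simp add: field_simps)
  finally have "((1 + t) / 2) ^ n - ((1 - t) / 2) ^ n \<le> real n * t" using assms by auto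
  moreover have "((1 + t) / 2) ^ n - ((1 - t) / 2) ^ n = ((1 + t) ^ n - (1 - t) ^ n) / 2 ^ n"
    by (simp only: power_divide diff_divide_distrib[of "(1 + t) ^ n"])
  ultimately show ?thesis by (simp add: field_simps)
qed

lemma shell_measure:
  fixes y :: "'a::euclidean_space"
  assumes "0 < e" "0 \<le> t" "t \<le> 1"
  shows "measure lborel (cball y (e * (1 + t)) - ball y (e * (1 - t)))
    \<le> unit_ball_vol DIM('a) * e ^ DIM('a) * (2 ^ DIM('a) * real DIM('a) * t)"
proof -
  have "measure lborel (cball y (e * (1 + t)) - ball y (e * (1 - t)))
     = measure lborel (cball y (e * (1 + t))) - measure lborel (ball y (e * (1 - t)))"
  proof (rule measure_Diff)
    have "e * (1 - t) \<le> e * (1 + t)" using assms by (intro mult_left_mono) auto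
    then show "ball y (e * (1 - t)) \<subseteq> cball y (e * (1 + t))" by auto
  qed (use emeasure_lborel_cball_finite[of y "e * (1 + t)"] in auto)
  also have "\<dots> = unit_ball_vol DIM('a) * e ^ DIM('a) * ((1 + t) ^ DIM('a) - (1 - t) ^ DIM('a))"
    using assms by (simp add: content_cball content_ball power_mult_distrib right_diff_distrib[of "unit_ball_vol _"] right_diff_distrib[of "e ^ _"] mult.assoc)
  also have "\<dots> \<le> unit_ball_vol DIM('a) * e ^ DIM('a) * (2 ^ DIM('a) * real DIM('a) * t)"
    using assms by (intro mult_left_mono pow_diff_bound) auto
  finally show ?thesis .
qed

text \<open>The set below is the preimage of the complement of a ball under inversion. Replacing one
  region by the other costs \<open>O(\<epsilon>\<^sup>2\<^sup>-\<^sup>\<alpha>)\<close>: the two differ by a shell of relative width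
  \<open>O(\<epsilon>)\<close>, on which the first-order bound on \<open>f\<close> suffices.\<close>

lemma shell_tendsto:
  fixes f :: "'a::euclidean_space \<Rightarrow> real" and y :: 'a
  assumes \<alpha>: "0 < \<alpha>" "\<alpha> < 2" and f: "tail_integrable \<alpha> f" "f differentiable (at y)" and y: "y \<noteq> 0"
  shows "((\<lambda>\<epsilon>. (LINT z:{z. \<epsilon> * norm z \<le> norm (y - z) * norm y}|lborel. (f y - f z) * kern \<alpha> (y - z))
       - (LINT z:- ball y \<epsilon>|lborel. (f y - f z) * kern \<alpha> (y - z))) \<longlongrightarrow> 0) (at_right 0)"
proof -
  let ?s = "real DIM('a) + \<alpha>"
  define F where "F = (\<lambda>z. (f y - f z) * kern \<alpha> (y - z))"
  define E where "E = (\<lambda>\<epsilon>. {z. \<epsilon> * norm z \<le> norm (y - z) * norm y})"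
  obtain M \<rho> where M: "M \<ge> 0" "\<rho> > 0" "\<And>z. norm (z - y) < \<rho> \<Longrightarrow> \<bar>f y - f z\<bar> \<le> M * norm (z - y)"
    using differentiable_local_bound[OF f(2)] by blast
  have [measurable]: "f \<in> borel_measurable borel" "E \<epsilon> \<in> sets borel" for \<epsilon>
    using f unfolding E_def by measurable
  \<comment> \<open>Membership in \<open>E \<epsilon>\<close> compares \<open>norm (y - z)\<close>
    with \<open>\<epsilon> * norm z / norm y\<close>, and near \<open>y\<close> the ratio
    \<open>norm z / norm y\<close> differs from 1 by about \<open>\<epsilon> / norm y\<close>. The
    factor 2 absorbs the error made in solving for \<open>norm (y - z)\<close> when
    \<open>\<epsilon> < norm y / 4\<close>.\<close>
  define c where "c = 2 / norm y"
  have c: "c > 0" using y by (simp add: c_def)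
  define K where "K = M * 2 * (1 / 2) powr - ?s * unit_ball_vol DIM('a) * 2 ^ DIM('a) * real DIM('a) * c"
  have bound: "norm ((LINT z:E \<epsilon>|lborel. F z) - (LINT z:- ball y \<epsilon>|lborel. F z)) \<le> K * \<epsilon> powr (2 - \<alpha>)"
    if \<epsilon>: "0 < \<epsilon>" "\<epsilon> < \<rho> / 2" "\<epsilon> < norm y / 4" for \<epsilon>
  proof -
    have ce: "c * \<epsilon> \<le> 1 / 2" using \<epsilon> y by (simp add: c_def field_simps)
    define A where "A = cball y (\<epsilon> * (1 + c * \<epsilon>)) - ball y (\<epsilon> * (1 - c * \<epsilon>))"
    define b where "b = M * (2 * \<epsilon>) * (\<epsilon> / 2) powr - ?s"
    have EA: "z \<in> A" if "z \<in> E \<epsilon> \<longleftrightarrow> z \<in> ball y \<epsilon>" for z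
    proof -
      define d where "d = norm (y - z)"
      have tri: "norm y - d \<le> norm z" "norm z \<le> norm y + d"
        using norm_triangle_ineq2[of y z] norm_triangle_ineq4[of y "y - z"] by (auto simp: d_def)
      show ?thesis
      proof (cases "d < \<epsilon>")
        case True
        with that have "\<epsilon> * norm z \<le> d * norm y" by (auto simp: E_def d_def dist_norm)
        moreover have "\<epsilon> * (norm y - \<epsilon>) \<le> \<epsilon> * norm z"
          using tri True \<epsilon> by (intro mult_left_mono) auto
        ultimately have "\<epsilon> * (norm y - \<epsilon>) \<le> d * norm y" by linarith
        then have "\<epsilon> * (1 - \<epsilon> / norm y) \<le> d" using y by (simp add: field_simps)
        moreover have "\<epsilon> * (1 - c * \<epsilon>) \<le> \<epsilon> * (1 - \<epsilon> / norm y)"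
          using \<epsilon> y by (intro mult_left_mono) (auto simp: c_def field_simps)
        moreover have "\<epsilon> \<le> \<epsilon> * (1 + c * \<epsilon>)" using \<epsilon> c by (simp add: algebra_simps)
        ultimately show ?thesis using True by (simp add: A_def d_def dist_norm)
      next
        case False
        with that have "d * norm y < \<epsilon> * norm z" by (auto simp: E_def d_def dist_norm)
        also have "\<epsilon> * norm z \<le> \<epsilon> * (norm y + d)" using tri \<epsilon> by (intro mult_left_mono) auto
        finally have d1: "d * (norm y - \<epsilon>) < \<epsilon> * norm y" by (simp add: algebra_simps)
        have "\<epsilon> * norm y \<le> \<epsilon> * (1 + c * \<epsilon>) * (norm y - \<epsilon>)"
        proof -
          have "2 * \<epsilon> * \<epsilon> \<le> norm y * \<epsilon>" using \<epsilon> by (intro mult_right_mono) auto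
          then have "norm y \<le> (1 + c * \<epsilon>) * (norm y - \<epsilon>)"
            using \<epsilon> y by (simp add: c_def field_simps)
          then show ?thesis using \<epsilon> by (simp add: mult.assoc)
        qed
        with d1 have "d * (norm y - \<epsilon>) < \<epsilon> * (1 + c * \<epsilon>) * (norm y - \<epsilon>)" by linarith
        moreover have "0 < norm y - \<epsilon>" using \<epsilon> by linarith
        ultimately have "d < \<epsilon> * (1 + c * \<epsilon>)" by (simp only: mult_less_cancel_right_pos)
        moreover have "\<epsilon> * (1 - c * \<epsilon>) \<le> \<epsilon>" using \<epsilon> c by (simp add: algebra_simps)
        ultimately show ?thesis using False by (simp add: A_def d_def dist_norm)
      qed
    qed
    have half: "\<epsilon> / 2 \<le> \<epsilon> * (1 - c * \<epsilon>)" "\<epsilon> * (1 + c * \<epsilon>) \<le> 2 * \<epsilon>"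
      using mult_left_mono[OF ce, of \<epsilon>] \<epsilon> by (simp_all add: right_diff_distrib distrib_left)
    have Fb: "\<bar>F z\<bar> \<le> b" if "z \<in> A" for z
    proof -
      have d: "\<epsilon> / 2 \<le> norm (y - z)" "norm (y - z) \<le> 2 * \<epsilon>"
        using that half by (auto simp: A_def dist_norm)
      have "\<bar>f y - f z\<bar> \<le> M * norm (z - y)"
        using d \<epsilon> by (intro M(3)) (auto simp: norm_minus_commute)
      also have "\<dots> \<le> M * (2 * \<epsilon>)" using d M(1) by (intro mult_left_mono) (auto simp: norm_minus_commute)
      finally have "\<bar>f y - f z\<bar> \<le> M * (2 * \<epsilon>)" .
      moreover have "kern \<alpha> (y - z) \<le> (\<epsilon> / 2) powr - ?s"
        unfolding kern_def using d \<epsilon> \<alpha> by (intro powr_mono2') auto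
      ultimately show ?thesis unfolding F_def b_def abs_mult
        using M(1) \<epsilon> by (intro mult_mono) auto
    qed
    have Esub: "E \<epsilon> \<subseteq> - ball y (\<epsilon> / 2)"
    proof
      fix z assume z: "z \<in> E \<epsilon>"
      show "z \<in> - ball y (\<epsilon> / 2)"
      proof (cases "z \<in> ball y \<epsilon>")
        case True
        then have "z \<in> A" using EA z by blast
        then show ?thesis using half by (auto simp: A_def)
      qed (use \<epsilon> in auto)
    qed
    have i1: "integrable lborel (\<lambda>z. indicator (E \<epsilon>) z *\<^sub>R F z)"
      using set_integrable_pv[OF \<alpha>(1) f(1) _ _ Esub] \<epsilon> by (simp add: set_integrable_def F_def)
    have i2: "integrable lborel (\<lambda>z. indicator (- ball y \<epsilon>) z *\<^sub>R F z)"
      using set_integrable_pv[OF \<alpha>(1) f(1), of "- ball y \<epsilon>" \<epsilon> y] \<epsilon> by (simp add: set_integrable_def F_def)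
    have A[measurable]: "A \<in> sets borel" by (simp add: A_def)
    have Afin: "emeasure lborel A < \<infinity>"
      unfolding A_def by (rule le_less_trans[OF emeasure_mono emeasure_lborel_cball_finite]) auto
    have "norm ((LINT z:E \<epsilon>|lborel. F z) - (LINT z:- ball y \<epsilon>|lborel. F z))
        = norm (\<integral>z. indicator (E \<epsilon>) z *\<^sub>R F z - indicator (- ball y \<epsilon>) z *\<^sub>R F z \<partial>lborel)"
      unfolding set_lebesgue_integral_def using i1 i2 by simp
    also have "\<dots> \<le> (\<integral>z. b * indicator A z \<partial>lborel)"
    proof (rule Bochner_Integration.integral_norm_bound_integral)
      show "integrable lborel (\<lambda>z. indicator (E \<epsilon>) z *\<^sub>R F z - indicator (- ball y \<epsilon>) z *\<^sub>R F z)"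
        using i1 i2 by simp
      show "integrable lborel (\<lambda>z. b * indicator A z :: real)"
        using Afin by (intro integrable_mult_right integrable_real_indicator) auto
      show "norm (indicator (E \<epsilon>) z *\<^sub>R F z - indicator (- ball y \<epsilon>) z *\<^sub>R F z) \<le> b * indicator A z" for z
      proof (cases "z \<in> A")
        case True
        then show ?thesis using Fb[OF True] by (auto simp: indicator_def)
      next
        case False
        then have "z \<in> E \<epsilon> \<longleftrightarrow> z \<in> - ball y \<epsilon>" using EA[of z] by auto
        then show ?thesis using False by (auto simp: indicator_def)
      qed
    qed
    also have "\<dots> = b * measure lborel A" by simp
    also have "\<dots> \<le> b * (unit_ball_vol DIM('a) * \<epsilon> ^ DIM('a) * (2 ^ DIM('a) * real DIM('a) * (c * \<epsilon>)))"
      unfolding A_def using \<epsilon> c ce M(1) by (intro mult_left_mono shell_measure) (auto simp: b_def)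
    \<comment> \<open>Powers of \<open>\<epsilon>\<close>: \<open>1 - (n + \<alpha>)\<close> from
      the bound \<open>b\<close> on the integrand, \<open>n + 1\<close> from the volume of the
      shell.\<close>
    also have "\<dots> = K * \<epsilon> powr (2 - \<alpha>)"
    proof -
      have "(\<epsilon> / 2) powr - ?s = (1 / 2) powr - ?s * \<epsilon> powr - ?s"
        using powr_mult[of "1/2" \<epsilon> "- ?s"] by simp
      moreover have "\<epsilon> powr (2 - \<alpha>) = \<epsilon> powr - ?s * \<epsilon> ^ DIM('a) * \<epsilon> * \<epsilon>"
      proof -
        have "\<epsilon> powr - ?s * \<epsilon> ^ DIM('a) * \<epsilon> * \<epsilon> = \<epsilon> powr - ?s * \<epsilon> powr real DIM('a) * \<epsilon> powr 1 * \<epsilon> powr 1"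
          using \<epsilon> by (simp add: powr_realpow)
        also have "\<dots> = \<epsilon> powr (2 - \<alpha>)" unfolding powr_add[symmetric] by simp
        finally show ?thesis ..
      qed
      ultimately show ?thesis by (simp add: b_def K_def mult_ac)
    qed
    finally show ?thesis .
  qed
  have "((\<lambda>\<epsilon>. (LINT z:E \<epsilon>|lborel. F z) - (LINT z:- ball y \<epsilon>|lborel. F z)) \<longlongrightarrow> 0) (at_right 0)"
  proof (rule Lim_null_comparison)
    show "\<forall>\<^sub>F \<epsilon> in at_right 0. norm ((LINT z:E \<epsilon>|lborel. F z) - (LINT z:- ball y \<epsilon>|lborel. F z)) \<le> K * \<epsilon> powr (2 - \<alpha>)"
      using M(2) y bound
      by (auto simp: eventually_at_right_field intro!: exI[of _ "min (\<rho> / 2) (norm y / 4)"])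
    have "((\<lambda>\<epsilon>. K * \<epsilon> powr (2 - \<alpha>)) \<longlongrightarrow> K * 0 powr (2 - \<alpha>)) (at_right 0)"
      using \<alpha> by (intro tendsto_mult tendsto_const tendsto_powr' tendsto_ident_at) (auto simp: eventually_at_right_less eventually_mono[OF eventually_at_right_less])
    then show "((\<lambda>\<epsilon>. K * \<epsilon> powr (2 - \<alpha>)) \<longlongrightarrow> 0) (at_right 0)" by simp
  qed
  then show ?thesis by (simp add: E_def F_def)
qed

lemma inversion_self:
  assumes "y \<noteq> 0"
  shows "inversion (norm y) y = y"
  using assms by (simp add: inversion_def)

lemma kern_inversion:
  fixes y z :: "'a::euclidean_space"
  assumes "0 < r" "y \<noteq> 0" "z \<noteq> 0"
  shows "kern \<alpha> (inversion r y - inversion r z)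
    = (r / norm y) powr - (real DIM('a) + \<alpha>) * (r / norm z) powr - (real DIM('a) + \<alpha>) * kern \<alpha> (y - z)"
proof -
  have "r\<^sup>2 * norm (y - z) / (norm y * norm z) = (r / norm y) * (r / norm z) * norm (y - z)"
    by (simp add: power2_eq_square)
  then show ?thesis
    unfolding kern_def norm_inversion_diff[OF assms(2,3)] using assms by (simp only: powr_mult)
qed

lemma power_eq_powr_dim:
  assumes "0 < x"
  shows "x ^ (2 * DIM('a::euclidean_space)) = x powr (2 * real DIM('a))"
  using assms by (simp add: powr_realpow[symmetric])

lemma differentiable_powr_norm:
  fixes y :: "'a::euclidean_space"
  assumes "y \<noteq> 0" "0 < r"
  shows "(\<lambda>z. (r / norm z) powr a) differentiable (at y)"
proof -
  have 1: "(\<lambda>z. r / norm z) differentiable (at y)"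
    using assms by (intro differentiable_divide differentiable_const differentiable_norm_at) auto
  have "((\<lambda>t. t powr a) has_real_derivative a * (r / norm y) powr (a - 1)) (at (r / norm y))"
    using assms by (intro has_real_derivative_powr) auto
  then have "(\<lambda>t. t powr a) differentiable (at (r / norm y))"
    by (auto simp: differentiable_def has_field_derivative_def)
  from differentiable_chain_at[OF 1 this] show ?thesis by (simp add: o_def)
qed

text \<open>Inversion in the sphere through \<open>y\<close> changes the sign of the integrand, so the principal
  value at \<open>y\<close> of the fundamental solution equals its own negative.\<close>

lemma pv_kelvin_one:
  fixes y :: "'a::euclidean_space"
  assumes \<alpha>: "0 < \<alpha>" "\<alpha> < 2" and y: "y \<noteq> 0" and "0 < r"
  shows "pv \<alpha> (kelvin \<alpha> r (\<lambda>_. 1)) y 0"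
proof -
  \<comment> \<open>A change of radius multiplies the transform of 1 by a constant only; the radius
    \<open>norm y\<close> makes \<open>y\<close> a fixed point of the inversion and gives
    \<open>G y = 1\<close>.\<close>
  define \<rho> where "\<rho> = norm y"
  have \<rho>: "\<rho> > 0" using y by (simp add: \<rho>_def)
  define G where "G = kelvin \<alpha> \<rho> (\<lambda>_::'a. 1)"
  define F where "F = (\<lambda>z. (G y - G z) * kern \<alpha> (y - z))"
  have tG: "tail_integrable \<alpha> G" unfolding G_def
    using \<alpha> \<rho> by (intro tail_integrable_kelvin tail_integrable_const)
  then have [measurable]: "G \<in> borel_measurable borel" by measurable
  have [measurable]: "F \<in> borel_measurable borel" unfolding F_def by measurable
  have dG: "G differentiable (at y)"
  proof -
    have "(\<lambda>z::'a. (\<rho> / norm z) powr (real DIM('a) - \<alpha>)) differentiable (at y)"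
      using y \<rho> by (rule differentiable_powr_norm)
    then show ?thesis by (simp add: G_def kelvin_def[abs_def])
  qed
  have Jy: "inversion \<rho> y = y" using inversion_self[OF y] by (simp add: \<rho>_def)
  have F: "(\<rho> / norm z) ^ (2 * DIM('a)) * F (inversion \<rho> z) = - F z" if z: "z \<noteq> 0" for z
  proof -
    define t where "t = \<rho> / norm z"
    have t: "t > 0" using z \<rho> by (simp add: t_def)
    have Gy: "G y = 1" using y by (simp add: G_def kelvin_def \<rho>_def)
    have Gz: "G z = t powr (real DIM('a) - \<alpha>)" by (simp add: G_def kelvin_def t_def)
    have "\<rho> / norm (inversion \<rho> z) = inverse t"
      using \<rho> z by (simp add: norm_inversion t_def power2_eq_square)
    then have GJ: "G (inversion \<rho> z) = t powr - (real DIM('a) - \<alpha>)"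
      using t by (simp add: G_def kelvin_def powr_def ln_inverse algebra_simps)
    have k: "kern \<alpha> (y - inversion \<rho> z) = t powr - (real DIM('a) + \<alpha>) * kern \<alpha> (y - z)"
      using kern_inversion[OF \<rho> y z, of \<alpha>] y by (simp add: inversion_self[OF y] t_def \<rho>_def)
    have "t powr (2 * real DIM('a)) * (1 - t powr - (real DIM('a) - \<alpha>)) * t powr - (real DIM('a) + \<alpha>)
        = t powr (real DIM('a) - \<alpha>) - 1"
      using t by (simp add: right_diff_distrib left_diff_distrib powr_add[symmetric])
    then have "t ^ (2 * DIM('a)) * ((1 - t powr - (real DIM('a) - \<alpha>)) * (t powr - (real DIM('a) + \<alpha>) * kern \<alpha> (y - z)))
        = (t powr (real DIM('a) - \<alpha>) - 1) * kern \<alpha> (y - z)"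
      by (simp only: power_eq_powr_dim[OF t, where 'a='a] mult.assoc[symmetric])
    then show ?thesis unfolding F_def GJ k Gy Gz t_def[symmetric] by (simp add: left_diff_distrib)
  qed
  have int: "(LINT z:- ball y \<epsilon>|lborel. F z) = - (LINT z:{z. \<epsilon> * norm z \<le> norm (y - z) * norm y}|lborel. F z)"
    (is "_ = - (LINT z:?E|lborel. F z)") if "\<epsilon> > 0" for \<epsilon>
  proof -
    have "(LINT z:- ball y \<epsilon>|lborel. F z) = (\<integral>z. indicator (- ball y \<epsilon>) z * F z \<partial>lborel)"
      by (simp add: set_lebesgue_integral_def)
    also have "\<dots> = (\<integral>z. (\<rho> / norm z) ^ (2 * DIM('a)) * (indicator (- ball y \<epsilon>) (inversion \<rho> z) * F (inversion \<rho> z)) \<partial>lborel)"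
      by (rule integral_inversion[symmetric]) (use \<rho> in auto)
    also have "\<dots> = (\<integral>z. - (indicator ?E z * F z) \<partial>lborel)"
    proof (rule integral_cong_AE)
      show "AE z in lborel. (\<rho> / norm z) ^ (2 * DIM('a)) * (indicator (- ball y \<epsilon>) (inversion \<rho> z) * F (inversion \<rho> z))
         = - (indicator ?E z * F z)"
        using AE_lborel_singleton[of "0::'a"]
      proof eventually_elim
        case (elim z)
        have nJ: "norm (y - inversion \<rho> z) = \<rho> * norm (y - z) / norm z"
          using norm_inversion_diff[OF y elim, of \<rho>] y by (simp add: inversion_self[OF y] \<rho>_def power2_eq_square)
        have "inversion \<rho> z \<in> - ball y \<epsilon> \<longleftrightarrow> z \<in> ?E"
          using elim unfolding Compl_iff mem_ball dist_norm nJ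
          by (simp add: \<rho>_def field_simps not_less)
        then have "indicator (- ball y \<epsilon>) (inversion \<rho> z) = (indicator ?E z :: real)"
          by (simp add: indicator_def)
        then show ?case using F[OF elim] by (cases "z \<in> ?E") auto
      qed
    qed auto
    also have "\<dots> = - (LINT z:?E|lborel. F z)" by (simp add: set_lebesgue_integral_def)
    finally show ?thesis .
  qed
  \<comment> \<open>By \<open>int\<close> the two integrals are negatives of each other, so minus
    one half of their difference is the integral over the complement of the ball.\<close>
  have "((\<lambda>\<epsilon>. - (1/2) * ((LINT z:{z. \<epsilon> * norm z \<le> norm (y - z) * norm y}|lborel. F z)
       - (LINT z:- ball y \<epsilon>|lborel. F z))) \<longlongrightarrow> - (1/2) * 0) (at_right 0)"
    unfolding F_def by (intro tendsto_mult tendsto_const shell_tendsto[OF \<alpha> tG dG y])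
  moreover have "\<forall>\<^sub>F \<epsilon> in at_right 0. - (1/2) * ((LINT z:{z. \<epsilon> * norm z \<le> norm (y - z) * norm y}|lborel. F z)
       - (LINT z:- ball y \<epsilon>|lborel. F z)) = (LINT z:- ball y \<epsilon>|lborel. F z)"
    using eventually_at_right_less[of 0] by eventually_elim (simp add: int)
  ultimately have "((\<lambda>\<epsilon>. LINT z:- ball y \<epsilon>|lborel. F z) \<longlongrightarrow> 0) (at_right 0)"
    using Lim_transform_eventually by fastforce
  then have "pv \<alpha> G y 0" by (simp add: pv_def F_def)
  from pv_cmult[OF this, of "(r / \<rho>) powr (real DIM('a) - \<alpha>)"]
  have "pv \<alpha> (\<lambda>z. (r / \<rho>) powr (real DIM('a) - \<alpha>) * G z) y 0" by simp
  moreover have "(r / \<rho>) powr (real DIM('a) - \<alpha>) * G z = kelvin \<alpha> r (\<lambda>_. 1) z" for z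
    using \<rho> assms by (simp add: G_def kelvin_def powr_mult[symmetric])
  ultimately show ?thesis by simp
qed

lemma differentiable_kelvin:
  fixes f :: "'a::euclidean_space \<Rightarrow> real"
  assumes "0 < r" "y \<noteq> 0" "f differentiable (at (inversion r y))"
  shows "kelvin \<alpha> r f differentiable (at y)"
proof -
  have "(\<lambda>z::'a. (r / norm z) powr (real DIM('a) - \<alpha>)) differentiable (at y)"
    using assms by (intro differentiable_powr_norm)
  moreover have "inversion r differentiable (at y)"
    using has_derivative_inversion[OF assms(2), of r UNIV] by (auto simp: differentiable_def)
  then have "(\<lambda>z. f (inversion r z)) differentiable (at y)"
    using assms(3) differentiable_chain_at[of "inversion r" y f] by (simp add: o_def)
  ultimately show ?thesis unfolding kelvin_def[abs_def] by (rule differentiable_mult)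
qed

text \<open>The kernel factors and the Jacobian together leave
  \<open>(r / norm z) powr (n - \<alpha>)\<close> in the integrand. This power times a difference of
  values of \<open>f\<close> is a difference of values of the transform, minus \<open>f y'\<close>
  times a difference for the transform of 1, and the latter has principal value 0 by
  \<open>pv_kelvin_one\<close>.\<close>

lemma pv_kelvin:
  fixes f :: "'a::euclidean_space \<Rightarrow> real"
  assumes \<alpha>: "0 < \<alpha>" "\<alpha> < 2" and r: "0 < r" and y: "y \<noteq> 0" and f: "tail_integrable \<alpha> f"
    and df: "f differentiable (at (inversion r y))" and l: "pv \<alpha> f (inversion r y) l"
  shows "pv \<alpha> (kelvin \<alpha> r f) y ((r / norm y) powr (real DIM('a) + \<alpha>) * l)"
proof -
  let ?s = "real DIM('a) + \<alpha>"
  define G where "G = kelvin \<alpha> r (\<lambda>_::'a. 1)"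
  define g where "g = kelvin \<alpha> r f"
  define y' where "y' = inversion r y"
  \<comment> \<open>Away from the origin, the points sent outside the ball of radius
    \<open>\<epsilon>\<close> about \<open>y'\<close> form \<open>E (\<kappa> * \<epsilon>)\<close>;
    \<open>\<kappa>\<close> is the inverse of the dilation factor of the inversion at
    \<open>y\<close>.\<close>
  define \<kappa> where "\<kappa> = (norm y)\<^sup>2 / r\<^sup>2"
  have \<kappa>: "\<kappa> > 0" using y r by (simp add: \<kappa>_def)
  define E where "E = (\<lambda>\<epsilon>. {z. \<epsilon> * norm z \<le> norm (y - z) * norm y})"
  have tG: "tail_integrable \<alpha> G" and tg: "tail_integrable \<alpha> g" unfolding G_def g_def
    using \<alpha> r f by (auto intro!: tail_integrable_kelvin tail_integrable_const)
  have [measurable]: "G \<in> borel_measurable borel" "g \<in> borel_measurable borel" "f \<in> borel_measurable borel"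
    using tG tg f by measurable
  have [measurable]: "E \<epsilon> \<in> sets borel" for \<epsilon>
    unfolding E_def by measurable
  have dG: "G differentiable (at y)" and dg: "g differentiable (at y)"
    unfolding G_def g_def using df r y by (auto intro!: differentiable_kelvin)
  have point: "(r / norm z) ^ (2 * DIM('a)) * ((f y' - f (inversion r z)) * kern \<alpha> (y' - inversion r z))
     = (r / norm y) powr - ?s * ((g y - g z) * kern \<alpha> (y - z) - f y' * ((G y - G z) * kern \<alpha> (y - z)))"
    if z: "z \<noteq> 0" for z
  proof -
    define t where "t = r / norm z"
    have t: "t > 0" using z r by (simp add: t_def)
    have gz: "g z = t powr (real DIM('a) - \<alpha>) * f (inversion r z)" "G z = t powr (real DIM('a) - \<alpha>)"
      by (simp_all add: g_def G_def kelvin_def t_def)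
    have gy: "g y = G y * f y'" by (simp add: g_def G_def kelvin_def y'_def)
    have "t ^ (2 * DIM('a)) * t powr - ?s = t powr (real DIM('a) - \<alpha>)"
      using t by (simp add: power_eq_powr_dim[where 'a='a] powr_add[symmetric])
    then have *: "t ^ (2 * DIM('a)) * (t powr - ?s * x) = t powr (real DIM('a) - \<alpha>) * x" for x
      by (metis mult.assoc)
    have k: "kern \<alpha> (y' - inversion r z) = t powr - ?s * ((r / norm y) powr - ?s * kern \<alpha> (y - z))"
      using kern_inversion[OF r y z, of \<alpha>] by (simp add: t_def y'_def mult_ac)
    have "t ^ (2 * DIM('a)) * ((f y' - f (inversion r z)) * kern \<alpha> (y' - inversion r z))
      = t ^ (2 * DIM('a)) * (t powr - ?s * ((f y' - f (inversion r z)) * ((r / norm y) powr - ?s * kern \<alpha> (y - z))))"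
      unfolding k by (simp only: mult_ac)
    also have "\<dots> = (r / norm y) powr - ?s * (t powr (real DIM('a) - \<alpha>) * ((f y' - f (inversion r z)) * kern \<alpha> (y - z)))"
      unfolding * by (simp only: mult_ac)
    also have "t powr (real DIM('a) - \<alpha>) * ((f y' - f (inversion r z)) * kern \<alpha> (y - z)) 
       = (g y - g z) * kern \<alpha> (y - z) - f y' * ((G y - G z) * kern \<alpha> (y - z))"
      unfolding gz gy by (simp add: algebra_simps)
    finally show ?thesis by (simp only: t_def)
  qed
  define I where "I = (\<lambda>h \<epsilon>. LINT z:E \<epsilon>|lborel. (h y - h z) * kern \<alpha> (y - z))"
  define B where "B = (\<lambda>h \<epsilon>. LINT z:- ball y \<epsilon>|lborel. (h y - h z) * kern \<alpha> (y - z))"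
  have sub: "E \<epsilon> \<subseteq> - ball y (\<epsilon> * norm y / (norm y + \<epsilon>))" if "\<epsilon> > 0" for \<epsilon>
  proof
    fix z assume "z \<in> E \<epsilon>"
    then have 1: "\<epsilon> * norm z \<le> norm (y - z) * norm y" by (simp add: E_def)
    have "norm y \<le> norm z + norm (y - z)" using norm_triangle_sub[of y z] by simp
    then have "\<epsilon> * norm y \<le> \<epsilon> * (norm z + norm (y - z))" using that by (intro mult_left_mono) auto
    with 1 have "\<epsilon> * norm y \<le> norm (y - z) * (norm y + \<epsilon>)" by (simp add: algebra_simps)
    then have "\<epsilon> * norm y / (norm y + \<epsilon>) \<le> norm (y - z)"
      using that by (subst pos_divide_le_eq) (auto intro: add_nonneg_pos)
    then show "z \<in> - ball y (\<epsilon> * norm y / (norm y + \<epsilon>))" by (simp add: dist_norm)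
  qed
  have si: "set_integrable lborel (E \<epsilon>) (\<lambda>z. (h y - h z) * kern \<alpha> (y - z))" if "\<epsilon> > 0" "tail_integrable \<alpha> h" for \<epsilon> h
    using \<alpha>(1) that(2) _ _ sub[OF that(1)]
    by (rule set_integrable_pv) (use that y in \<open>auto intro!: mult_pos_pos divide_pos_pos add_nonneg_pos\<close>)
  have eq: "(LINT z:- ball y' \<epsilon>|lborel. (f y' - f z) * kern \<alpha> (y' - z))
     = (r / norm y) powr - ?s * (I g (\<kappa> * \<epsilon>) - f y' * I G (\<kappa> * \<epsilon>))" if "\<epsilon> > 0" for \<epsilon>
  proof -
    have "(LINT z:- ball y' \<epsilon>|lborel. (f y' - f z) * kern \<alpha> (y' - z))
        = (\<integral>z. indicator (- ball y' \<epsilon>) z * ((f y' - f z) * kern \<alpha> (y' - z)) \<partial>lborel)"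
      by (simp add: set_lebesgue_integral_def)
    also have "\<dots> = (\<integral>z. (r / norm z) ^ (2 * DIM('a)) * (indicator (- ball y' \<epsilon>) (inversion r z) * ((f y' - f (inversion r z)) * kern \<alpha> (y' - inversion r z))) \<partial>lborel)"
      by (rule integral_inversion[symmetric]) (use r in auto)
    also have "\<dots> = (\<integral>z. (r / norm y) powr - ?s * (indicator (E (\<kappa> * \<epsilon>)) z * ((g y - g z) * kern \<alpha> (y - z)) -
          f y' * (indicator (E (\<kappa> * \<epsilon>)) z * ((G y - G z) * kern \<alpha> (y - z)))) \<partial>lborel)"
    proof (rule integral_cong_AE)
      show "AE z in lborel. (r / norm z) ^ (2 * DIM('a)) * (indicator (- ball y' \<epsilon>) (inversion r z) * ((f y' - f (inversion r z)) * kern \<alpha> (y' - inversion r z)))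
         = (r / norm y) powr - ?s * (indicator (E (\<kappa> * \<epsilon>)) z * ((g y - g z) * kern \<alpha> (y - z)) -
          f y' * (indicator (E (\<kappa> * \<epsilon>)) z * ((G y - G z) * kern \<alpha> (y - z))))"
        using AE_lborel_singleton[of "0::'a"]
      proof eventually_elim
        case (elim z)
        have "inversion r z \<in> - ball y' \<epsilon> \<longleftrightarrow> \<epsilon> \<le> r\<^sup>2 * norm (y - z) / (norm y * norm z)"
          using norm_inversion_diff[OF y elim, of r] by (simp add: y'_def dist_norm not_less)
        also have "\<dots> \<longleftrightarrow> z \<in> E (\<kappa> * \<epsilon>)"
          using elim y r by (simp add: E_def \<kappa>_def field_simps power2_eq_square)
        finally have "indicator (- ball y' \<epsilon>) (inversion r z) = (indicator (E (\<kappa> * \<epsilon>)) z :: real)"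
          by (simp add: indicator_def)
        then show ?case using point[OF elim] by (simp add: indicator_def)
      qed
    qed auto
    also have "\<dots> = (r / norm y) powr - ?s * (I g (\<kappa> * \<epsilon>) - f y' * I G (\<kappa> * \<epsilon>))"
      using si[OF _ tg, of "\<kappa> * \<epsilon>"] si[OF _ tG, of "\<kappa> * \<epsilon>"] that \<kappa>
      by (simp add: I_def set_lebesgue_integral_def set_integrable_def)
    finally show ?thesis .
  qed
  have lim\<kappa>: "filterlim (\<lambda>\<epsilon>. \<kappa> * \<epsilon>) (at_right 0) (at_right (0::real))"
    using \<kappa> by (auto simp: filterlim_at eventually_at_right_less intro!: tendsto_eq_intros eventually_mono[OF eventually_at_right_less])
  have sh: "((\<lambda>\<epsilon>. I h (\<kappa> * \<epsilon>) - B h (\<kappa> * \<epsilon>)) \<longlongrightarrow> 0) (at_right 0)"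
    if "tail_integrable \<alpha> h" "h differentiable (at y)" for h
    using filterlim_compose[OF shell_tendsto[OF \<alpha> that y] lim\<kappa>] by (simp add: I_def B_def E_def)
  have BG: "((\<lambda>\<epsilon>. B G (\<kappa> * \<epsilon>)) \<longlongrightarrow> 0) (at_right 0)"
    using filterlim_compose[OF pv_kelvin_one[OF \<alpha> y r, unfolded pv_def] lim\<kappa>] by (simp add: B_def G_def)
  \<comment> \<open>The sum is arranged to cancel to \<open>B g (\<kappa> * \<epsilon>)\<close>,
    while each summand has a known limit: the given principal value of \<open>f\<close>, the shell
    errors for \<open>G\<close> and \<open>g\<close>, and the vanishing principal value of
    \<open>G\<close>.\<close>
  have "((\<lambda>\<epsilon>. (r / norm y) powr ?s * ((r / norm y) powr - ?s * (I g (\<kappa> * \<epsilon>) - f y' * I G (\<kappa> * \<epsilon>)))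
      + f y' * ((I G (\<kappa> * \<epsilon>) - B G (\<kappa> * \<epsilon>)) + B G (\<kappa> * \<epsilon>)) - (I g (\<kappa> * \<epsilon>) - B g (\<kappa> * \<epsilon>)))
     \<longlongrightarrow> (r / norm y) powr ?s * l + f y' * (0 + 0) - 0) (at_right 0)"
  proof (intro tendsto_add tendsto_diff tendsto_mult tendsto_const sh tG dG tg dg BG)
    show "((\<lambda>\<epsilon>. (r / norm y) powr - ?s * (I g (\<kappa> * \<epsilon>) - f y' * I G (\<kappa> * \<epsilon>))) \<longlongrightarrow> l) (at_right 0)"
      using l[folded y'_def, unfolded pv_def]
      by (rule Lim_transform_eventually) (use eq in \<open>auto intro!: eventually_mono[OF eventually_at_right_less[of 0]]\<close>)
  qed
  moreover have "(r / norm y) powr ?s * (r / norm y) powr - ?s = 1"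
    using r y by (simp add: powr_add[symmetric])
  then have "(r / norm y) powr ?s * ((r / norm y) powr - ?s * x) = x" for x
    by (simp add: mult.assoc[symmetric])
  then have "(r / norm y) powr ?s * ((r / norm y) powr - ?s * (I g (\<kappa> * \<epsilon>) - f y' * I G (\<kappa> * \<epsilon>)))
      + f y' * ((I G (\<kappa> * \<epsilon>) - B G (\<kappa> * \<epsilon>)) + B G (\<kappa> * \<epsilon>)) - (I g (\<kappa> * \<epsilon>) - B g (\<kappa> * \<epsilon>)) = B g (\<kappa> * \<epsilon>)" for \<epsilon>
    by (simp only:) (simp add: algebra_simps)
  ultimately have "((\<lambda>\<epsilon>. B g (\<kappa> * \<epsilon>)) \<longlongrightarrow> (r / norm y) powr ?s * l) (at_right 0)"
    by (simp only: add_0_right mult_zero_right diff_zero)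
  then have "((\<lambda>\<epsilon>. B g (\<kappa> * (inverse \<kappa> * \<epsilon>))) \<longlongrightarrow> (r / norm y) powr ?s * l) (at_right 0)"
    by (rule filterlim_compose)
       (use \<kappa> in \<open>auto simp: filterlim_at eventually_at_right_less intro!: tendsto_eq_intros eventually_mono[OF eventually_at_right_less]\<close>)
  then show ?thesis using \<kappa> by (simp add: pv_def B_def g_def mult.assoc[symmetric])
qed

section \<open>A maximum principle for antisymmetric functions\<close>

text \<open>The kernel at the mirror image of \<open>z\<close>, weighted so that for antisymmetric
  \<open>V\<close> the integral of \<open>V\<close> times \<open>kern\<close> outside the sphere
  becomes minus that of \<open>V\<close> times \<open>kern_refl\<close> inside. The exponent is
  \<open>2 n - (n - \<alpha>)\<close>: Jacobian divided by Kelvin factor.\<close>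

definition kern_refl :: "real \<Rightarrow> real \<Rightarrow> 'a::euclidean_space \<Rightarrow> 'a \<Rightarrow> real" where
  "kern_refl \<alpha> r y z = (r / norm z) powr (real DIM('a) + \<alpha>) * kern \<alpha> (y - inversion r z)"

lemma measurable_kern_refl [measurable]: "kern_refl \<alpha> r y \<in> borel_measurable borel"
  unfolding kern_refl_def by measurable

lemma kern_refl_nonneg [simp]: "0 \<le> kern_refl \<alpha> r y z"
  by (simp add: kern_refl_def)

lemma kern_refl_0 [simp]: "kern_refl \<alpha> r y 0 = 0"
  by (simp add: kern_refl_def)

lemma kern_refl_eq:
  fixes y z :: "'a::euclidean_space"
  assumes "0 < r" "z \<noteq> 0"
  shows "kern_refl \<alpha> r y z = (norm z * norm (y - inversion r z) / r) powr - (real DIM('a) + \<alpha>)"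
proof -
  have "(r / norm z) powr (real DIM('a) + \<alpha>) = (norm z / r) powr - (real DIM('a) + \<alpha>)"
    using assms by (intro powr_divide_minus[symmetric]) auto
  then show ?thesis
    using assms by (simp only: kern_refl_def kern_def) (simp add: powr_mult[symmetric])
qed

text \<open>The left side is the square of the reflected distance behind \<open>kern_refl\<close>.
  With both points inside the sphere the added product is positive, so reflection increases
  distances; the Green function of a ball rests on the same identity.\<close>

lemma norm_refl_identity:
  fixes y z :: "'a::real_inner"
  assumes "0 < r" "z \<noteq> 0"
  shows "(norm z * norm (y - inversion r z) / r)\<^sup>2
    = (norm (y - z))\<^sup>2 + (r\<^sup>2 - (norm y)\<^sup>2) * (r\<^sup>2 - (norm z)\<^sup>2) / r\<^sup>2"
  using assms unfolding power_mult_distrib power_divide inversion_def power2_norm_eq_inner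
  by (simp add: inner_diff_left inner_diff_right inner_commute[of z y])
     (simp add: field_simps eval_nat_numeral)

lemma kern_refl_le_kern:
  fixes y z :: "'a::euclidean_space"
  assumes "0 < \<alpha>" "0 < r" "norm y < r" "norm z \<le> r" "z \<noteq> y"
  shows "kern_refl \<alpha> r y z \<le> kern \<alpha> (y - z)"
proof (cases "z = 0")
  case False
  have "(norm (y - z))\<^sup>2 \<le> (norm z * norm (y - inversion r z) / r)\<^sup>2"
    unfolding norm_refl_identity[OF assms(2) False]
    using assms by (simp add: mult_nonneg_nonneg power_mono)
  then have "norm (y - z) \<le> norm z * norm (y - inversion r z) / r"
    by (rule power2_le_imp_le) (use assms in auto)
  then show ?thesis
    unfolding kern_refl_eq[OF assms(2) False] kern_def using assms by (intro powr_mono2') auto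
qed simp

lemma kern_refl_less_kern:
  fixes y z :: "'a::euclidean_space"
  assumes "0 < \<alpha>" "0 < r" "norm y < r" "norm z < r" "z \<noteq> y"
  shows "kern_refl \<alpha> r y z < kern \<alpha> (y - z)"
proof (cases "z = 0")
  case False
  have "(norm y)\<^sup>2 < r\<^sup>2" "(norm z)\<^sup>2 < r\<^sup>2"
    using assms by (auto intro!: power_strict_mono)
  then have "(norm (y - z))\<^sup>2 < (norm z * norm (y - inversion r z) / r)\<^sup>2"
    unfolding norm_refl_identity[OF assms(2) False]
    using assms by simp
  then have "norm (y - z) < norm z * norm (y - inversion r z) / r"
    by (rule power_less_imp_less_base) (use assms in auto)
  then show ?thesis
    unfolding kern_refl_eq[OF assms(2) False] kern_def using assms by (intro powr_less_mono2_neg) auto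
qed (use assms in auto)

text \<open>The reflected distance is at least \<open>r - norm y * norm z / r\<close>. The reflected
  kernel is thus nonsingular in the ball while \<open>y\<close> keeps away from the sphere, and its
  integrals need no principal value.\<close>

lemma kern_refl_bound:
  fixes y z :: "'a::euclidean_space"
  assumes "0 < \<alpha>" "0 < d" "norm y + d \<le> r" "norm z \<le> r"
  shows "kern_refl \<alpha> r y z \<le> d powr - (real DIM('a) + \<alpha>)"
proof (cases "z = 0")
  case False
  have r: "r > 0" using assms norm_ge_zero[of y] by linarith
  have "r\<^sup>2 / norm z - norm y \<le> norm (y - inversion r z)"
    using norm_triangle_ineq2[of "inversion r z" y] by (simp add: norm_inversion norm_minus_commute)
  then have "norm z * (r\<^sup>2 / norm z - norm y) / r \<le> norm z * norm (y - inversion r z) / r"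
    using r by (intro divide_right_mono mult_left_mono) auto
  moreover have "norm z * (r\<^sup>2 / norm z - norm y) / r = r - norm z / r * norm y"
    using r False by (simp add: field_simps power2_eq_square)
  moreover have "norm z / r * norm y \<le> 1 * norm y"
    using assms r by (intro mult_right_mono) auto
  ultimately have "d \<le> norm z * norm (y - inversion r z) / r" using assms by linarith
  then show ?thesis
    unfolding kern_refl_eq[OF r False] using assms by (intro powr_mono2') auto
qed simp

lemma set_integrable_bounded:
  fixes f :: "'a::euclidean_space \<Rightarrow> real"
  assumes [measurable]: "f \<in> borel_measurable borel" "A \<in> sets borel" and "A \<subseteq> ball x R"
    and "\<And>z. z \<in> A \<Longrightarrow> \<bar>f z\<bar> \<le> C"
  shows "set_integrable lborel A f"
  unfolding set_integrable_def
proof (rule Bochner_Integration.integrable_bound)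
  have "emeasure lborel A < \<infinity>"
    using emeasure_mono[OF assms(3), of lborel] emeasure_lborel_ball_finite[of x R] by auto
  then show "integrable lborel (\<lambda>z. C * indicator A z :: real)"
    by (intro integrable_mult_right integrable_real_indicator) auto
  show "AE z in lborel. norm (indicator A z *\<^sub>R f z) \<le> norm (C * indicator A z :: real)"
    using assms(4) by (intro AE_I2) (auto simp: indicator_def intro: order_trans[OF _ abs_ge_self])
qed measurable

lemma ball_complement_subset:
  fixes y :: "'a::real_normed_vector"
  shows "- ball 0 r \<subseteq> - ball y (r - norm y)"
proof (rule subsetI)
  fix z :: 'a assume "z \<in> - ball 0 r"
  then show "z \<in> - ball y (r - norm y)"
    using norm_triangle_sub[of z y] by (simp add: dist_norm norm_minus_commute)
qed

lemma set_integrable_kern_refl: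
  fixes y :: "'a::euclidean_space"
  assumes "0 < \<alpha>" "norm y < r"
  shows "set_integrable lborel (ball 0 r) (kern_refl \<alpha> r y)"
  using kern_refl_bound[OF assms(1), of "r - norm y" y r] assms
  by (intro set_integrable_bounded[of _ _ 0 r "(r - norm y) powr - (real DIM('a) + \<alpha>)"]) auto

section \<open>Folding the exterior of the sphere onto the ball\<close>

definition antisymmetric_about :: "real \<Rightarrow> real \<Rightarrow> ('a::euclidean_space \<Rightarrow> real) \<Rightarrow> bool" where
  "antisymmetric_about \<alpha> r V \<longleftrightarrow> (\<forall>z. z \<noteq> 0 \<longrightarrow> kelvin \<alpha> r V z = - V z)"

lemma antisymmetric_sphere:
  assumes "antisymmetric_about \<alpha> r V" "norm z = r" "0 < r"
  shows "V z = 0"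
proof -
  have "z \<noteq> 0" using assms by auto
  then have "kelvin \<alpha> r V z = V z" using assms by (auto simp: kelvin_def inversion_self)
  then show ?thesis using assms(1) \<open>z \<noteq> 0\<close> by (auto simp: antisymmetric_about_def)
qed

lemma antisymmetric_point:
  fixes y z :: "'a::euclidean_space"
  assumes "antisymmetric_about \<alpha> r V" "0 < r"
  shows "(r / norm z) ^ (2 * DIM('a)) * (indicator (- ball 0 r) (inversion r z) * (V (inversion r z) * kern \<alpha> (y - inversion r z)))
    = - (indicator (ball 0 r) z * (V z * kern_refl \<alpha> r y z))"
proof (cases "z = 0")
  case False
  define t where "t = r / norm z"
  have t: "t > 0" using False assms by (simp add: t_def)
  have J: "inversion r z \<in> - ball 0 r \<longleftrightarrow> norm z \<le> r"
    using False assms(2) by (simp add: norm_inversion field_simps power2_eq_square not_less)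
  have "t powr (real DIM('a) - \<alpha>) * V (inversion r z) = - V z"
    using assms(1) False by (auto simp: antisymmetric_about_def kelvin_def t_def)
  moreover have "t ^ (2 * DIM('a)) = t powr (real DIM('a) + \<alpha>) * t powr (real DIM('a) - \<alpha>)"
    using t by (simp add: power_eq_powr_dim[where 'a='a] powr_add[symmetric])
  ultimately have "t ^ (2 * DIM('a)) * (V (inversion r z) * kern \<alpha> (y - inversion r z)) = - (V z * kern_refl \<alpha> r y z)"
    unfolding kern_refl_def t_def[symmetric]
    by (metis (no_types, opaque_lifting) mult.assoc mult.left_commute mult_minus_left)
  \<comment> \<open>The preimage of the exterior is the closed ball, while the right side has the
    open one; \<open>V\<close> vanishes on the sphere, which settles the boundary points.\<close>
  then show ?thesis
    using J antisymmetric_sphere[OF assms(1) _ assms(2), of z]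
    by (cases "norm z = r") (auto simp: indicator_def t_def)
qed simp

lemma antisymmetric_integral:
  fixes y :: "'a::euclidean_space"
  assumes anti: "antisymmetric_about \<alpha> r V" and y: "norm y < r" and \<alpha>: "0 < \<alpha>" and V: "tail_integrable \<alpha> V"
  shows "set_integrable lborel (ball 0 r) (\<lambda>z. V z * kern_refl \<alpha> r y z)"
    and "(LINT z:- ball 0 r|lborel. V z * kern \<alpha> (y - z)) = - (LINT z:ball 0 r|lborel. V z * kern_refl \<alpha> r y z)"
proof -
  have r: "0 < r" using y norm_ge_zero[of y] by linarith
  have [measurable]: "V \<in> borel_measurable borel" using V by measurable
  note sub = ball_complement_subset[of r y]
  define f where "f = (\<lambda>z. indicator (- ball 0 r) z * (V z * kern \<alpha> (y - z)))"
  have [measurable]: "f \<in> borel_measurable borel" unfolding f_def by measurable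
  have "integrable lborel f"
    using set_integrable_tail_kern[OF \<alpha> V _ _ sub] y by (simp add: f_def set_integrable_def)
  then have "integrable lborel (\<lambda>z. (r / norm z) ^ (2 * DIM('a)) * f (inversion r z))"
    by (subst integrable_inversion_iff[OF r]) auto
  then have "integrable lborel (\<lambda>z. - (indicator (ball 0 r) z * (V z * kern_refl \<alpha> r y z)))"
    by (simp only: f_def antisymmetric_point[OF anti r])
  then show "set_integrable lborel (ball 0 r) (\<lambda>z. V z * kern_refl \<alpha> r y z)"
    by (simp add: set_integrable_def)
  have "(\<integral>z. f z \<partial>lborel) = (\<integral>z. (r / norm z) ^ (2 * DIM('a)) * f (inversion r z) \<partial>lborel)"
    by (rule integral_inversion[symmetric]) (use r in auto)
  also have "\<dots> = (\<integral>z. - (indicator (ball 0 r) z * (V z * kern_refl \<alpha> r y z)) \<partial>lborel)"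
    by (simp only: f_def antisymmetric_point[OF anti r])
  finally show "(LINT z:- ball 0 r|lborel. V z * kern \<alpha> (y - z)) = - (LINT z:ball 0 r|lborel. V z * kern_refl \<alpha> r y z)"
    by (simp add: f_def set_lebesgue_integral_def)
qed

lemma set_integral_le_AE:
  fixes f g :: "'a \<Rightarrow> real"
  assumes "set_integrable M A f" "set_integrable M A g" "AE x in M. x \<in> A \<longrightarrow> f x \<le> g x"
  shows "(LINT x:A|M. f x) \<le> (LINT x:A|M. g x)"
  unfolding set_lebesgue_integral_def
  using assms unfolding set_integrable_def
  by (intro integral_mono_AE) (auto simp: indicator_def elim!: eventually_mono)

text \<open>Folding leaves the difference \<open>kern - kern_refl\<close>, nonnegative in the ball,
  and \<open>V y\<close> times two kernel masses. On \<open>ball y \<rho>\<close> the folded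
  integrand is nonpositive by minimality, so removing that ball yields a bound free of principal
  values. What remains is \<open>kern_refl\<close> integrated over the excised
  \<open>\<epsilon>\<close>-ball, which is \<open>O(\<epsilon>)\<close> by the first-order bound on
  \<open>V\<close>.\<close>

theorem pv_antisymmetric_le:
  fixes y :: "'a::euclidean_space"
  assumes \<alpha>: "0 < \<alpha>" and y: "norm y < r" and V: "tail_integrable \<alpha> V" "V differentiable (at y)"
    and anti: "antisymmetric_about \<alpha> r V" and l: "pv \<alpha> V y l"
    and \<rho>: "0 < \<rho>" "ball y \<rho> \<subseteq> ball 0 r" and min: "\<And>z. z \<in> ball y \<rho> \<Longrightarrow> V y \<le> V z"
  shows "l \<le> (LINT z:ball 0 r - ball y \<rho>|lborel. (V y - V z) * (kern \<alpha> (y - z) - kern_refl \<alpha> r y z))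
     + V y * ((LINT z:- ball 0 r|lborel. kern \<alpha> (y - z)) + (LINT z:ball 0 r|lborel. kern_refl \<alpha> r y z))"
    (is "l \<le> ?R")
proof -
  have r: "0 < r" using y norm_ge_zero[of y] by linarith
  have [measurable]: "V \<in> borel_measurable borel" using V by measurable
  let ?K = "\<lambda>z. kern \<alpha> (y - z)" and ?K' = "kern_refl \<alpha> r y"
  let ?B = "ball (0::'a) r"
  obtain M \<sigma> where M: "M \<ge> 0" "\<sigma> > 0" "\<And>z. norm (z - y) < \<sigma> \<Longrightarrow> \<bar>V y - V z\<bar> \<le> M * norm (z - y)"
    using differentiable_local_bound[OF V(2)] by blast
  define C where "C = (r - norm y) powr - (real DIM('a) + \<alpha>)"
  have C: "?K' z \<le> C" if "norm z \<le> r" for z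
    unfolding C_def using that y \<alpha> by (intro kern_refl_bound) auto
  note subB = ball_complement_subset[of r y]
  note iK' = set_integrable_kern_refl[OF \<alpha> y]
  note iVK' = antisymmetric_integral(1)[OF anti y \<alpha> V(1)]
  have idK': "set_integrable lborel ?B (\<lambda>z. (V y - V z) * ?K' z)"
    using set_integral_diff(1)[OF set_integrable_mult_right[of "V y", OF iK'] iVK'] by (simp add: left_diff_distrib)
  have iK: "set_integrable lborel (- ?B) (\<lambda>z. 1 * ?K z)"
    using y by (intro set_integrable_tail_kern[OF \<alpha> tail_integrable_const[OF \<alpha>] _ _ subB]) auto
  have iVK: "set_integrable lborel (- ?B) (\<lambda>z. V z * ?K z)"
    using y by (intro set_integrable_tail_kern[OF \<alpha> V(1) _ _ subB]) auto
  have idK: "set_integrable lborel (?B - ball y \<epsilon>) (\<lambda>z. (V y - V z) * ?K z)" if "\<epsilon> > 0" for \<epsilon>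
    by (rule set_integrable_pv[OF \<alpha> V(1) _ that]) auto
  have sub_int: "set_integrable lborel A f" if "set_integrable lborel B f" "A \<subseteq> B" "A \<in> sets borel" for A B and f :: "'a \<Rightarrow> real"
    using that by (auto intro: set_integrable_subset)
  define D where "D = M * C * measure lborel (ball y \<rho>)"
  have bound: "(LINT z:- ball y \<epsilon>|lborel. (V y - V z) * ?K z) \<le> ?R + D * \<epsilon>" if \<epsilon>: "0 < \<epsilon>" "\<epsilon> < \<rho>" "\<epsilon> < \<sigma>" for \<epsilon>
  proof -
    have \<epsilon>B: "ball y \<epsilon> \<subseteq> ball y \<rho>" using \<epsilon> by auto
    have i1: "set_integrable lborel (?B - ball y \<epsilon>) (\<lambda>z. (V y - V z) * ?K' z)"
      by (rule sub_int[OF idK']) auto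
    have i2: "set_integrable lborel (ball y \<epsilon>) (\<lambda>z. (V y - V z) * ?K' z)"
      by (rule sub_int[OF idK']) (use \<epsilon>B \<rho> in auto)
    have un: "- ball y \<epsilon> = (?B - ball y \<epsilon>) \<union> (- ?B)" using \<epsilon>B \<rho> by auto
    have "(LINT z:- ball y \<epsilon>|lborel. (V y - V z) * ?K z)
       = (LINT z:?B - ball y \<epsilon>|lborel. (V y - V z) * ?K z) + (LINT z:- ?B|lborel. (V y - V z) * ?K z)"
      unfolding un using y \<epsilon>
      by (intro set_integral_Un idK set_integrable_pv[OF \<alpha> V(1) _ _ subB]) auto
    also have "(LINT z:- ?B|lborel. (V y - V z) * ?K z) = V y * (LINT z:- ?B|lborel. ?K z) - (LINT z:- ?B|lborel. V z * ?K z)"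
      using set_integral_diff(2)[OF set_integrable_mult_right[of "V y", OF iK] iVK] by (simp add: left_diff_distrib)
    also have "(LINT z:- ?B|lborel. V z * ?K z) = - (LINT z:?B|lborel. V z * ?K' z)"
      by (rule antisymmetric_integral(2)[OF anti y \<alpha> V(1)])
    also have "(LINT z:?B|lborel. V z * ?K' z) = V y * (LINT z:?B|lborel. ?K' z) - (LINT z:?B|lborel. (V y - V z) * ?K' z)"
      using set_integral_diff(2)[OF set_integrable_mult_right[of "V y", OF iK'] iVK'] by (simp add: left_diff_distrib)
    also have "(LINT z:?B|lborel. (V y - V z) * ?K' z)
        = (LINT z:?B - ball y \<epsilon>|lborel. (V y - V z) * ?K' z) + (LINT z:ball y \<epsilon>|lborel. (V y - V z) * ?K' z)"
    proof -
      have "?B = (?B - ball y \<epsilon>) \<union> ball y \<epsilon>" using \<epsilon>B \<rho> by auto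
      then show ?thesis using set_integral_Un[OF _ i1 i2] by auto
    qed
    finally have P: "(LINT z:- ball y \<epsilon>|lborel. (V y - V z) * ?K z)
      = ((LINT z:?B - ball y \<epsilon>|lborel. (V y - V z) * ?K z) - (LINT z:?B - ball y \<epsilon>|lborel. (V y - V z) * ?K' z))
        + V y * ((LINT z:- ?B|lborel. ?K z) + (LINT z:?B|lborel. ?K' z)) - (LINT z:ball y \<epsilon>|lborel. (V y - V z) * ?K' z)"
      by (simp add: algebra_simps)
    have dd: "set_integrable lborel (?B - ball y \<epsilon>) (\<lambda>z. (V y - V z) * (?K z - ?K' z))"
      using set_integral_diff(1)[OF idK[OF \<epsilon>(1)] i1] by (simp add: right_diff_distrib)
    have "(LINT z:?B - ball y \<epsilon>|lborel. (V y - V z) * ?K z) - (LINT z:?B - ball y \<epsilon>|lborel. (V y - V z) * ?K' z)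
        = (LINT z:?B - ball y \<epsilon>|lborel. (V y - V z) * (?K z - ?K' z))"
      using set_integral_diff(2)[OF idK[OF \<epsilon>(1)] i1] by (simp add: right_diff_distrib)
    also have "\<dots> = (LINT z:?B - ball y \<rho>|lborel. (V y - V z) * (?K z - ?K' z))
         + (LINT z:ball y \<rho> - ball y \<epsilon>|lborel. (V y - V z) * (?K z - ?K' z))"
    proof -
      have "?B - ball y \<epsilon> = (?B - ball y \<rho>) \<union> (ball y \<rho> - ball y \<epsilon>)" using \<epsilon>B \<rho> by auto
      then show ?thesis
        using \<epsilon>B \<rho>(2) set_integral_Un[OF _ sub_int[OF dd, of "?B - ball y \<rho>"] sub_int[OF dd, of "ball y \<rho> - ball y \<epsilon>"]] by auto
    qed
    also have "(LINT z:ball y \<rho> - ball y \<epsilon>|lborel. (V y - V z) * (?K z - ?K' z)) \<le> 0"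
    proof -
      have "(V y - V z) * (?K z - ?K' z) \<le> 0" if "z \<in> ball y \<rho> - ball y \<epsilon>" for z
      proof -
        have "z \<in> ?B" using that \<rho> by blast
        then have "?K' z \<le> ?K z" using that \<epsilon> by (intro kern_refl_le_kern[OF \<alpha> r y]) auto
        then show ?thesis using min[of z] that by (intro mult_nonpos_nonneg) auto
      qed
      then have "0 \<le> (LINT z:ball y \<rho> - ball y \<epsilon>|lborel. - ((V y - V z) * (?K z - ?K' z)))"
        unfolding set_lebesgue_integral_def
        by (intro integral_nonneg_AE AE_I2) (auto simp: indicator_def)
      then show ?thesis by (simp add: set_lebesgue_integral_def)
    qed
    finally have a: "(LINT z:?B - ball y \<epsilon>|lborel. (V y - V z) * ?K z) - (LINT z:?B - ball y \<epsilon>|lborel. (V y - V z) * ?K' z)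
      \<le> (LINT z:?B - ball y \<rho>|lborel. (V y - V z) * (?K z - ?K' z))" by simp
    have "- (LINT z:ball y \<epsilon>|lborel. (V y - V z) * ?K' z) = (LINT z:ball y \<epsilon>|lborel. - ((V y - V z) * ?K' z))"
      by (simp add: set_lebesgue_integral_def)
    also have "\<dots> \<le> (LINT z:ball y \<epsilon>|lborel. M * \<epsilon> * C)"
    proof (rule set_integral_mono)
      show "set_integrable lborel (ball y \<epsilon>) (\<lambda>z. - ((V y - V z) * ?K' z))"
        using i2 by (simp add: set_integrable_def)
      show "set_integrable lborel (ball y \<epsilon>) (\<lambda>z. M * \<epsilon> * C)"
        by (rule set_integrable_bounded[of _ _ y \<epsilon> "\<bar>M * \<epsilon> * C\<bar>"]) auto
      fix z assume z: "z \<in> ball y \<epsilon>"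
      then have n: "norm (z - y) < \<epsilon>" by (simp add: dist_norm norm_minus_commute)
      have "z \<in> ?B" using z \<epsilon>B \<rho> by blast
      have "- (V y - V z) \<le> M * norm (z - y)" using M(3)[of z] n \<epsilon> by linarith
      also have "\<dots> \<le> M * \<epsilon>" using M n by (intro mult_left_mono) auto
      finally have "- (V y - V z) \<le> M * \<epsilon>" .
      then have "- (V y - V z) * ?K' z \<le> M * \<epsilon> * ?K' z" by (intro mult_right_mono) auto
      also have "\<dots> \<le> M * \<epsilon> * C" using M \<epsilon> C[of z] \<open>z \<in> ?B\<close> by (intro mult_left_mono) auto
      finally show "- ((V y - V z) * ?K' z) \<le> M * \<epsilon> * C" by (simp only: mult_minus_left)
    qed
    also have "\<dots> = M * \<epsilon> * C * measure lborel (ball y \<epsilon>)"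
      by (simp add: set_lebesgue_integral_def)
    also have "\<dots> \<le> M * \<epsilon> * C * measure lborel (ball y \<rho>)"
      using M \<epsilon> \<epsilon>B emeasure_lborel_ball_finite[of y \<rho>]
      by (intro mult_left_mono measure_mono_fmeasurable) (auto simp: C_def fmeasurable_def)
    finally show ?thesis using P a by (simp add: D_def algebra_simps)
  qed
  show ?thesis
  proof (rule tendsto_le)
    show "((\<lambda>\<epsilon>. ?R + D * \<epsilon>) \<longlongrightarrow> ?R) (at_right 0)"
      by (auto intro!: tendsto_eq_intros)
    show "((\<lambda>\<epsilon>. LINT z:- ball y \<epsilon>|lborel. (V y - V z) * ?K z) \<longlongrightarrow> l) (at_right 0)"
      using l by (simp add: pv_def)
    show "\<forall>\<^sub>F \<epsilon> in at_right 0. (LINT z:- ball y \<epsilon>|lborel. (V y - V z) * ?K z) \<le> ?R + D * \<epsilon>"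
      unfolding eventually_at_right_field
      using bound \<rho>(1) M(2) by (intro exI[of _ "min \<rho> \<sigma>"]) auto
  qed auto
qed

lemma set_integrable_antisymmetric:
  fixes y :: "'a::euclidean_space"
  assumes \<alpha>: "0 < \<alpha>" and y: "norm y < r" and V: "tail_integrable \<alpha> V"
    and anti: "antisymmetric_about \<alpha> r V" and \<rho>: "0 < \<rho>"
  shows "set_integrable lborel (ball 0 r - ball y \<rho>) (\<lambda>z. (V y - V z) * (kern \<alpha> (y - z) - kern_refl \<alpha> r y z))"
proof -
  have "set_integrable lborel (ball 0 r) (\<lambda>z. (V y - V z) * kern_refl \<alpha> r y z)"
    using set_integral_diff(1)[OF set_integrable_mult_right[of "V y", OF set_integrable_kern_refl[OF \<alpha> y]] antisymmetric_integral(1)[OF anti y \<alpha> V]]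
    by (simp add: left_diff_distrib)
  then have "set_integrable lborel (ball 0 r - ball y \<rho>) (\<lambda>z. (V y - V z) * kern_refl \<alpha> r y z)"
    by (rule set_integrable_subset) auto
  moreover have "set_integrable lborel (ball 0 r - ball y \<rho>) (\<lambda>z. (V y - V z) * kern \<alpha> (y - z))"
    by (rule set_integrable_pv[OF \<alpha> V _ \<rho>]) auto
  ultimately show ?thesis
    using set_integral_diff(1) by (fastforce simp: right_diff_distrib)
qed

text \<open>At a minimum over the punctured ball the folded integral is nonpositive, and so is the
  reflected mass times \<open>V y\<close>. Only the exterior mass is kept, as it is the one that
  blows up at the sphere (\<open>kern_integral_lower\<close>).\<close>

lemma pv_antisymmetric_negative_min:
  fixes y :: "'a::euclidean_space"
  assumes \<alpha>: "0 < \<alpha>" and y: "y \<noteq> 0" "norm y < r" and V: "tail_integrable \<alpha> V" "V differentiable (at y)"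
    and anti: "antisymmetric_about \<alpha> r V" and l: "pv \<alpha> V y l"
    and neg: "V y \<le> 0" and min: "\<And>z. z \<noteq> 0 \<Longrightarrow> norm z < r \<Longrightarrow> V y \<le> V z"
  shows "l \<le> V y * (LINT z:- ball 0 r|lborel. kern \<alpha> (y - z))"
proof -
  have r: "0 < r" using y norm_ge_zero[of y] by linarith
  define \<rho> where "\<rho> = min (norm y) (r - norm y)"
  have \<rho>: "0 < \<rho>" using y by (simp add: \<rho>_def)
  have sub: "z \<noteq> 0 \<and> norm z < r" if "z \<in> ball y \<rho>" for z
    using that norm_triangle_sub[of z y] by (auto simp: \<rho>_def dist_norm norm_minus_commute)
  have "l \<le> (LINT z:ball 0 r - ball y \<rho>|lborel. (V y - V z) * (kern \<alpha> (y - z) - kern_refl \<alpha> r y z))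
     + V y * ((LINT z:- ball 0 r|lborel. kern \<alpha> (y - z)) + (LINT z:ball 0 r|lborel. kern_refl \<alpha> r y z))"
    by (rule pv_antisymmetric_le[OF \<alpha> y(2) V anti l \<rho>]) (use sub min in auto)
  also have "(LINT z:ball 0 r - ball y \<rho>|lborel. (V y - V z) * (kern \<alpha> (y - z) - kern_refl \<alpha> r y z)) \<le> (LINT z:ball 0 r - ball y \<rho>|lborel. 0)"
  proof (rule set_integral_le_AE)
    show "AE z in lborel. z \<in> ball 0 r - ball y \<rho> \<longrightarrow> (V y - V z) * (kern \<alpha> (y - z) - kern_refl \<alpha> r y z) \<le> 0"
      using AE_lborel_singleton[of "0::'a"]
    proof eventually_elim
      case (elim z)
      show ?case
        using min[of z] elim kern_refl_le_kern[OF \<alpha> r y(2), of z] \<rho>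
        by (cases "z = y") (auto intro!: mult_nonpos_nonneg)
    qed
  qed (use set_integrable_antisymmetric[OF \<alpha> y(2) V(1) anti \<rho>] in \<open>auto simp: set_integrable_def\<close>)
  finally have "l \<le> V y * ((LINT z:- ball 0 r|lborel. kern \<alpha> (y - z)) + (LINT z:ball 0 r|lborel. kern_refl \<alpha> r y z))"
    by (simp add: set_lebesgue_integral_def)
  moreover have "0 \<le> (LINT z:ball 0 r|lborel. kern_refl \<alpha> r y z)"
    unfolding set_lebesgue_integral_def by (intro integral_nonneg_AE AE_I2) auto
  ultimately show ?thesis
    using mult_nonpos_nonneg[OF neg] by (smt (verit) distrib_left)
qed

lemma AE_zero_on_ball_False:
  fixes h :: "'a::euclidean_space \<Rightarrow> real"
  assumes "AE z in lborel. h z = 0" "0 < r" "\<And>z. z \<in> ball x r \<Longrightarrow> h z \<noteq> 0"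
  shows False
proof -
  obtain N where N: "N \<in> null_sets lborel" "{z. h z \<noteq> 0} \<subseteq> N"
    using assms(1) by (auto simp: eventually_ae_filter)
  have "ball x r \<subseteq> N" using N(2) assms(3) by blast
  then have "emeasure lborel (ball x r) \<le> emeasure lborel N" using N(1) by (intro emeasure_mono) auto
  also have "\<dots> = 0" using N(1) by auto
  finally have "measure lborel (ball x r) = 0" by (simp add: measure_def)
  then show False using assms(2) by simp
qed

lemma isCont_pos_ball:
  fixes f :: "'a::metric_space \<Rightarrow> real"
  assumes "isCont f x0" "0 < f x0"
  obtains d where "0 < d" "\<And>x. dist x x0 < d \<Longrightarrow> 0 < f x"
proof -
  obtain d where d: "0 < d" "\<And>x. dist x x0 < d \<Longrightarrow> dist (f x) (f x0) < f x0"
    using assms unfolding continuous_at_eps_delta by blast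
  have "0 < f x" if "dist x x0 < d" for x
    using d(2)[OF that] by (simp add: dist_real_def)
  with d(1) show ?thesis by (rule that)
qed

text \<open>Strong maximum principle. With \<open>V y = 0\<close> the mass terms drop out, and
  \<open>0 \<le> l\<close> makes the integral of the nonnegative
  \<open>V z * (kern - kern_refl)\<close> off a small ball vanish. The kernel difference is positive
  on all of the open ball apart from \<open>y\<close>, so by nonlocality one zero spreads in a
  single step, without a connectedness argument.\<close>

lemma pv_antisymmetric_strong:
  fixes y :: "'a::euclidean_space"
  assumes \<alpha>: "0 < \<alpha>" and y: "y \<noteq> 0" "norm y < r" and V: "tail_integrable \<alpha> V" "V differentiable (at y)"
    and anti: "antisymmetric_about \<alpha> r V" and l: "pv \<alpha> V y l" "0 \<le> l"
    and zero: "V y = 0" and nonneg: "\<And>z. z \<noteq> 0 \<Longrightarrow> norm z < r \<Longrightarrow> 0 \<le> V z"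
    and cont: "\<And>z. z \<noteq> 0 \<Longrightarrow> isCont V z"
    and z0: "z0 \<noteq> 0" "norm z0 < r"
  shows "V z0 = 0"
proof (rule ccontr)
  assume "V z0 \<noteq> 0"
  then have pos: "0 < V z0" using nonneg[OF z0] by simp
  with zero have ne: "z0 \<noteq> y" by auto
  have r: "0 < r" using y norm_ge_zero[of y] by linarith
  \<comment> \<open>The first term leaves a neighbourhood of \<open>z0\<close> outside the removed
    ball; the other two keep the removed ball inside the punctured one.\<close>
  define \<rho> where "\<rho> = min (dist y z0 / 2) (min (norm y) (r - norm y))"
  have \<rho>: "0 < \<rho>" using y ne by (simp add: \<rho>_def)
  have sub: "z \<noteq> 0 \<and> norm z < r" if "z \<in> ball y \<rho>" for z
    using that norm_triangle_sub[of z y] by (auto simp: \<rho>_def dist_norm norm_minus_commute)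
  define h where "h = (\<lambda>z. indicator (ball 0 r - ball y \<rho>) z * (V z * (kern \<alpha> (y - z) - kern_refl \<alpha> r y z)))"
  have "l \<le> (LINT z:ball 0 r - ball y \<rho>|lborel. (V y - V z) * (kern \<alpha> (y - z) - kern_refl \<alpha> r y z))
     + V y * ((LINT z:- ball 0 r|lborel. kern \<alpha> (y - z)) + (LINT z:ball 0 r|lborel. kern_refl \<alpha> r y z))"
    by (rule pv_antisymmetric_le[OF \<alpha> y(2) V anti l(1) \<rho>]) (use sub nonneg zero in auto)
  then have le: "(\<integral>z. h z \<partial>lborel) \<le> 0"
    using l(2) zero by (simp add: h_def set_lebesgue_integral_def)
  have ih: "integrable lborel h"
    using set_integrable_antisymmetric[OF \<alpha> y(2) V(1) anti \<rho>] zero by (simp add: h_def set_integrable_def)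
  have hn: "AE z in lborel. 0 \<le> h z"
    using AE_lborel_singleton[of "0::'a"]
  proof eventually_elim
    case (elim z)
    show ?case
      using nonneg[of z] elim kern_refl_le_kern[OF \<alpha> r y(2), of z] \<rho>
      by (cases "z = y") (auto simp: h_def indicator_def)
  qed
  have "(\<integral>z. h z \<partial>lborel) = 0"
    using le integral_nonneg_AE[OF hn] by linarith
  then have ae: "AE z in lborel. h z = 0"
    using integral_nonneg_eq_0_iff_AE[OF ih hn] by simp
  obtain d where d: "d > 0" "\<And>z. dist z z0 < d \<Longrightarrow> 0 < V z"
    using isCont_pos_ball[OF cont[OF z0(1)] pos] by blast
  define \<eta> where "\<eta> = min d (min (dist y z0 / 2) (r - norm z0))"
  have \<eta>: "\<eta> > 0" using d(1) z0 ne by (simp add: \<eta>_def)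
  have "h z \<noteq> 0" if "z \<in> ball z0 \<eta>" for z
  proof -
    have "0 < V z" using d(2)[of z] that by (simp add: \<eta>_def dist_commute)
    moreover have nz: "norm z < r" using that norm_triangle_sub[of z z0] by (auto simp: \<eta>_def dist_norm norm_minus_commute)
    moreover have "dist y z0 \<le> dist y z + dist z z0" by (rule dist_triangle)
    then have nb: "z \<notin> ball y \<rho>" using that by (auto simp: \<eta>_def \<rho>_def dist_commute)
    moreover have "kern_refl \<alpha> r y z < kern \<alpha> (y - z)"
      using nz nb \<rho> by (intro kern_refl_less_kern[OF \<alpha> r y(2)]) auto
    ultimately show ?thesis by (auto simp: h_def)
  qed
  then show False using AE_zero_on_ball_False[OF ae \<eta>] by blast
qed

section \<open>Lower bounds at a puncture\<close>

lemma kern_half: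
  fixes y z :: "'a::euclidean_space"
  assumes "0 < \<alpha>" "norm y \<le> norm z / 2" "z \<noteq> 0"
  shows "kern \<alpha> (y - z) \<le> 2 powr (real DIM('a) + \<alpha>) * kern \<alpha> z"
proof -
  let ?s = "real DIM('a) + \<alpha>"
  have "norm z / 2 \<le> norm (y - z)"
    using assms norm_triangle_sub[of z y] by (simp add: norm_minus_commute)
  then have "kern \<alpha> (y - z) \<le> (norm z / 2) powr - ?s"
    unfolding kern_def using assms by (intro powr_mono2') auto
  also have "(norm z / 2) powr - ?s = (2 / norm z) powr ?s"
    using assms by (intro powr_divide_minus) auto
  also have "\<dots> = 2 powr ?s * kern \<alpha> z"
    unfolding kern_def powr_minus_divide using assms by (simp add: powr_divide)
  finally show ?thesis .
qed

lemma set_integrable_kern: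
  assumes "0 < \<alpha>" "0 < d" and [measurable]: "A \<in> sets borel" and "A \<subseteq> - ball 0 d"
  shows "set_integrable lborel A (kern \<alpha> :: 'a::euclidean_space \<Rightarrow> real)"
  using set_integrable_tail_kern[OF assms(1) tail_integrable_const[OF assms(1), of 1] _ assms(2,4)] assms(3)
  by (simp add: kern_def[abs_def])

lemma kern_lower:
  fixes y z :: "'a::euclidean_space"
  assumes "0 < \<alpha>" "y \<noteq> z" "norm (y - z) \<le> d"
  shows "d powr - (real DIM('a) + \<alpha>) \<le> kern \<alpha> (y - z)"
  unfolding kern_def using assms by (intro powr_mono2') auto

lemma annulus_measure_pos:
  assumes "0 < \<delta>"
  shows "0 < measure lborel {z::'a::euclidean_space. 2 * \<delta> \<le> norm z \<and> norm z \<le> 3 * \<delta>}" (is "0 < measure lborel ?A")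
proof -
  obtain b :: 'a where b: "b \<in> Basis" using nonempty_Basis by blast
  have "ball ((5 * \<delta> / 2) *\<^sub>R b) (\<delta> / 2) \<subseteq> ?A"
  proof
    fix z assume "z \<in> ball ((5 * \<delta> / 2) *\<^sub>R b) (\<delta> / 2)"
    then have "norm ((5 * \<delta> / 2) *\<^sub>R b - z) < \<delta> / 2" by (simp add: dist_norm)
    moreover have "norm ((5 * \<delta> / 2) *\<^sub>R b) = 5 * \<delta> / 2" using b assms by simp
    ultimately show "z \<in> ?A"
      using norm_triangle_sub[of "(5 * \<delta> / 2) *\<^sub>R b" z] norm_triangle_sub[of z "(5 * \<delta> / 2) *\<^sub>R b"]
      by (simp add: norm_minus_commute)
  qed
  moreover have "?A \<in> sets borel" by measurable
  moreover have "emeasure lborel ?A < \<infinity>"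
    by (rule le_less_trans[OF emeasure_mono emeasure_lborel_cball_finite[of 0 "3 * \<delta>"]]) auto
  ultimately have "measure lborel (ball ((5 * \<delta> / 2) *\<^sub>R b) (\<delta> / 2)) \<le> measure lborel ?A"
    by (intro measure_mono_fmeasurable) (auto simp: fmeasurable_def)
  then show ?thesis using assms by (smt (verit) content_ball_gt_0_iff half_gt_zero)
qed

lemma annulus_finite:
  "emeasure lborel {z::'a::euclidean_space. 2 * \<delta> \<le> norm z \<and> norm z \<le> 3 * \<delta>} < \<infinity>"
  by (rule le_less_trans[OF emeasure_mono emeasure_lborel_cball_finite[of 0 "3 * \<delta>"]]) auto

lemma puncture_constant:
  fixes v m c N :: real
  assumes "0 \<le> v" "0 \<le> N" "m * c \<le> v * N"
  shows "c / (N + 1) * m \<le> v"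
proof -
  have "m * c \<le> v * (N + 1)" using assms by (simp add: distrib_left)
  then show ?thesis using assms by (simp add: field_simps)
qed

text \<open>Inside radius \<open>\<delta>\<close> minimality makes the integrand nonpositive.
  Outside, \<open>V y * k z\<close> costs at most \<open>V y\<close> times a kernel mass, and
  \<open>- V z * k z\<close> gains at least \<open>m * b\<close> on the annulus. The kernel
  \<open>k\<close> is abstract because both the full and the folded kernel will be used.\<close>

lemma annulus_comparison:
  fixes V k :: "'a::euclidean_space \<Rightarrow> real"
  defines "A \<equiv> \<lambda>\<delta>. {z::'a. 2 * \<delta> \<le> norm z \<and> norm z \<le> 3 * \<delta>}"
  assumes \<alpha>: "0 < \<alpha>" and \<delta>: "0 < \<delta>" and y: "norm y < \<delta> / 2"
    and int: "set_integrable lborel S (\<lambda>z. (V y - V z) * k z)" and S: "A \<delta> \<subseteq> S"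
    and k: "\<And>z. z \<in> S \<Longrightarrow> z \<noteq> y \<Longrightarrow> 0 \<le> k z" "\<And>z. z \<in> S \<Longrightarrow> z \<noteq> y \<Longrightarrow> k z \<le> kern \<alpha> (y - z)"
    and b: "\<And>z. z \<in> A \<delta> \<Longrightarrow> b \<le> k z"
    and min: "\<And>z. z \<noteq> 0 \<Longrightarrow> norm z < \<delta> \<Longrightarrow> V y \<le> V z"
    and nonneg: "0 \<le> V y" "\<And>z. z \<in> S \<Longrightarrow> z \<noteq> 0 \<Longrightarrow> 0 \<le> V z"
    and m: "0 \<le> m" "\<And>z. z \<in> A \<delta> \<Longrightarrow> m \<le> V z"
  shows "(LINT z:S|lborel. (V y - V z) * k z)
    \<le> V y * (2 powr (real DIM('a) + \<alpha>) * (LINT z:- ball 0 \<delta>|lborel. kern \<alpha> (z::'a))) - m * (b * measure lborel (A \<delta>))"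
proof -
  let ?c = "2 powr (real DIM('a) + \<alpha>)"
  define g where "g = (\<lambda>z. V y * ?c * (indicator (- ball 0 \<delta>) z * kern \<alpha> z) - m * b * indicator (A \<delta>) z)"
  have "A \<delta> \<in> sets borel" unfolding A_def by measurable
  then have iA: "integrable lborel (\<lambda>z. m * b * indicator (A \<delta>) z :: real)"
    using annulus_finite[of \<delta>] by (intro integrable_mult_right integrable_real_indicator) (auto simp: A_def)
  have ik: "integrable lborel (\<lambda>z. V y * ?c * (indicator (- ball 0 \<delta>) z * kern \<alpha> (z::'a)))"
    using set_integrable_kern[OF \<alpha> \<delta>, of "- ball (0::'a) \<delta>"] by (intro integrable_mult_right) (auto simp: set_integrable_def)
  have "(LINT z:S|lborel. (V y - V z) * k z) \<le> (\<integral>z. g z \<partial>lborel)"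
    unfolding set_lebesgue_integral_def
  proof (rule integral_mono_AE)
    show "integrable lborel (\<lambda>z. indicator S z *\<^sub>R ((V y - V z) * k z))"
      using int by (simp add: set_integrable_def)
    show "integrable lborel g" unfolding g_def by (intro Bochner_Integration.integrable_diff ik iA)
    show "AE z in lborel. indicator S z *\<^sub>R ((V y - V z) * k z) \<le> g z"
      using AE_lborel_singleton[of "0::'a"]
    proof eventually_elim
      case (elim z)
      show ?case
      proof (cases "norm z < \<delta>")
        case True
        then have "z \<notin> A \<delta>" using \<delta> by (auto simp: A_def)
        then show ?thesis using True min[OF elim True] k(1)[of z]
          by (cases "z = y") (auto simp: g_def indicator_def mult_nonpos_nonneg)
      next
        case False
        then have zy: "z \<noteq> y" using y \<delta> by auto
        show ?thesis
        proof (cases "z \<in> S")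
          case True
          have "k z \<le> ?c * kern \<alpha> z"
            using k(2)[OF True zy] kern_half[OF \<alpha>, of y z] y elim False by auto
          then have vk: "V y * k z \<le> V y * (?c * kern \<alpha> z)" using nonneg(1) by (rule mult_left_mono)
          have "m * b * indicator (A \<delta>) z \<le> V z * k z"
          proof (cases "z \<in> A \<delta>")
            case zA: True
            have "m * b \<le> m * k z" using m b zA by (intro mult_left_mono)
            also have "\<dots> \<le> V z * k z" using m k(1)[OF True zy] zA by (intro mult_right_mono) auto
            finally show ?thesis using zA by simp
          qed (use nonneg(2)[OF True elim] k(1)[OF True zy] in simp)
          then show ?thesis using vk True False by (simp add: g_def left_diff_distrib mult.assoc)
        next
          case nS: False
          then have "z \<notin> A \<delta>" using S by blast
          then show ?thesis using nS False nonneg(1) by (simp add: g_def)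
        qed
      qed
    qed
  qed
  also have "\<dots> = V y * (?c * (LINT z:- ball 0 \<delta>|lborel. kern \<alpha> (z::'a))) - m * (b * measure lborel (A \<delta>))"
    unfolding g_def using ik iA by (simp add: set_lebesgue_integral_def)
  finally show ?thesis .
qed

text \<open>With \<open>0 \<le> l\<close>, \<open>annulus_comparison\<close> yields
  \<open>m * c \<le> V y * T\<close>: positive values on the annulus force a positive value near the
  puncture. The order of quantifiers is the point: \<open>\<kappa>\<close> does not depend on
  \<open>V\<close>, so the bound is uniform when small multiples of a singular function are added.
  Dividing by \<open>T + 1\<close> makes \<open>0 \<le> T\<close> sufficient.\<close>

lemma puncture_bound:
  assumes \<alpha>: "0 < \<alpha>" and \<delta>: "0 < \<delta>"
  obtains \<kappa> where "0 < \<kappa>"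
    "\<And>(V :: 'a::euclidean_space \<Rightarrow> real) y m l. \<lbrakk>tail_integrable \<alpha> V; pv \<alpha> V y l; 0 \<le> l;
      y \<noteq> 0; norm y < \<delta> / 2; \<And>z. z \<noteq> 0 \<Longrightarrow> norm z < \<delta> \<Longrightarrow> V y \<le> V z; \<And>z. z \<noteq> 0 \<Longrightarrow> 0 \<le> V z;
      \<And>z. 2 * \<delta> \<le> norm z \<Longrightarrow> norm z \<le> 3 * \<delta> \<Longrightarrow> m \<le> V z; 0 \<le> m\<rbrakk> \<Longrightarrow> \<kappa> * m \<le> V y"
proof -
  let ?s = "real DIM('a) + \<alpha>"
  let ?A = "{z::'a. 2 * \<delta> \<le> norm z \<and> norm z \<le> 3 * \<delta>}"
  define b where "b = (4 * \<delta>) powr - ?s"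
  define c where "c = b * measure lborel ?A"
  define T where "T = 2 powr ?s * (LINT z:- ball 0 \<delta>|lborel. kern \<alpha> (z::'a))"
  have "0 < b" using \<delta> by (simp add: b_def)
  then have c: "0 < c" using mult_pos_pos annulus_measure_pos[OF \<delta>] by (simp only: c_def)
  have T: "0 \<le> T" unfolding T_def set_lebesgue_integral_def
    by (intro mult_nonneg_nonneg integral_nonneg_AE AE_I2) auto
  show ?thesis
  proof (rule that[of "c / (T + 1)"])
    show "0 < c / (T + 1)" using c T by (auto intro!: divide_pos_pos)
    fix V :: "'a \<Rightarrow> real" and y m l
    assume V: "tail_integrable \<alpha> V" and l: "pv \<alpha> V y l" "0 \<le> l" and y: "y \<noteq> 0" "norm y < \<delta> / 2"
      and min: "\<And>z. z \<noteq> 0 \<Longrightarrow> norm z < \<delta> \<Longrightarrow> V y \<le> V z" and nonneg: "\<And>z. z \<noteq> 0 \<Longrightarrow> 0 \<le> V z"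
      and m: "\<And>z. 2 * \<delta> \<le> norm z \<Longrightarrow> norm z \<le> 3 * \<delta> \<Longrightarrow> m \<le> V z" "0 \<le> m"
    have bound: "(LINT z:- ball y \<epsilon>|lborel. (V y - V z) * kern \<alpha> (y - z)) \<le> V y * T - m * c"
      if \<epsilon>: "0 < \<epsilon>" "\<epsilon> < \<delta> / 2" for \<epsilon>
      unfolding T_def c_def
    proof (rule annulus_comparison[OF \<alpha> \<delta> y(2)])
      show "set_integrable lborel (- ball y \<epsilon>) (\<lambda>z. (V y - V z) * kern \<alpha> (y - z))"
        by (rule set_integrable_pv[OF \<alpha> V _ \<epsilon>(1)]) auto
      show "?A \<subseteq> - ball y \<epsilon>"
      proof
        fix z assume "z \<in> ?A"
        then show "z \<in> - ball y \<epsilon>"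
          using \<epsilon> y norm_triangle_sub[of z y] by (auto simp: dist_norm norm_minus_commute)
      qed
      show "b \<le> kern \<alpha> (y - z)" if "z \<in> ?A" for z
        unfolding b_def using that norm_triangle_ineq4[of y z] y \<delta> by (intro kern_lower[OF \<alpha>]) auto
    qed (use y min nonneg m in auto)
    have "l \<le> V y * T - m * c"
    proof (rule tendsto_upperbound)
      show "((\<lambda>\<epsilon>. LINT z:- ball y \<epsilon>|lborel. (V y - V z) * kern \<alpha> (y - z)) \<longlongrightarrow> l) (at_right 0)"
        using l by (simp add: pv_def)
      show "\<forall>\<^sub>F \<epsilon> in at_right 0. (LINT z:- ball y \<epsilon>|lborel. (V y - V z) * kern \<alpha> (y - z)) \<le> V y * T - m * c"
        unfolding eventually_at_right_field using bound \<delta> by (intro exI[of _ "\<delta> / 2"]) auto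
    qed auto
    then have "m * c \<le> V y * T" using l by linarith
    then show "c / (T + 1) * m \<le> V y"
      by (rule puncture_constant[OF nonneg[OF y(1)] T])
  qed
qed

text \<open>The mechanism of \<open>puncture_bound\<close> for functions whose sign is known only
  inside the ball; folding compensates for the missing sign outside.\<close>

lemma antisymmetric_puncture_bound:
  assumes \<alpha>: "0 < \<alpha>" and \<delta>: "0 < \<delta>" "16 * \<delta> \<le> r"
  obtains \<kappa> where "0 < \<kappa>"
    "\<And>(V :: 'a::euclidean_space \<Rightarrow> real) y m l. \<lbrakk>tail_integrable \<alpha> V; V differentiable (at y);
      antisymmetric_about \<alpha> r V; pv \<alpha> V y l; 0 \<le> l;
      y \<noteq> 0; norm y < \<delta> / 2; \<And>z. z \<noteq> 0 \<Longrightarrow> norm z < \<delta> \<Longrightarrow> V y \<le> V z;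
      \<And>z. z \<noteq> 0 \<Longrightarrow> norm z < r \<Longrightarrow> 0 \<le> V z;
      \<And>z. 2 * \<delta> \<le> norm z \<Longrightarrow> norm z \<le> 3 * \<delta> \<Longrightarrow> m \<le> V z; 0 \<le> m\<rbrakk> \<Longrightarrow> \<kappa> * m \<le> V y"
proof -
  let ?s = "real DIM('a) + \<alpha>"
  let ?A = "{z::'a. 2 * \<delta> \<le> norm z \<and> norm z \<le> 3 * \<delta>}"
  have r: "0 < r" using \<delta> by linarith
  \<comment> \<open>On the annulus the kernel is at least the first term and the reflected kernel at
    most the second; \<open>16 * \<delta> \<le> r\<close> gives \<open>4 * \<delta> < r / 2\<close>
    and hence \<open>b > 0\<close>.\<close>
  define b where "b = (4 * \<delta>) powr - ?s - (r / 2) powr - ?s"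
  define c where "c = b * measure lborel ?A"
  define T where "T = 2 powr ?s * (LINT z:- ball 0 \<delta>|lborel. kern \<alpha> (z::'a))"
  \<comment> \<open>The first \<open>T\<close> comes from \<open>annulus_comparison\<close>; the
    bracket bounds the exterior and reflected kernel masses that multiply
    \<open>V y\<close>.\<close>
  define N where "N = T + (T + (r / 2) powr - ?s * measure lborel (ball (0::'a) r))"
  have "0 < b" unfolding b_def using \<delta> \<alpha> powr_less_mono2_neg[of "- ?s" "4 * \<delta>" "r / 2"] by auto
  then have c: "0 < c" using mult_pos_pos annulus_measure_pos[OF \<delta>(1)] by (simp only: c_def)
  have "0 \<le> T" unfolding T_def set_lebesgue_integral_def
    by (intro mult_nonneg_nonneg integral_nonneg_AE AE_I2) auto
  then have N: "0 \<le> N" by (auto simp: N_def)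
  show ?thesis
  proof (rule that[of "c / (N + 1)"])
    show "0 < c / (N + 1)" using c N by (auto intro!: divide_pos_pos)
    fix V :: "'a \<Rightarrow> real" and y m l
    assume V: "tail_integrable \<alpha> V" "V differentiable (at y)" and anti: "antisymmetric_about \<alpha> r V"
      and l: "pv \<alpha> V y l" "0 \<le> l" and y: "y \<noteq> 0" "norm y < \<delta> / 2"
      and min: "\<And>z. z \<noteq> 0 \<Longrightarrow> norm z < \<delta> \<Longrightarrow> V y \<le> V z"
      and nonneg: "\<And>z. z \<noteq> 0 \<Longrightarrow> norm z < r \<Longrightarrow> 0 \<le> V z"
      and m: "\<And>z. 2 * \<delta> \<le> norm z \<Longrightarrow> norm z \<le> 3 * \<delta> \<Longrightarrow> m \<le> V z" "0 \<le> m"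
    have yr: "norm y < r" using y \<delta> by linarith
    have vy: "0 \<le> V y" using nonneg[OF y(1) yr] .
    define \<rho> where "\<rho> = min (norm y) (\<delta> / 2)"
    have \<rho>: "0 < \<rho>" using y \<delta> by (simp add: \<rho>_def)
    have sub: "z \<noteq> 0 \<and> norm z < \<delta>" if "z \<in> ball y \<rho>" for z
      using that norm_triangle_sub[of z y] y by (auto simp: \<rho>_def dist_norm norm_minus_commute)
    have "l \<le> (LINT z:ball 0 r - ball y \<rho>|lborel. (V y - V z) * (kern \<alpha> (y - z) - kern_refl \<alpha> r y z))
       + V y * ((LINT z:- ball 0 r|lborel. kern \<alpha> (y - z)) + (LINT z:ball 0 r|lborel. kern_refl \<alpha> r y z))"
      by (rule pv_antisymmetric_le[OF \<alpha> yr V anti l(1) \<rho>]) (use sub min \<delta> in fastforce)+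
    also have "(LINT z:ball 0 r - ball y \<rho>|lborel. (V y - V z) * (kern \<alpha> (y - z) - kern_refl \<alpha> r y z)) \<le> V y * T - m * c"
      unfolding T_def c_def
    proof (rule annulus_comparison[OF \<alpha> \<delta>(1) y(2) set_integrable_antisymmetric[OF \<alpha> yr V(1) anti \<rho>]])
      show "?A \<subseteq> ball 0 r - ball y \<rho>" using sub \<delta> by fastforce
      show "0 \<le> kern \<alpha> (y - z) - kern_refl \<alpha> r y z" if "z \<in> ball 0 r - ball y \<rho>" "z \<noteq> y" for z
        using that kern_refl_le_kern[OF \<alpha> r yr, of z] by simp
      show "b \<le> kern \<alpha> (y - z) - kern_refl \<alpha> r y z" if "z \<in> ?A" for z
      proof -
        have "(4 * \<delta>) powr - ?s \<le> kern \<alpha> (y - z)"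
          using that norm_triangle_ineq4[of y z] y \<delta> by (intro kern_lower[OF \<alpha>]) auto
        moreover have "kern_refl \<alpha> r y z \<le> (r / 2) powr - ?s"
          using y \<delta> that r by (intro kern_refl_bound[OF \<alpha>]) auto
        ultimately show ?thesis by (simp add: b_def)
      qed
    qed (use min nonneg m vy in auto)
    finally have l1: "l \<le> V y * T - m * c
      + V y * ((LINT z:- ball 0 r|lborel. kern \<alpha> (y - z)) + (LINT z:ball 0 r|lborel. kern_refl \<alpha> r y z))"
      by simp
    have "(LINT z:- ball 0 r|lborel. kern \<alpha> (y - z)) \<le> (\<integral>z. 2 powr ?s * (indicator (- ball 0 \<delta>) z * kern \<alpha> (z::'a)) \<partial>lborel)"
      unfolding set_lebesgue_integral_def
    proof (rule Bochner_Integration.integral_mono)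
      have "set_integrable lborel (- ball 0 r) (\<lambda>z. 1 * kern \<alpha> (y - z))"
        using yr by (intro set_integrable_tail_kern[OF \<alpha> tail_integrable_const[OF \<alpha>] _ _ ball_complement_subset]) auto
      then show "integrable lborel (\<lambda>z. indicator (- ball 0 r) z *\<^sub>R kern \<alpha> (y - z))" by (simp add: set_integrable_def)
      show "integrable lborel (\<lambda>z. 2 powr ?s * (indicator (- ball 0 \<delta>) z * kern \<alpha> (z::'a)))"
        using set_integrable_kern[OF \<alpha> \<delta>(1), of "- ball (0::'a) \<delta>"] by (intro integrable_mult_right) (auto simp: set_integrable_def)
      show "indicator (- ball 0 r) z *\<^sub>R kern \<alpha> (y - z) \<le> 2 powr ?s * (indicator (- ball 0 \<delta>) z * kern \<alpha> z)" for z
      proof (cases "z \<in> ball 0 r")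
        case False
        then show ?thesis using kern_half[OF \<alpha>, of y z] y \<delta> r by (cases "z = 0") (auto simp: indicator_def)
      qed (auto simp: indicator_def)
    qed
    then have "(LINT z:- ball 0 r|lborel. kern \<alpha> (y - z)) \<le> T"
      by (simp add: T_def set_lebesgue_integral_def)
    moreover have "(LINT z:ball 0 r|lborel. kern_refl \<alpha> r y z) \<le> (LINT z:ball (0::'a) r|lborel. (r / 2) powr - ?s)"
    proof (rule set_integral_mono)
      show "set_integrable lborel (ball 0 r) (kern_refl \<alpha> r y)" by (rule set_integrable_kern_refl[OF \<alpha> yr])
      show "set_integrable lborel (ball (0::'a) r) (\<lambda>_. (r / 2) powr - ?s)"
        by (rule set_integrable_bounded[of _ _ 0 r "(r / 2) powr - ?s"]) auto
      show "kern_refl \<alpha> r y z \<le> (r / 2) powr - ?s" if "z \<in> ball 0 r" for z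
        using y \<delta> that r by (intro kern_refl_bound[OF \<alpha>]) auto
    qed
    then have "(LINT z:ball 0 r|lborel. kern_refl \<alpha> r y z) \<le> (r / 2) powr - ?s * measure lborel (ball (0::'a) r)"
      by (simp add: set_lebesgue_integral_def mult.commute)
    ultimately have "V y * ((LINT z:- ball 0 r|lborel. kern \<alpha> (y - z)) + (LINT z:ball 0 r|lborel. kern_refl \<alpha> r y z))
       \<le> V y * (T + (r / 2) powr - ?s * measure lborel (ball (0::'a) r))"
      using vy by (intro mult_left_mono add_mono)
    then have "m * c \<le> V y * N" using l1 l(2) unfolding N_def distrib_left[of "V y" T] by linarith
    then show "c / (N + 1) * m \<le> V y"
      by (rule puncture_constant[OF vy N])
  qed
qed

text \<open>With \<open>d = r - norm y\<close>, a ball of radius \<open>d\<close> fits outside the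
  sphere within distance \<open>3 * d\<close> of \<open>y\<close>; volume times kernel is of order
  \<open>d powr n * d powr - (n + \<alpha>)\<close>.\<close>

lemma kern_integral_lower:
  fixes y :: "'a::euclidean_space"
  assumes \<alpha>: "0 < \<alpha>" and y: "y \<noteq> 0" "norm y < r"
  shows "unit_ball_vol (real DIM('a)) * 3 powr - (real DIM('a) + \<alpha>) * (r - norm y) powr - \<alpha>
     \<le> (LINT z:- ball 0 r|lborel. kern \<alpha> (y - z))"
proof -
  let ?s = "real DIM('a) + \<alpha>"
  define d where "d = r - norm y"
  have d: "d > 0" using y by (simp add: d_def)
  \<comment> \<open>On the ray through \<open>y\<close>, at distance \<open>2 * d\<close> from
    \<open>y\<close> and hence \<open>d\<close> beyond the sphere.\<close>
  define w where "w = ((norm y + 2 * d) / norm y) *\<^sub>R y"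
  have w: "norm w = norm y + 2 * d" using y d by (simp add: w_def)
  have "w - y = ((norm y + 2 * d) / norm y - 1) *\<^sub>R y" by (simp add: w_def scaleR_diff_left)
  also have "(norm y + 2 * d) / norm y - 1 = 2 * d / norm y" using y by (simp add: field_simps)
  finally have wy: "norm (w - y) = 2 * d" using y d by simp
  have sub: "norm z \<ge> r \<and> norm (y - z) \<le> 3 * d" if "z \<in> ball w d" for z
  proof -
    have "norm (w - z) < d" using that by (simp add: dist_norm)
    then show ?thesis using norm_triangle_sub[of w z] norm_triangle_ineq[of "y - w" "w - z"] w wy
      by (simp add: d_def norm_minus_commute)
  qed
  have fin: "emeasure lborel (ball w d) < \<infinity>" by (rule emeasure_lborel_ball_finite)
  have "(\<integral>z. (3 * d) powr - ?s * indicator (ball w d) z \<partial>lborel) \<le> (LINT z:- ball 0 r|lborel. kern \<alpha> (y - z))"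
    unfolding set_lebesgue_integral_def
  proof (rule Bochner_Integration.integral_mono)
    show "integrable lborel (\<lambda>z. (3 * d) powr - ?s * indicator (ball w d) z :: real)"
      using fin by (intro integrable_mult_right integrable_real_indicator) auto
    have "set_integrable lborel (- ball 0 r) (\<lambda>z. 1 * kern \<alpha> (y - z))"
      using y by (intro set_integrable_tail_kern[OF \<alpha> tail_integrable_const[OF \<alpha>] _ _ ball_complement_subset]) auto
    then show "integrable lborel (\<lambda>z. indicator (- ball 0 r) z *\<^sub>R kern \<alpha> (y - z))" by (simp add: set_integrable_def)
    show "(3 * d) powr - ?s * indicator (ball w d) z \<le> indicator (- ball 0 r) z *\<^sub>R kern \<alpha> (y - z)" for z
    proof (cases "z \<in> ball w d")
      case True
      then have "y \<noteq> z" using sub[OF True] y by auto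
      then show ?thesis using sub[OF True] kern_lower[OF \<alpha>, of y z "3 * d"] True by (auto simp: indicator_def)
    qed (auto simp: indicator_def)
  qed
  moreover have "(\<integral>z. (3 * d) powr - ?s * indicator (ball w d) z \<partial>lborel)
      = unit_ball_vol (real DIM('a)) * 3 powr - ?s * d powr - \<alpha>"
  proof -
    have "(\<integral>z. (3 * d) powr - ?s * indicator (ball w d) z \<partial>lborel) = (3 * d) powr - ?s * (unit_ball_vol (real DIM('a)) * d ^ DIM('a))"
      using d by (simp add: content_ball)
    also have "\<dots> = unit_ball_vol (real DIM('a)) * 3 powr - ?s * (d powr - ?s * d powr real DIM('a))"
      using d by (simp add: powr_mult powr_realpow)
    also have "d powr - ?s * d powr real DIM('a) = d powr - \<alpha>"
      unfolding powr_add[symmetric] by simp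
    finally show ?thesis .
  qed
  ultimately show ?thesis by (simp only: d_def)
qed

section \<open>Moving spheres about the origin\<close>

lemma kelvin_kelvin:
  fixes f :: "'a::euclidean_space \<Rightarrow> real"
  assumes "0 < r" "z \<noteq> 0"
  shows "kelvin \<alpha> r (kelvin \<alpha> r f) z = f z"
proof -
  have "r / norm (inversion r z) = inverse (r / norm z)"
    using assms by (simp add: norm_inversion power2_eq_square)
  moreover have "(r / norm z) powr b * inverse (r / norm z) powr b = 1" for b
    using assms by (simp add: powr_mult[symmetric])
  ultimately show ?thesis
    using assms by (simp add: kelvin_def mult.assoc[symmetric])
qed

lemma antisymmetric_kelvin_diff:
  assumes "0 < r"
  shows "antisymmetric_about \<alpha> r (\<lambda>z. kelvin \<alpha> r f z - f z)"
proof -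
  have "kelvin \<alpha> r (\<lambda>z. kelvin \<alpha> r f z - f z) z = kelvin \<alpha> r (kelvin \<alpha> r f) z - kelvin \<alpha> r f z" for z
    by (simp add: kelvin_def right_diff_distrib)
  then show ?thesis using assms by (simp add: antisymmetric_about_def kelvin_kelvin)
qed

lemma antisymmetric_add_cmult:
  assumes "antisymmetric_about \<alpha> r V" "antisymmetric_about \<alpha> r W"
  shows "antisymmetric_about \<alpha> r (\<lambda>z. V z + c * W z)"
proof -
  have "kelvin \<alpha> r (\<lambda>z. V z + c * W z) z = kelvin \<alpha> r V z + c * kelvin \<alpha> r W z" for z
    by (simp add: kelvin_def algebra_simps)
  then show ?thesis using assms by (simp add: antisymmetric_about_def)
qed

lemma kelvin_one: "kelvin \<alpha> r (\<lambda>_. 1) z = (r / norm z) powr (real DIM('a) - \<alpha>)"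
  for z :: "'a::euclidean_space"
  by (simp add: kelvin_def)

lemma powr_blowup:
  fixes r a K :: real
  assumes "0 < r" "0 < a"
  obtains \<eta> where "0 < \<eta>" "\<And>t. 0 < t \<Longrightarrow> t < \<eta> \<Longrightarrow> K \<le> (r / t) powr a"
proof -
  define \<eta> where "\<eta> = r / (\<bar>K\<bar> + 1) powr (1 / a)"
  have q: "0 < (\<bar>K\<bar> + 1) powr (1 / a)" by (simp add: powr_gt_zero)
  have "0 < \<eta>" using assms q by (simp add: \<eta>_def)
  moreover have "K \<le> (r / t) powr a" if "0 < t" "t < \<eta>" for t
  proof -
    have "t * (\<bar>K\<bar> + 1) powr (1 / a) < r" using that q by (simp add: \<eta>_def pos_less_divide_eq)
    then have "(\<bar>K\<bar> + 1) powr (1 / a) \<le> r / t" using that by (simp add: pos_le_divide_eq mult.commute)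
    then have "((\<bar>K\<bar> + 1) powr (1 / a)) powr a \<le> (r / t) powr a"
      using assms by (intro powr_mono2) auto
    then show ?thesis using assms by (simp add: powr_powr)
  qed
  ultimately show ?thesis by (rule that)
qed

lemma compact_annulus: "compact {z::'a::euclidean_space. a \<le> norm z \<and> norm z \<le> b}"
proof -
  have "{z::'a. a \<le> norm z \<and> norm z \<le> b} = cball 0 b - ball 0 a" by auto
  then show ?thesis by (simp add: compact_diff)
qed

lemma annulus_attains_min:
  fixes f :: "'a::euclidean_space \<Rightarrow> real"
  assumes "0 < a" "a \<le> b" and cont: "\<And>z. z \<noteq> 0 \<Longrightarrow> isCont f z"
  obtains w where "a \<le> norm w" "norm w \<le> b" "\<And>z. a \<le> norm z \<Longrightarrow> norm z \<le> b \<Longrightarrow> f w \<le> f z"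
proof -
  let ?Q = "{z::'a. a \<le> norm z \<and> norm z \<le> b}"
  obtain e :: 'a where "e \<in> Basis" using nonempty_Basis by blast
  then have "a *\<^sub>R e \<in> ?Q" using assms by simp
  then have "?Q \<noteq> {}" by blast
  moreover have "continuous_on ?Q f"
    using assms by (intro continuous_at_imp_continuous_on ballI cont) auto
  ultimately obtain w where "w \<in> ?Q" "\<And>z. z \<in> ?Q \<Longrightarrow> f w \<le> f z"
    using continuous_attains_inf[OF compact_annulus] by blast
  then show ?thesis by (intro that[of w]) auto
qed

text \<open>On a punctured ball \<open>V\<close> need not attain its infimum. Adding
  \<open>\<epsilon> * h\<close>, with \<open>h\<close> infinite at the puncture, restores a minimum;
  \<open>step\<close> bounds its value from below uniformly in \<open>\<epsilon>\<close>, and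
  \<open>\<epsilon>\<close> can be chosen as small as the fixed point \<open>y\<close>
  requires.\<close>

lemma puncture_principle:
  fixes V h :: "'a::euclidean_space \<Rightarrow> real"
  assumes \<delta>: "0 < \<delta>" and m: "0 < m" and \<kappa>: "0 < \<kappa>"
    and cont: "\<And>z. z \<noteq> 0 \<Longrightarrow> isCont V z" "\<And>z. z \<noteq> 0 \<Longrightarrow> isCont h z"
    and blow: "\<And>K. \<exists>\<eta>>0. \<forall>z. z \<noteq> 0 \<longrightarrow> norm z < \<eta> \<longrightarrow> K \<le> h z"
    and nonneg: "\<And>z. z \<noteq> 0 \<Longrightarrow> norm z \<le> \<delta> \<Longrightarrow> 0 \<le> V z" "\<And>z. z \<noteq> 0 \<Longrightarrow> norm z \<le> \<delta> \<Longrightarrow> 0 \<le> h z"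
    and low: "\<And>z. \<delta> / 2 \<le> norm z \<Longrightarrow> norm z \<le> \<delta> \<Longrightarrow> m \<le> V z"
    and step: "\<And>\<epsilon> y. \<lbrakk>0 < \<epsilon>; y \<noteq> 0; norm y < \<delta> / 2; \<And>z. z \<noteq> 0 \<Longrightarrow> norm z < \<delta> \<Longrightarrow> V y + \<epsilon> * h y \<le> V z + \<epsilon> * h z\<rbrakk>
      \<Longrightarrow> \<kappa> * m \<le> V y + \<epsilon> * h y"
    and y: "y \<noteq> 0" "norm y \<le> \<delta>"
  shows "min 1 \<kappa> * m \<le> V y"
proof (rule ccontr)
  assume "\<not> ?thesis"
  then have less: "V y < min 1 \<kappa> * m" by simp
  \<comment> \<open>Small enough that the perturbed value at \<open>y\<close> still violates the
    claim; the \<open>+ 1\<close> covers \<open>h y = 0\<close>.\<close>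
  define \<epsilon> where "\<epsilon> = (min 1 \<kappa> * m - V y) / (h y + 1)"
  have hy: "0 \<le> h y" using nonneg y by blast
  then have \<epsilon>: "0 < \<epsilon>" using less by (simp add: \<epsilon>_def)
  have "\<epsilon> * h y < \<epsilon> * (h y + 1)" using \<epsilon> by simp
  also have "\<dots> = min 1 \<kappa> * m - V y" using hy by (simp add: \<epsilon>_def)
  finally have Vy: "V y + \<epsilon> * h y < min 1 \<kappa> * m" by simp
  obtain \<eta> where \<eta>: "\<eta> > 0" "\<And>z. z \<noteq> 0 \<Longrightarrow> norm z < \<eta> \<Longrightarrow> m / \<epsilon> \<le> h z"
    using blow by blast
  have big: "min 1 \<kappa> * m \<le> V z + \<epsilon> * h z" if "z \<noteq> 0" "norm z < \<eta>" "norm z \<le> \<delta>" for z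
  proof -
    have "m \<le> \<epsilon> * h z" using \<eta>(2)[OF that(1,2)] \<epsilon> by (simp add: field_simps)
    moreover have "min 1 \<kappa> * m \<le> 1 * m" using m by (intro mult_right_mono) auto
    ultimately show ?thesis using nonneg(1)[OF that(1,3)] by linarith
  qed
  \<comment> \<open>Below radius \<open>\<eta>\<close> the term \<open>\<epsilon> * h\<close> alone
    is at least \<open>m\<close>, so a minimum over this compact annulus is one over the punctured
    ball. The inner radius is also at most \<open>norm y\<close>, to keep \<open>y\<close> in the
    annulus.\<close>
  define Q where "Q = {z::'a. min \<eta> (norm y) \<le> norm z \<and> norm z \<le> \<delta>}"
  have "y \<in> Q" using y by (simp add: Q_def)
  have "0 < min \<eta> (norm y)" using \<eta>(1) y by simp
  then have nz: "z \<noteq> 0" if "z \<in> Q" for z using that by (auto simp: Q_def simp del: min_less_iff_conj)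
  have "continuous_on Q (\<lambda>z. V z + \<epsilon> * h z)"
    using cont nz by (auto intro!: continuous_intros continuous_at_imp_continuous_on)
  then obtain w where w: "w \<in> Q" "\<And>z. z \<in> Q \<Longrightarrow> V w + \<epsilon> * h w \<le> V z + \<epsilon> * h z"
    using continuous_attains_inf[of Q] compact_annulus \<open>y \<in> Q\<close> unfolding Q_def by blast
  have Vw: "V w + \<epsilon> * h w < min 1 \<kappa> * m" using w(2)[OF \<open>y \<in> Q\<close>] Vy by linarith
  have glob: "V w + \<epsilon> * h w \<le> V z + \<epsilon> * h z" if "z \<noteq> 0" "norm z < \<delta>" for z
  proof (cases "z \<in> Q")
    case False
    then have "norm z < \<eta>" using that by (auto simp: Q_def)
    then show ?thesis using big[of z] that Vw by simp
  qed (use w in blast)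
  have wd: "norm w < \<delta> / 2"
  proof (rule ccontr)
    assume "\<not> norm w < \<delta> / 2"
    then have "m \<le> V w" "norm w \<le> \<delta>" using w(1) low[of w] by (auto simp: Q_def)
    moreover have "0 \<le> \<epsilon> * h w" using nonneg(2)[OF nz[OF w(1)]] \<open>norm w \<le> \<delta>\<close> \<epsilon> by simp
    moreover have "min 1 \<kappa> * m \<le> 1 * m" using m by (intro mult_right_mono) auto
    ultimately show False using Vw by linarith
  qed
  have "\<kappa> * m \<le> V w + \<epsilon> * h w"
    by (rule step[OF \<epsilon> nz[OF w(1)] wd glob])
  moreover have "min 1 \<kappa> * m \<le> \<kappa> * m" using m by (intro mult_right_mono) auto
  ultimately show False using Vw by linarith
qed

lemma powr_diff_le:
  fixes a b M p :: real
  assumes "0 < b" "b \<le> a" "a \<le> M" "1 < p"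
  shows "a powr p - b powr p \<le> p * M powr (p - 1) * (a - b)"
proof (cases "a = b")
  case False
  then have "b < a" using assms by simp
  have "((\<lambda>x. x powr p) has_real_derivative p * x powr (p - 1)) (at x)" if "b \<le> x" for x
    using that assms by (intro has_real_derivative_powr) auto
  with \<open>b < a\<close> obtain z where z: "b < z" "z < a" "a powr p - b powr p = (a - b) * (p * z powr (p - 1))"
    using MVT2[of b a "\<lambda>x. x powr p" "\<lambda>x. p * x powr (p - 1)"] by blast
  have "z powr (p - 1) \<le> M powr (p - 1)" using z assms by (intro powr_mono2) auto
  then have "(a - b) * (p * z powr (p - 1)) \<le> (a - b) * (p * M powr (p - 1))"
    using assms by (intro mult_left_mono) auto
  then show ?thesis using z by (simp add: mult_ac)
qed simp

section \<open>Kelvin differences of a positive solution\<close>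

locale frac_solution =
  fixes u :: "'a::euclidean_space \<Rightarrow> real" and g :: "'a \<Rightarrow> 'a" and \<alpha> p C :: real
  assumes \<alpha>: "0 < \<alpha>" "\<alpha> < 2" "\<alpha> < real DIM('a)"
    and C: "0 < C" and p: "1 < p" "p * (real DIM('a) - \<alpha>) \<le> real DIM('a) + \<alpha>"
    and tail: "tail_integrable \<alpha> u"
    and grad: "\<And>x. GDERIV u x :> g x" and cont_grad: "\<And>x. isCont g x"
    and pos: "\<And>x. 0 < u x"
    and eq: "\<And>x. pv \<alpha> u x (u x powr p / C)"
begin

definition W :: "real \<Rightarrow> 'a \<Rightarrow> real" where "W r z = kelvin \<alpha> r u z - u z"

lemma a_pos: "0 < real DIM('a) - \<alpha>" using \<alpha> by simp

lemma differentiable_u: "u differentiable (at x)"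
  using grad[of x] by (auto simp: gderiv_def differentiable_def)

lemma isCont_u [simp]: "isCont u x"
  using differentiable_u by (rule differentiable_imp_continuous_within)

lemma continuous_u: "continuous_on S u"
  by (simp add: continuous_at_imp_continuous_on)

lemma continuous_u_compose [continuous_intros]: "continuous_on S f \<Longrightarrow> continuous_on S (\<lambda>x. u (f x))"
  by (rule continuous_on_compose2[OF continuous_u[of UNIV]]) auto

lemma isCont_u_compose: "isCont f x \<Longrightarrow> isCont (\<lambda>x. u (f x)) x"
  by (rule isCont_o2[OF _ isCont_u])

lemma kelvin_pos: "0 < r \<Longrightarrow> z \<noteq> 0 \<Longrightarrow> 0 < kelvin \<alpha> r u z"
  using pos by (simp add: kelvin_def)

lemma differentiable_kelvin_u: "0 < r \<Longrightarrow> z \<noteq> 0 \<Longrightarrow> kelvin \<alpha> r u differentiable (at z)"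
  by (rule differentiable_kelvin) (auto simp: differentiable_u)

lemma differentiable_W: "0 < r \<Longrightarrow> z \<noteq> 0 \<Longrightarrow> W r differentiable (at z)"
  unfolding W_def[abs_def] by (intro differentiable_diff differentiable_kelvin_u differentiable_u)

lemma isCont_W: "0 < r \<Longrightarrow> z \<noteq> 0 \<Longrightarrow> isCont (W r) z"
  by (rule differentiable_imp_continuous_within[OF differentiable_W])

lemma tail_W: "0 < r \<Longrightarrow> tail_integrable \<alpha> (W r)"
  unfolding W_def[abs_def] using \<alpha> tail by (intro tail_integrable_diff tail_integrable_kelvin)

lemma antisymmetric_W: "0 < r \<Longrightarrow> antisymmetric_about \<alpha> r (W r)"
  unfolding W_def[abs_def] by (rule antisymmetric_kelvin_diff)

lemma pv_kelvin_u:
  assumes "0 < r" "y \<noteq> 0"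
  shows "pv \<alpha> (kelvin \<alpha> r u) y ((r / norm y) powr (real DIM('a) + \<alpha>) * (u (inversion r y) powr p / C))"
  using \<alpha> assms tail differentiable_u eq by (intro pv_kelvin)

lemma pv_W:
  assumes "0 < r" "y \<noteq> 0"
  obtains l where "pv \<alpha> (W r) y l"
    "l = ((r / norm y) powr (real DIM('a) + \<alpha> - p * (real DIM('a) - \<alpha>)) * kelvin \<alpha> r u y powr p - u y powr p) / C"
proof -
  have "pv \<alpha> (W r) y ((r / norm y) powr (real DIM('a) + \<alpha>) * (u (inversion r y) powr p / C) - u y powr p / C)"
    unfolding W_def[abs_def]
    by (intro pv_diff pv_kelvin_u eq tail_integrable_kelvin tail assms \<alpha>)
  moreover have "kelvin \<alpha> r u y powr p = (r / norm y) powr (p * (real DIM('a) - \<alpha>)) * u (inversion r y) powr p"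
    using assms pos[of "inversion r y"] by (simp add: kelvin_def powr_mult powr_powr mult.commute)
  then have "(r / norm y) powr (real DIM('a) + \<alpha> - p * (real DIM('a) - \<alpha>)) * kelvin \<alpha> r u y powr p
     = ((r / norm y) powr (real DIM('a) + \<alpha> - p * (real DIM('a) - \<alpha>)) * (r / norm y) powr (p * (real DIM('a) - \<alpha>))) * u (inversion r y) powr p"
    by simp
  then have "(r / norm y) powr (real DIM('a) + \<alpha> - p * (real DIM('a) - \<alpha>)) * kelvin \<alpha> r u y powr p
     = (r / norm y) powr (real DIM('a) + \<alpha>) * u (inversion r y) powr p"
    by (simp add: powr_add[symmetric])
  ultimately show ?thesis by (intro that) (auto simp: diff_divide_distrib)
qed

text \<open>This is where the upper bound on \<open>p\<close> acts: it makes the exponent of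
  \<open>r / norm y\<close> nonnegative, so inside the sphere the weight is at least 1.\<close>

lemma pv_W_lower:
  assumes "0 < r" "y \<noteq> 0" "norm y \<le> r"
  obtains l where "pv \<alpha> (W r) y l" "(kelvin \<alpha> r u y powr p - u y powr p) / C \<le> l"
proof -
  obtain l where l: "pv \<alpha> (W r) y l"
    "l = ((r / norm y) powr (real DIM('a) + \<alpha> - p * (real DIM('a) - \<alpha>)) * kelvin \<alpha> r u y powr p - u y powr p) / C"
    using pv_W assms by blast
  have "1 \<le> (r / norm y) powr (real DIM('a) + \<alpha> - p * (real DIM('a) - \<alpha>))"
    using assms p by (intro ge_one_powr_ge_zero) auto
  from mult_right_mono[OF this, of "kelvin \<alpha> r u y powr p"]
  have "(kelvin \<alpha> r u y powr p - u y powr p) / C \<le> l"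
    unfolding l(2) using C by (intro divide_right_mono) auto
  with l(1) show ?thesis by (rule that)
qed

lemma pv_W_nonneg:
  assumes "0 < r" "y \<noteq> 0" "norm y \<le> r" "0 \<le> W r y"
  obtains l where "pv \<alpha> (W r) y l" "0 \<le> l"
proof -
  obtain l where l: "pv \<alpha> (W r) y l" "(kelvin \<alpha> r u y powr p - u y powr p) / C \<le> l"
    using pv_W_lower[OF assms(1-3)] by blast
  have "u y powr p \<le> kelvin \<alpha> r u y powr p"
    using assms pos[of y] p by (intro powr_mono2) (auto simp: W_def less_imp_le)
  then have "0 \<le> (kelvin \<alpha> r u y powr p - u y powr p) / C" using C by simp
  with l(2) have "0 \<le> l" by linarith
  with l(1) show ?thesis by (rule that)
qed

text \<open>In terms of \<open>u\<close> this is a decay bound, \<open>u x\<close> at least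
  \<open>c * norm x powr - (n - \<alpha>)\<close> for \<open>norm x \<ge> 1\<close>. The transform
  has positive principal values near the puncture, and the perturbation \<open>h\<close> with
  principal value 0 is the fundamental solution.\<close>

lemma kelvin_lower:
  obtains c where "0 < c" "\<And>y. y \<noteq> 0 \<Longrightarrow> norm y \<le> 1 \<Longrightarrow> c \<le> kelvin \<alpha> 1 u y"
proof -
  obtain \<kappa> where \<kappa>: "0 < \<kappa>" "\<And>(V :: 'a \<Rightarrow> real) y m l. \<lbrakk>tail_integrable \<alpha> V; pv \<alpha> V y l; 0 \<le> l;
      y \<noteq> 0; norm y < 1 / 2; \<And>z. z \<noteq> 0 \<Longrightarrow> norm z < 1 \<Longrightarrow> V y \<le> V z; \<And>z. z \<noteq> 0 \<Longrightarrow> 0 \<le> V z;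
      \<And>z. 2 * 1 \<le> norm z \<Longrightarrow> norm z \<le> 3 * 1 \<Longrightarrow> m \<le> V z; 0 \<le> m\<rbrakk> \<Longrightarrow> \<kappa> * m \<le> V y"
    using puncture_bound[OF \<alpha>(1), of 1] by (metis zero_less_one)
  define Q where "Q = {z::'a. 1 / 2 \<le> norm z \<and> norm z \<le> 3}"
  have Q0: "z \<noteq> 0" if "z \<in> Q" for z using that by (auto simp: Q_def)
  have cont: "isCont (kelvin \<alpha> 1 u) z" if "z \<noteq> 0" for z
    using that by (intro differentiable_imp_continuous_within[OF differentiable_kelvin_u]) auto
  have "(0::real) < 1 / 2" "(1::real) / 2 \<le> 3" by auto
  then obtain w where "1 / 2 \<le> norm w" "norm w \<le> 3"
    "\<And>z. 1 / 2 \<le> norm z \<Longrightarrow> norm z \<le> 3 \<Longrightarrow> kelvin \<alpha> 1 u w \<le> kelvin \<alpha> 1 u z"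
    using annulus_attains_min[OF _ _ cont] by blast
  then have w: "w \<in> Q" "\<And>z. z \<in> Q \<Longrightarrow> kelvin \<alpha> 1 u w \<le> kelvin \<alpha> 1 u z" by (auto simp: Q_def)
  define m where "m = kelvin \<alpha> 1 u w"
  have m: "0 < m" using kelvin_pos Q0 w by (simp add: m_def)
  define h where "h = kelvin \<alpha> 1 (\<lambda>_::'a. 1)"
  have "min 1 \<kappa> * m \<le> kelvin \<alpha> 1 u y" if "y \<noteq> 0" "norm y \<le> 1" for y
  proof (rule puncture_principle[of 1 m \<kappa> _ h, OF _ m \<kappa>(1) cont])
    show "isCont h z" if "z \<noteq> 0" for z
      unfolding h_def using that by (intro differentiable_imp_continuous_within[OF differentiable_kelvin]) auto
    show "\<exists>\<eta>>0. \<forall>z. z \<noteq> 0 \<longrightarrow> norm z < \<eta> \<longrightarrow> K \<le> h z" for K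
      using powr_blowup[of 1 "real DIM('a) - \<alpha>" K] a_pos unfolding h_def kelvin_one by (metis zero_less_norm_iff zero_less_one)
    show "0 \<le> h z" for z by (simp add: h_def kelvin_one)
    show "m \<le> kelvin \<alpha> 1 u z" if "1 / 2 \<le> norm z" "norm z \<le> 1" for z
      unfolding m_def using that by (intro w(2)) (auto simp: Q_def)
    show "0 \<le> kelvin \<alpha> 1 u z" if "z \<noteq> 0" for z using kelvin_pos[of 1 z] that by simp
    fix \<epsilon> :: real and y :: 'a
    assume \<epsilon>: "0 < \<epsilon>" and y: "y \<noteq> 0" "norm y < 1 / 2"
      and min: "\<And>z. z \<noteq> 0 \<Longrightarrow> norm z < 1 \<Longrightarrow> kelvin \<alpha> 1 u y + \<epsilon> * h y \<le> kelvin \<alpha> 1 u z + \<epsilon> * h z"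
    have hn: "0 \<le> \<epsilon> * h z" for z using \<epsilon> by (simp add: h_def kelvin_one)
    show "\<kappa> * m \<le> kelvin \<alpha> 1 u y + \<epsilon> * h y"
    proof (rule \<kappa>(2)[where V = "\<lambda>z. kelvin \<alpha> 1 u z + \<epsilon> * h z"])
      show "tail_integrable \<alpha> (\<lambda>z. kelvin \<alpha> 1 u z + \<epsilon> * h z)"
        unfolding h_def using \<alpha> tail by (intro tail_integrable_add tail_integrable_cmult tail_integrable_kelvin tail_integrable_const) auto
      show "pv \<alpha> (\<lambda>z. kelvin \<alpha> 1 u z + \<epsilon> * h z) y
         ((1 / norm y) powr (real DIM('a) + \<alpha>) * (u (inversion 1 y) powr p / C) + \<epsilon> * 0)"
        unfolding h_def using \<alpha> tail y
        by (intro pv_add pv_cmult pv_kelvin_u pv_kelvin_one tail_integrable_cmult tail_integrable_kelvin tail_integrable_const) auto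
      show "0 \<le> (1 / norm y) powr (real DIM('a) + \<alpha>) * (u (inversion 1 y) powr p / C) + \<epsilon> * 0"
        using C by simp
      show "m \<le> kelvin \<alpha> 1 u z + \<epsilon> * h z" if "2 * 1 \<le> norm z" "norm z \<le> 3 * 1" for z
        unfolding m_def using that hn[of z] w(2)[of z] by (simp add: Q_def)
      show "0 \<le> kelvin \<alpha> 1 u z + \<epsilon> * h z" if "z \<noteq> 0" for z
        using kelvin_pos[of 1 z] that hn[of z] by simp
    qed (use y min m in auto)
  qed (use that in auto)
  then show ?thesis using m \<kappa>(1) by (intro that[of "min 1 \<kappa> * m"]) auto
qed

text \<open>Positivity in the punctured ball does not yet prevent \<open>W r\<close> from tending to
  0 at the centre, where its values depend on \<open>u\<close> near infinity. The uniform gap is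
  what will survive a small change of radius.\<close>

lemma W_puncture:
  assumes r: "0 < r" and W: "\<And>z. z \<noteq> 0 \<Longrightarrow> norm z < r \<Longrightarrow> 0 < W r z"
  obtains c \<delta> where "0 < c" "0 < \<delta>" "\<And>y. y \<noteq> 0 \<Longrightarrow> norm y \<le> \<delta> \<Longrightarrow> c \<le> W r y"
proof -
  define \<delta> where "\<delta> = r / 16"
  have \<delta>: "0 < \<delta>" "16 * \<delta> \<le> r" using r by (auto simp: \<delta>_def)
  obtain \<kappa> where \<kappa>: "0 < \<kappa>"
    "\<And>(V :: 'a::euclidean_space \<Rightarrow> real) y m l. \<lbrakk>tail_integrable \<alpha> V; V differentiable (at y);
      antisymmetric_about \<alpha> r V; pv \<alpha> V y l; 0 \<le> l;
      y \<noteq> 0; norm y < \<delta> / 2; \<And>z. z \<noteq> 0 \<Longrightarrow> norm z < \<delta> \<Longrightarrow> V y \<le> V z;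
      \<And>z. z \<noteq> 0 \<Longrightarrow> norm z < r \<Longrightarrow> 0 \<le> V z;
      \<And>z. 2 * \<delta> \<le> norm z \<Longrightarrow> norm z \<le> 3 * \<delta> \<Longrightarrow> m \<le> V z; 0 \<le> m\<rbrakk> \<Longrightarrow> \<kappa> * m \<le> V y"
    using antisymmetric_puncture_bound[OF \<alpha>(1) \<delta>] by metis
  define Q where "Q = {z::'a. \<delta> / 2 \<le> norm z \<and> norm z \<le> 3 * \<delta>}"
  have Q0: "z \<noteq> 0" "norm z < r" if "z \<in> Q" for z using that \<delta> by (auto simp: Q_def)
  have "0 < \<delta> / 2" "\<delta> / 2 \<le> 3 * \<delta>" using \<delta> by auto
  then obtain w where "\<delta> / 2 \<le> norm w" "norm w \<le> 3 * \<delta>"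
    "\<And>z. \<delta> / 2 \<le> norm z \<Longrightarrow> norm z \<le> 3 * \<delta> \<Longrightarrow> W r w \<le> W r z"
    using annulus_attains_min[OF _ _ isCont_W[OF r]] by blast
  then have w: "w \<in> Q" "\<And>z. z \<in> Q \<Longrightarrow> W r w \<le> W r z" by (auto simp: Q_def)
  define m where "m = W r w"
  have m: "0 < m" using W Q0 w by (simp add: m_def)
  \<comment> \<open>Subtracting 1 makes the singular function antisymmetric, so that
    \<open>W r + \<epsilon> * h\<close> can still be folded; it keeps the blow-up, the vanishing
    principal value and the sign inside the sphere.\<close>
  define h where "h = (\<lambda>z::'a. kelvin \<alpha> r (\<lambda>_. 1) z - 1)"
  have hn: "0 \<le> h z" if "z \<noteq> 0" "norm z < r" for z
    using that a_pos by (simp add: h_def kelvin_one ge_one_powr_ge_zero)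
  have dh: "h differentiable (at z)" if "z \<noteq> 0" for z
    unfolding h_def using that r by (intro differentiable_diff differentiable_kelvin) auto
  have "min 1 \<kappa> * m \<le> W r y" if "y \<noteq> 0" "norm y \<le> \<delta>" for y
  proof (rule puncture_principle[of \<delta> m \<kappa> _ h, OF \<delta>(1) m \<kappa>(1) isCont_W[OF r]])
    show "isCont h z" if "z \<noteq> 0" for z
      by (rule differentiable_imp_continuous_within[OF dh[OF that]])
    show "\<exists>\<eta>>0. \<forall>z. z \<noteq> 0 \<longrightarrow> norm z < \<eta> \<longrightarrow> K \<le> h z" for K
    proof -
      obtain \<eta> where "0 < \<eta>" "\<And>t. 0 < t \<Longrightarrow> t < \<eta> \<Longrightarrow> K + 1 \<le> (r / t) powr (real DIM('a) - \<alpha>)"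
        using powr_blowup[OF r a_pos, of "K + 1"] by blast
      then show ?thesis unfolding h_def kelvin_one
        by (intro exI[of _ \<eta>]) (auto simp: le_diff_eq)
    qed
    show "0 \<le> h z" if "z \<noteq> 0" "norm z \<le> \<delta>" for z using that \<delta> by (intro hn) auto
    show "m \<le> W r z" if "\<delta> / 2 \<le> norm z" "norm z \<le> \<delta>" for z
      unfolding m_def using that \<delta> by (intro w(2)) (auto simp: Q_def)
    show "0 \<le> W r z" if "z \<noteq> 0" "norm z \<le> \<delta>" for z using W[of z] that \<delta> by (intro less_imp_le) auto
    fix \<epsilon> :: real and y :: 'a
    assume \<epsilon>: "0 < \<epsilon>" and y: "y \<noteq> 0" "norm y < \<delta> / 2"
      and min: "\<And>z. z \<noteq> 0 \<Longrightarrow> norm z < \<delta> \<Longrightarrow> W r y + \<epsilon> * h y \<le> W r z + \<epsilon> * h z"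
    have yr: "norm y < r" using y \<delta> by linarith
    obtain l where l: "pv \<alpha> (W r) y l" "0 \<le> l"
      using pv_W_nonneg[OF r y(1)] W[OF y(1) yr] yr by (metis less_imp_le)
    show "\<kappa> * m \<le> W r y + \<epsilon> * h y"
    proof (rule \<kappa>(2)[where V = "\<lambda>z. W r z + \<epsilon> * h z"])
      show "tail_integrable \<alpha> (\<lambda>z. W r z + \<epsilon> * h z)"
        unfolding h_def using \<alpha> tail_W[OF r] r
        by (intro tail_integrable_add tail_integrable_diff tail_integrable_cmult tail_integrable_kelvin tail_integrable_const)
      show "(\<lambda>z. W r z + \<epsilon> * h z) differentiable (at y)"
        by (intro differentiable_add differentiable_mult differentiable_const differentiable_W r y dh)
      show "antisymmetric_about \<alpha> r (\<lambda>z. W r z + \<epsilon> * h z)"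
        unfolding h_def by (intro antisymmetric_add_cmult antisymmetric_W antisymmetric_kelvin_diff r)
      show "pv \<alpha> (\<lambda>z. W r z + \<epsilon> * h z) y (l + \<epsilon> * (0 - 0))"
        unfolding h_def using \<alpha> y r l tail_W[OF r]
        by (intro pv_add pv_cmult pv_diff pv_const pv_kelvin_one tail_integrable_diff tail_integrable_cmult tail_integrable_kelvin tail_integrable_const)
      show "0 \<le> l + \<epsilon> * (0 - 0)" using l by simp
      show "m \<le> W r z + \<epsilon> * h z" if "2 * \<delta> \<le> norm z" "norm z \<le> 3 * \<delta>" for z
      proof -
        have "z \<in> Q" using that \<delta> by (simp add: Q_def)
        then have "m \<le> W r z" "0 \<le> \<epsilon> * h z" using w(2)[of z] hn[of z] Q0[of z] \<epsilon> by (auto simp: m_def)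
        then show ?thesis by simp
      qed
      show "0 \<le> W r z + \<epsilon> * h z" if "z \<noteq> 0" "norm z < r" for z
        using W[OF that] hn[OF that] \<epsilon> by simp
    qed (use y min m in auto)
  qed (use that in auto)
  then show ?thesis using m \<kappa>(1) \<delta> by (intro that[of "min 1 \<kappa> * m" \<delta>]) auto
qed

section \<open>Small radii, and the behaviour of \<open>W\<close> at the centre and near the
  sphere\<close>

lemma radial_monotone:
  assumes "0 < \<rho>" and \<rho>: "\<And>x. norm x < \<rho> \<Longrightarrow> norm (g x) * norm x \<le> (real DIM('a) - \<alpha>) / 2 * u x"
    and \<theta>: "norm \<theta> = 1" and t: "0 < t" "t \<le> t'" "t' < \<rho>"
  shows "t powr ((real DIM('a) - \<alpha>) / 2) * u (t *\<^sub>R \<theta>) \<le> t' powr ((real DIM('a) - \<alpha>) / 2) * u (t' *\<^sub>R \<theta>)"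
proof (rule DERIV_nonneg_imp_nondecreasing[OF t(2)])
  let ?A = "(real DIM('a) - \<alpha>) / 2"
  fix s assume s: "t \<le> s" "s \<le> t'"
  then have s0: "0 < s" using t by linarith
  have "((\<lambda>s. u (s *\<^sub>R \<theta>)) has_derivative (\<lambda>h. (h *\<^sub>R \<theta>) \<bullet> g (s *\<^sub>R \<theta>))) (at s)"
    using grad[of "s *\<^sub>R \<theta>"] unfolding gderiv_def
    by (rule has_derivative_compose[rotated]) (auto intro!: derivative_eq_intros)
  then have "((\<lambda>s. u (s *\<^sub>R \<theta>)) has_real_derivative (\<theta> \<bullet> g (s *\<^sub>R \<theta>))) (at s)"
    unfolding has_field_derivative_def by (rule has_derivative_eq_rhs) (simp add: fun_eq_iff)
  then have D: "((\<lambda>s. s powr ?A * u (s *\<^sub>R \<theta>)) has_real_derivative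
      (?A * s powr (?A - 1) * u (s *\<^sub>R \<theta>) + (\<theta> \<bullet> g (s *\<^sub>R \<theta>)) * s powr ?A)) (at s)"
    using s0 by (intro DERIV_mult has_real_derivative_powr)
  have E: "?A * s powr (?A - 1) * u (s *\<^sub>R \<theta>) + (\<theta> \<bullet> g (s *\<^sub>R \<theta>)) * s powr ?A
     = s powr (?A - 1) * (?A * u (s *\<^sub>R \<theta>) + s * (\<theta> \<bullet> g (s *\<^sub>R \<theta>)))"
  proof -
    have "s powr ?A = s powr (?A - 1) * s" using s0 by (simp add: powr_diff)
    then show ?thesis by (simp add: algebra_simps)
  qed
  have "0 \<le> s powr (?A - 1) * (?A * u (s *\<^sub>R \<theta>) + s * (\<theta> \<bullet> g (s *\<^sub>R \<theta>)))"
  proof -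
    have "\<bar>\<theta> \<bullet> g (s *\<^sub>R \<theta>)\<bar> \<le> norm (g (s *\<^sub>R \<theta>))"
      using Cauchy_Schwarz_ineq2[of \<theta> "g (s *\<^sub>R \<theta>)"] \<theta> by simp
    then have "s * \<bar>\<theta> \<bullet> g (s *\<^sub>R \<theta>)\<bar> \<le> s * norm (g (s *\<^sub>R \<theta>))" using s0 by (intro mult_left_mono) auto
    also have "\<dots> \<le> ?A * u (s *\<^sub>R \<theta>)"
      using \<rho>[of "s *\<^sub>R \<theta>"] s0 s t \<theta> by (simp add: mult.commute)
    finally have "\<bar>s * (\<theta> \<bullet> g (s *\<^sub>R \<theta>))\<bar> \<le> ?A * u (s *\<^sub>R \<theta>)" using s0 by (simp add: abs_mult)
    then show ?thesis by (intro mult_nonneg_nonneg) auto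
  qed
  then show "\<exists>y. ((\<lambda>s. s powr ?A * u (s *\<^sub>R \<theta>)) has_real_derivative y) (at s) \<and> 0 \<le> y"
    using D[unfolded E] by blast
qed

text \<open>Write \<open>A = n - \<alpha>\<close> and let \<open>x\<close> be the mirror image of
  \<open>y\<close>. For \<open>x\<close> near the origin, \<open>0 \<le> W r y\<close> says that
  \<open>t powr (A / 2) * u (t *\<^sub>R \<theta>)\<close> does not decrease from
  \<open>norm y\<close> to \<open>norm x\<close>, which is \<open>radial_monotone\<close>. For
  \<open>x\<close> farther away, the decay bound makes \<open>kelvin \<alpha> r u y\<close> at least
  a constant times \<open>r powr - A\<close>, which reaches the maximum of \<open>u\<close> near the
  origin once \<open>r\<close> is small.\<close>

lemma start:
  obtains r0 where "0 < r0" "\<And>r y. 0 < r \<Longrightarrow> r \<le> r0 \<Longrightarrow> y \<noteq> 0 \<Longrightarrow> norm y < r \<Longrightarrow> 0 \<le> W r y"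
proof -
  let ?A = "real DIM('a) - \<alpha>"
  obtain c where c: "0 < c" "\<And>y. y \<noteq> 0 \<Longrightarrow> norm y \<le> 1 \<Longrightarrow> c \<le> kelvin \<alpha> 1 u y"
    using kelvin_lower by blast
  have far: "c \<le> norm x powr ?A * u x" if "1 \<le> norm x" for x
  proof -
    have x: "x \<noteq> 0" using that by auto
    have "c \<le> kelvin \<alpha> 1 u (inversion 1 x)"
      using x that by (intro c(2)) (auto simp: norm_inversion)
    then show ?thesis using x by (simp add: kelvin_def norm_inversion)
  qed
  have "isCont (\<lambda>x. ?A / 2 * u x - norm (g x) * norm x) 0"
    by (intro continuous_intros isCont_u cont_grad)
  \<comment> \<open>At the origin the gradient term carries the factor \<open>norm 0\<close>, so
    positivity of \<open>u\<close> alone decides; continuity extends the inequality to a small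
    ball.\<close>
  moreover have "0 < ?A / 2 * u 0 - norm (g 0) * norm (0::'a)" using a_pos pos by simp
  ultimately obtain \<rho>0 where \<rho>0: "0 < \<rho>0" "\<And>x. dist x 0 < \<rho>0 \<Longrightarrow> 0 < ?A / 2 * u x - norm (g x) * norm x"
    using isCont_pos_ball[of 0 "\<lambda>x. ?A / 2 * u x - norm (g x) * norm x"] by blast
  define \<rho> where "\<rho> = min 1 \<rho>0"
  have \<rho>: "0 < \<rho>" "\<rho> \<le> 1" "\<And>x. norm x < \<rho> \<Longrightarrow> norm (g x) * norm x \<le> ?A / 2 * u x"
    using \<rho>0 by (auto simp: \<rho>_def less_imp_le)
  have "isCont (\<lambda>x. norm x powr ?A * u x) z" if "z \<noteq> 0" for z
    using that by (intro continuous_intros isCont_u) auto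
  then obtain w where w: "\<rho> \<le> norm w" "norm w \<le> 1"
    "\<And>z. \<rho> \<le> norm z \<Longrightarrow> norm z \<le> 1 \<Longrightarrow> norm w powr ?A * u w \<le> norm z powr ?A * u z"
    using annulus_attains_min[OF \<rho>(1,2), of "\<lambda>x. norm x powr ?A * u x"] by blast
  define c2 where "c2 = min c (norm w powr ?A * u w)"
  have "w \<noteq> 0" using w(1) \<rho>(1) by auto
  then have c2: "0 < c2" using c(1) pos[of w] by (simp add: c2_def)
  have low: "c2 \<le> norm x powr ?A * u x" if "\<rho> \<le> norm x" for x
    using that far[of x] w(3)[of x] unfolding c2_def by linarith
  obtain M where M: "\<And>x. norm x \<le> 1 \<Longrightarrow> u x \<le> M"
    using continuous_attains_sup[of "cball 0 1" u] continuous_u by force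
  obtain \<eta> where \<eta>: "0 < \<eta>" "\<And>t. 0 < t \<Longrightarrow> t < \<eta> \<Longrightarrow> M / c2 \<le> (1 / t) powr ?A"
    using powr_blowup[of 1 ?A "M / c2"] a_pos by auto
  \<comment> \<open>\<open>\<rho> / 2\<close> keeps \<open>y\<close> in the unit ball, where
    \<open>u\<close> is at most \<open>M\<close>; \<open>\<eta> / 2\<close> makes
    \<open>c2 * (1 / r) powr (n - \<alpha>)\<close> at least \<open>M\<close>.\<close>
  define r0 where "r0 = min (\<rho> / 2) (\<eta> / 2)"
  have "0 < r0" using \<rho> \<eta> by (simp add: r0_def)
  moreover have "0 \<le> W r y" if r: "0 < r" "r \<le> r0" and y: "y \<noteq> 0" "norm y < r" for r y
  proof -
    define x where "x = inversion r y"
    have nx: "norm x = r\<^sup>2 / norm y" by (simp add: x_def norm_inversion)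
    have k: "kelvin \<alpha> r u y = (r / norm y) powr ?A * u x" by (simp add: kelvin_def x_def)
    have "norm y * norm y < r * r" using y r by (intro mult_strict_mono) auto
    then have yx: "norm y < norm x" using y by (simp add: nx pos_less_divide_eq power2_eq_square)
    show ?thesis
    proof (cases "norm x < \<rho>")
      case True
      define \<theta> where "\<theta> = (1 / norm y) *\<^sub>R y"
      have \<theta>: "norm \<theta> = 1" "norm y *\<^sub>R \<theta> = y" "norm x *\<^sub>R \<theta> = x"
        using y by (auto simp: \<theta>_def nx x_def inversion_def power_divide power2_eq_square)
      have "norm y powr (?A / 2) * u (norm y *\<^sub>R \<theta>) \<le> norm x powr (?A / 2) * u (norm x *\<^sub>R \<theta>)"
        by (rule radial_monotone[OF \<rho>(1,3) \<theta>(1)]) (use y yx True in auto)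
      then have "norm y powr (?A / 2) * u y \<le> norm x powr (?A / 2) * u x" by (simp add: \<theta>)
      moreover have "norm x powr (?A / 2) = norm y powr (?A / 2) * (r / norm y) powr ?A"
      proof -
        have "norm x = norm y * (r / norm y) powr 2" using y r by (simp add: nx power2_eq_square)
        then have "norm x powr (?A / 2) = norm y powr (?A / 2) * ((r / norm y) powr 2) powr (?A / 2)"
          by (simp only: powr_mult)
        moreover have "2 * (?A / 2) = ?A" by simp
        ultimately show ?thesis by (simp only: powr_powr)
      qed
      ultimately have "norm y powr (?A / 2) * u y \<le> norm y powr (?A / 2) * kelvin \<alpha> r u y"
        by (simp add: k mult.assoc)
      then show ?thesis using y by (simp add: W_def)
    next
      case False
      have e: "r / norm y = norm x * (1 / r)" using r y by (simp add: nx power2_eq_square)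
      have "M / c2 \<le> (1 / r) powr ?A" using r \<rho> \<eta>(1) by (intro \<eta>(2)) (auto simp: r0_def)
      then have "M \<le> c2 * (1 / r) powr ?A" using c2 by (simp add: field_simps)
      also have "\<dots> \<le> (norm x powr ?A * u x) * (1 / r) powr ?A"
        using False by (intro mult_right_mono low) auto
      also have "\<dots> = kelvin \<alpha> r u y" unfolding k e by (simp only: powr_mult mult_ac)
      finally have "M \<le> kelvin \<alpha> r u y" .
      moreover have "u y \<le> M" using y r \<rho> by (intro M) (auto simp: r0_def)
      ultimately show ?thesis by (simp add: W_def)
    qed
  qed
  ultimately show ?thesis by (rule that)
qed

text \<open>Near the centre \<open>W \<mu>\<close> involves the values of \<open>u\<close> near infinity, over which there is no
  uniform control; \<open>W \<mu>\<close> and \<open>W \<Lambda>\<close> are therefore compared at points with the same image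
  under the respective inversions.\<close>

lemma W_near_zero:
  assumes \<Lambda>: "0 < \<Lambda>" and W: "\<And>z. z \<noteq> 0 \<Longrightarrow> norm z < \<Lambda> \<Longrightarrow> 0 < W \<Lambda> z"
  obtains \<delta> \<eta> where "0 < \<delta>" "0 < \<eta>"
    "\<And>\<mu> y. \<Lambda> \<le> \<mu> \<Longrightarrow> \<mu> < \<Lambda> + \<eta> \<Longrightarrow> y \<noteq> 0 \<Longrightarrow> norm y < \<delta> \<Longrightarrow> 0 \<le> W \<mu> y"
proof -
  let ?A = "real DIM('a) - \<alpha>"
  obtain c \<delta> where c: "0 < c" "0 < \<delta>" "\<And>y. y \<noteq> 0 \<Longrightarrow> norm y \<le> \<delta> \<Longrightarrow> c \<le> W \<Lambda> y"
    using W_puncture[OF \<Lambda> W] by blast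
  \<comment> \<open>With \<open>q = \<Lambda> / \<mu>\<close>, the comparison at points with a
    common image gives \<open>W \<mu> y \<ge> \<Phi> (q, y)\<close>. Since
    \<open>\<Phi> (1, 0) = c\<close>, the gap \<open>c\<close> at the puncture leaves room for
    \<open>q\<close> slightly below 1 and \<open>y\<close> near 0.\<close>
  define \<Phi> where "\<Phi> = (\<lambda>x::real \<times> 'a. fst x powr ?A * (u ((fst x)\<^sup>2 *\<^sub>R snd x) + c) - u (snd x))"
  have "isCont \<Phi> (1, 0)"
    unfolding \<Phi>_def by (intro continuous_intros isCont_u_compose) auto
  moreover have "0 < \<Phi> (1, 0)" using c by (simp add: \<Phi>_def)
  ultimately obtain d where d: "0 < d" "\<And>x. dist x (1, 0) < d \<Longrightarrow> 0 < \<Phi> x"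
    using isCont_pos_ball by blast
  have "0 \<le> W \<mu> y" if \<mu>: "\<Lambda> \<le> \<mu>" "\<mu> < \<Lambda> + \<Lambda> * d / 2" and y: "y \<noteq> 0" "norm y < min \<delta> (d / 2)" for \<mu> y
  proof -
    define q where "q = \<Lambda> / \<mu>"
    have m0: "0 < \<mu>" using \<Lambda> \<mu> by linarith
    have q: "0 < q" "q \<le> 1" using \<Lambda> \<mu> m0 by (auto simp: q_def)
    have "1 - q = (\<mu> - \<Lambda>) / \<mu>" using m0 by (simp add: q_def field_simps)
    also have "\<dots> \<le> (\<mu> - \<Lambda>) / \<Lambda>" using \<Lambda> \<mu> by (intro divide_left_mono) auto
    also have "\<dots> < d / 2" using \<Lambda> \<mu> by (simp add: pos_divide_less_eq mult.commute)
    finally have q1: "1 - q < d / 2" .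
    have "dist (q, y) (1, 0) \<le> \<bar>q - 1\<bar> + \<bar>norm y\<bar>"
      unfolding dist_Pair_Pair using sqrt_sum_squares_le_sum_abs[of "dist q 1" "dist y 0"] by (simp add: dist_real_def)
    then have "dist (q, y) (1, 0) < d" using q1 q y by simp
    then have \<Phi>: "0 < \<Phi> (q, y)" by (rule d(2))
    \<comment> \<open>Inversion in the sphere of radius \<open>\<Lambda>\<close> sends
      \<open>y1\<close> to the point to which inversion of radius \<open>\<mu>\<close> sends
      \<open>y\<close>.\<close>
    define y1 where "y1 = q\<^sup>2 *\<^sub>R y"
    have n1: "norm y1 = q\<^sup>2 * norm y" by (simp add: y1_def)
    have "q\<^sup>2 * norm y \<le> 1 * norm y" using q by (intro mult_right_mono power_le_one) auto
    moreover have "norm y < \<delta>" using y by simp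
    ultimately have "norm y1 \<le> \<delta>" using n1 by linarith
    then have "c \<le> W \<Lambda> y1" using y q by (intro c(3)) (auto simp: y1_def)
    then have "u y1 + c \<le> (\<Lambda> / norm y1) powr ?A * u (inversion \<Lambda> y1)" by (simp add: W_def kelvin_def)
    moreover have "inversion \<Lambda> y1 = inversion \<mu> y"
      unfolding inversion_def n1 unfolding y1_def using q m0 y \<Lambda>
      by (simp add: q_def power_divide power_mult_distrib field_simps eval_nat_numeral)
    ultimately have "q powr ?A * (u y1 + c) \<le> q powr ?A * ((\<Lambda> / norm y1) powr ?A * u (inversion \<mu> y))"
      using q by (intro mult_left_mono) auto
    also have "\<dots> = (q * (\<Lambda> / norm y1)) powr ?A * u (inversion \<mu> y)" by (simp only: powr_mult mult.assoc)
    also have "q * (\<Lambda> / norm y1) = \<mu> / norm y"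
      unfolding n1 using q m0 y \<Lambda> by (simp add: q_def field_simps power2_eq_square)
    finally have "q powr ?A * (u y1 + c) \<le> kelvin \<alpha> \<mu> u y" by (simp add: kelvin_def)
    then show ?thesis using \<Phi> by (simp add: \<Phi>_def W_def y1_def)
  qed
  then show ?thesis using c d \<Lambda> by (intro that[of "min \<delta> (d / 2)" "\<Lambda> * d / 2"]) auto
qed

text \<open>At a negative minimum the principal value is at least \<open>B * W \<mu> y\<close> by
  the equation and at most the exterior mass times \<open>W \<mu> y\<close> by folding. Dividing by
  the negative number bounds the mass by \<open>B\<close>, whereas near the sphere the mass is
  unbounded. Since \<open>M\<close> bounds \<open>u\<close> on the whole ball of radius
  \<open>R\<close>, \<open>d\<close> serves all \<open>\<mu> \<le> R\<close>.\<close>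

lemma negative_min_distance:
  assumes "0 < R"
  obtains d where "0 < d" "\<And>\<mu> y. \<lbrakk>0 < \<mu>; \<mu> \<le> R; y \<noteq> 0; norm y < \<mu>; W \<mu> y < 0;
     \<And>z. z \<noteq> 0 \<Longrightarrow> norm z < \<mu> \<Longrightarrow> W \<mu> y \<le> W \<mu> z\<rbrakk> \<Longrightarrow> d \<le> \<mu> - norm y"
proof -
  obtain M where M: "\<And>x. norm x \<le> R \<Longrightarrow> u x \<le> M"
    using continuous_attains_sup[of "cball 0 R" u] continuous_u assms by force
  define c0 where "c0 = unit_ball_vol (real DIM('a)) * 3 powr - (real DIM('a) + \<alpha>)"
  have c0: "0 < c0" by (simp add: c0_def)
  \<comment> \<open>Lipschitz constant of \<open>t powr p\<close> up to \<open>M\<close>, divided by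
    \<open>C\<close>; a negative \<open>W \<mu> y\<close> puts the transform between 0 and
    \<open>u y\<close>, hence below \<open>M\<close>.\<close>
  define B where "B = p * M powr (p - 1) / C"
  obtain d where d: "0 < d" "\<And>t. 0 < t \<Longrightarrow> t < d \<Longrightarrow> B / c0 + 1 \<le> (1 / t) powr \<alpha>"
    using powr_blowup[of 1 \<alpha> "B / c0 + 1"] \<alpha> by auto
  have "d \<le> \<mu> - norm y" if \<mu>: "0 < \<mu>" "\<mu> \<le> R" and y: "y \<noteq> 0" "norm y < \<mu>" and neg: "W \<mu> y < 0"
     and min: "\<And>z. z \<noteq> 0 \<Longrightarrow> norm z < \<mu> \<Longrightarrow> W \<mu> y \<le> W \<mu> z" for \<mu> y
  proof (rule ccontr)
    assume "\<not> ?thesis"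
    then have t: "0 < \<mu> - norm y" "\<mu> - norm y < d" using y by auto
    define I where "I = (LINT z:- ball 0 \<mu>|lborel. kern \<alpha> (y - z))"
    obtain l where l: "pv \<alpha> (W \<mu>) y l" "(kelvin \<alpha> \<mu> u y powr p - u y powr p) / C \<le> l"
      using pv_W_lower[OF \<mu>(1) y(1)] y by (metis less_imp_le)
    have "l \<le> W \<mu> y * I" unfolding I_def
      by (rule pv_antisymmetric_negative_min[OF \<alpha>(1) y tail_W differentiable_W antisymmetric_W l(1)])
         (use \<mu> y neg min in auto)
    moreover have "u y powr p - kelvin \<alpha> \<mu> u y powr p \<le> p * M powr (p - 1) * (u y - kelvin \<alpha> \<mu> u y)"
      using neg y \<mu> p kelvin_pos by (intro powr_diff_le M) (auto simp: W_def)
    then have "(u y powr p - kelvin \<alpha> \<mu> u y powr p) / C \<le> B * (- W \<mu> y)"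
      using C by (simp add: B_def W_def divide_right_mono)
    then have "B * W \<mu> y \<le> (kelvin \<alpha> \<mu> u y powr p - u y powr p) / C"
      by (simp add: diff_divide_distrib)
    ultimately have "B * W \<mu> y \<le> I * W \<mu> y" using l(2) by (simp add: mult.commute)
    then have "I \<le> B" using neg by simp
    moreover have "c0 * (\<mu> - norm y) powr - \<alpha> \<le> I"
      unfolding c0_def I_def by (rule kern_integral_lower[OF \<alpha>(1) y])
    moreover have e: "(\<mu> - norm y) powr - \<alpha> = (1 / (\<mu> - norm y)) powr \<alpha>"
      using t powr_divide_minus[of "\<mu> - norm y" 1 \<alpha>] by simp
    moreover have "c0 * (B / c0 + 1) \<le> c0 * (1 / (\<mu> - norm y)) powr \<alpha>"
      using c0 d(2)[OF t] by (intro mult_left_mono) auto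
    moreover have "c0 * (B / c0 + 1) = B + c0" using c0 by (simp add: field_simps)
    ultimately show False using c0 unfolding e by linarith
  qed
  with d(1) show ?thesis by (rule that)
qed

lemma continuous_W_joint:
  assumes "\<And>x. x \<in> S \<Longrightarrow> 0 < fst x \<and> snd x \<noteq> 0"
  shows "continuous_on S (\<lambda>x. W (fst x) (snd x))"
  unfolding W_def kelvin_def inversion_def
  using assms by (intro continuous_intros) fastforce+

section \<open>Continuation in the radius\<close>

definition dominated :: "real \<Rightarrow> bool" where
  "dominated r \<longleftrightarrow> 0 < r \<and> (\<forall>\<mu> y. 0 < \<mu> \<longrightarrow> \<mu> \<le> r \<longrightarrow> y \<noteq> 0 \<longrightarrow> norm y < \<mu> \<longrightarrow> 0 \<le> W \<mu> y)"

text \<open>For \<open>\<mu>\<close> slightly above \<open>\<Lambda>\<close> a negative value could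
  arise in three zones: near the centre, excluded by \<open>W_near_zero\<close>; near the sphere,
  where \<open>negative_min_distance\<close> forbids the minimum; and on the compact annulus
  between, where \<open>W \<Lambda>\<close> has a positive minimum and joint uniform continuity
  applies.\<close>

lemma dominated_extend:
  assumes dom: "dominated \<Lambda>" and W: "\<And>z. z \<noteq> 0 \<Longrightarrow> norm z < \<Lambda> \<Longrightarrow> 0 < W \<Lambda> z"
  obtains r where "\<Lambda> < r" "dominated r"
proof -
  have \<Lambda>: "0 < \<Lambda>" using dom by (simp add: dominated_def)
  obtain \<delta> \<eta> where z: "0 < \<delta>" "0 < \<eta>"
    "\<And>\<mu> y. \<Lambda> \<le> \<mu> \<Longrightarrow> \<mu> < \<Lambda> + \<eta> \<Longrightarrow> y \<noteq> 0 \<Longrightarrow> norm y < \<delta> \<Longrightarrow> 0 \<le> W \<mu> y"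
    using W_near_zero[OF \<Lambda> W] by blast
  obtain d where d: "0 < d" "\<And>\<mu> y. \<lbrakk>0 < \<mu>; \<mu> \<le> \<Lambda> + 1; y \<noteq> 0; norm y < \<mu>; W \<mu> y < 0;
     \<And>z. z \<noteq> 0 \<Longrightarrow> norm z < \<mu> \<Longrightarrow> W \<mu> y \<le> W \<mu> z\<rbrakk> \<Longrightarrow> d \<le> \<mu> - norm y"
    using negative_min_distance[of "\<Lambda> + 1"] \<Lambda> by (metis add_pos_pos zero_less_one)
  define \<sigma> where "\<sigma> = min \<delta> (\<Lambda> / 2)"
  have \<sigma>: "0 < \<sigma>" "\<sigma> \<le> \<delta>" using z \<Lambda> by (auto simp: \<sigma>_def)
  \<comment> \<open>Outer radius of the middle zone: a point at distance at least \<open>d\<close>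
    from a sphere of radius at most \<open>\<Lambda> + d / 2\<close> has norm at most
    \<open>\<Lambda> - d / 2\<close>.\<close>
  define b where "b = max \<sigma> (\<Lambda> - d / 2)"
  have b: "\<sigma> \<le> b" "b < \<Lambda>" "\<Lambda> - d / 2 \<le> b" using d \<Lambda> by (auto simp: b_def \<sigma>_def)
  obtain w where w: "\<sigma> \<le> norm w" "norm w \<le> b" "\<And>z. \<sigma> \<le> norm z \<Longrightarrow> norm z \<le> b \<Longrightarrow> W \<Lambda> w \<le> W \<Lambda> z"
    using annulus_attains_min[OF \<sigma>(1) b(1) isCont_W[OF \<Lambda>]] by blast
  have m: "0 < W \<Lambda> w" using w \<sigma> b by (intro W) auto
  define S where "S = {\<Lambda>..\<Lambda> + 1} \<times> {z::'a. \<sigma> \<le> norm z \<and> norm z \<le> b}"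
  have "compact S" unfolding S_def by (intro compact_Times compact_annulus) simp
  moreover have "continuous_on S (\<lambda>x. W (fst x) (snd x))"
    using \<Lambda> \<sigma> by (intro continuous_W_joint) (auto simp: S_def)
  ultimately have "uniformly_continuous_on S (\<lambda>x. W (fst x) (snd x))"
    by (rule compact_uniformly_continuous[rotated])
  then obtain e where e: "0 < e" "\<And>x x'. x \<in> S \<Longrightarrow> x' \<in> S \<Longrightarrow> dist x' x < e \<Longrightarrow> dist (W (fst x') (snd x')) (W (fst x) (snd x)) < W \<Lambda> w"
    unfolding uniformly_continuous_on_def using m by metis
  define r where "r = \<Lambda> + min (min (1 / 2) (d / 2)) (min (\<eta> / 2) (e / 2))"
  have r: "\<Lambda> < r" "r \<le> \<Lambda> + 1" "r \<le> \<Lambda> + d / 2" "r < \<Lambda> + \<eta>" "r < \<Lambda> + e"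
    using d z e by (auto simp: r_def min_def)
  have "0 \<le> W \<mu> y" if \<mu>: "0 < \<mu>" "\<mu> \<le> r" and y: "y \<noteq> 0" "norm y < \<mu>" for \<mu> y
  proof (cases "\<mu> \<le> \<Lambda>")
    case True
    then show ?thesis using dom \<mu> y by (auto simp: dominated_def)
  next
    case False
    show ?thesis
    proof (rule ccontr)
      assume "\<not> ?thesis"
      then have neg: "W \<mu> y < 0" by simp
      have y\<sigma>: "\<sigma> \<le> norm y" using z(3)[of \<mu> y] neg False \<mu> r y \<sigma> by force
      have "\<sigma> \<le> \<mu>" using y\<sigma> y by linarith
      \<comment> \<open>As \<open>W \<mu>\<close> is nonnegative below radius
        \<open>\<sigma>\<close> and vanishes on the sphere, a negative minimum over the closed
        annulus lies inside the sphere and is a minimum over the punctured ball.\<close>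
      then obtain v where v: "\<sigma> \<le> norm v" "norm v \<le> \<mu>" "\<And>z. \<sigma> \<le> norm z \<Longrightarrow> norm z \<le> \<mu> \<Longrightarrow> W \<mu> v \<le> W \<mu> z"
        using annulus_attains_min[OF \<sigma>(1) _ isCont_W[OF \<mu>(1)]] by blast
      have vneg: "W \<mu> v < 0" using v(3)[of y] y\<sigma> y neg by linarith
      have v0: "v \<noteq> 0" using v \<sigma> by auto
      have "norm v \<noteq> \<mu>" using antisymmetric_sphere[OF antisymmetric_W[OF \<mu>(1)], of v] \<mu> vneg by auto
      then have vm: "norm v < \<mu>" using v by simp
      have "d \<le> \<mu> - norm v"
      proof (rule d(2)[OF \<mu>(1) _ v0 vm vneg])
        show "W \<mu> v \<le> W \<mu> x" if x: "x \<noteq> 0" "norm x < \<mu>" for x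
        proof (cases "norm x < \<sigma>")
          case True
          then have "0 \<le> W \<mu> x" using False \<mu> r x \<sigma> by (intro z(3)) auto
          then show ?thesis using vneg by simp
        qed (use v x in auto)
      qed (use \<mu> r in auto)
      then have "norm v \<le> b" using b \<mu> r by linarith
      then have "(\<mu>, v) \<in> S" "(\<Lambda>, v) \<in> S" using v False \<mu> r by (auto simp: S_def)
      moreover have "dist (\<mu>, v) (\<Lambda>, v) < e" using False \<mu> r by (simp add: dist_Pair_Pair dist_real_def)
      ultimately have "dist (W \<mu> v) (W \<Lambda> v) < W \<Lambda> w" using e(2)[of "(\<Lambda>, v)" "(\<mu>, v)"] by simp
      moreover have "W \<Lambda> w \<le> W \<Lambda> v" using v \<open>norm v \<le> b\<close> by (intro w(3)) auto
      ultimately show False using vneg by (simp add: dist_real_def)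
    qed
  qed
  then have "dominated r" using r \<Lambda> by (simp add: dominated_def)
  with r(1) show ?thesis by (rule that)
qed

text \<open>The strong principle yields the alternative inside the sphere; a nonzero value found
  outside is first carried inside by antisymmetry.\<close>

lemma W_dichotomy:
  assumes \<Lambda>: "0 < \<Lambda>" and W: "\<And>z. z \<noteq> 0 \<Longrightarrow> norm z < \<Lambda> \<Longrightarrow> 0 \<le> W \<Lambda> z"
  shows "(\<forall>z. z \<noteq> 0 \<longrightarrow> norm z < \<Lambda> \<longrightarrow> 0 < W \<Lambda> z) \<or> (\<forall>z. z \<noteq> 0 \<longrightarrow> W \<Lambda> z = 0)"
proof (rule disjCI)
  assume "\<not> (\<forall>z. z \<noteq> 0 \<longrightarrow> W \<Lambda> z = 0)"
  then obtain z0 where z0: "z0 \<noteq> 0" "W \<Lambda> z0 \<noteq> 0" by blast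
  have anti: "kelvin \<alpha> \<Lambda> (W \<Lambda>) z = - W \<Lambda> z" if "z \<noteq> 0" for z
    using antisymmetric_W[OF \<Lambda>] that by (auto simp: antisymmetric_about_def)
  have "\<exists>z1. z1 \<noteq> 0 \<and> norm z1 < \<Lambda> \<and> W \<Lambda> z1 \<noteq> 0"
  proof (cases "norm z0 < \<Lambda>")
    case False
    have "norm z0 \<noteq> \<Lambda>" using antisymmetric_sphere[OF antisymmetric_W[OF \<Lambda>], of z0] z0 \<Lambda> by auto
    then have "norm (inversion \<Lambda> z0) < \<Lambda>"
      using False \<Lambda> z0 by (simp add: norm_inversion divide_less_eq power2_eq_square)
    moreover have "W \<Lambda> (inversion \<Lambda> z0) \<noteq> 0" using anti[OF z0(1)] z0 by (auto simp: kelvin_def)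
    ultimately show ?thesis using z0 \<Lambda> by (intro exI[of _ "inversion \<Lambda> z0"]) simp
  qed (use z0 in blast)
  then obtain z1 where z1: "z1 \<noteq> 0" "norm z1 < \<Lambda>" "W \<Lambda> z1 \<noteq> 0" by blast
  show "\<forall>z. z \<noteq> 0 \<longrightarrow> norm z < \<Lambda> \<longrightarrow> 0 < W \<Lambda> z"
  proof (intro allI impI, rule ccontr)
    fix y assume y: "y \<noteq> 0" "norm y < \<Lambda>" "\<not> 0 < W \<Lambda> y"
    then have Wy: "W \<Lambda> y = 0" using W[of y] by simp
    obtain l where l: "pv \<alpha> (W \<Lambda>) y l" "0 \<le> l"
      using pv_W_nonneg[OF \<Lambda> y(1)] y Wy by (metis less_imp_le order_refl)
    have "W \<Lambda> z1 = 0"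
      by (rule pv_antisymmetric_strong[OF \<alpha>(1) y(1,2) tail_W differentiable_W antisymmetric_W l Wy W isCont_W])
         (use \<Lambda> y z1 in auto)
    with z1 show False by simp
  qed
qed

text \<open>\<open>dominated\<close> is closed downwards, so if some radius fails, the dominated
  radii are bounded by it and have a supremum \<open>\<Lambda>\<close>. Continuity from the left
  gives \<open>0 \<le> W \<Lambda>\<close> in the ball, the dichotomy makes it strict, and
  \<open>dominated_extend\<close> passes beyond the supremum.\<close>

theorem moving_spheres:
  "(\<forall>r>0. \<forall>y. y \<noteq> 0 \<longrightarrow> norm y < r \<longrightarrow> u y \<le> kelvin \<alpha> r u y) \<or> (\<exists>r>0. \<forall>y. y \<noteq> 0 \<longrightarrow> kelvin \<alpha> r u y = u y)"
proof (rule disjCI)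
  assume "\<not> (\<exists>r>0. \<forall>y. y \<noteq> 0 \<longrightarrow> kelvin \<alpha> r u y = u y)"
  then have no: "\<not> (\<forall>y. y \<noteq> 0 \<longrightarrow> W r y = 0)" if "0 < r" for r
    using that by (auto simp: W_def)
  have all: "dominated r" if "0 < r" for r
  proof (rule ccontr)
    assume nd: "\<not> dominated r"
    have mono: "dominated s" if "dominated t" "0 < s" "s \<le> t" for s t
      using that by (auto simp: dominated_def)
    obtain r0 where r0: "dominated r0" using start unfolding dominated_def by metis
    have bdd: "bdd_above {t. dominated t}"
      using nd mono that by (intro bdd_aboveI[of _ r]) (metis linear mem_Collect_eq)
    define \<Lambda> where "\<Lambda> = Sup {t. dominated t}"
    have up: "t \<le> \<Lambda>" if "dominated t" for t unfolding \<Lambda>_def using that bdd by (intro cSup_upper) auto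
    have \<Lambda>: "0 < \<Lambda>" using up[OF r0] r0 by (auto simp: dominated_def)
    have below: "dominated t" if t: "0 < t" "t < \<Lambda>" for t
    proof -
      obtain s where "dominated s" "t < s"
        using t(2) less_cSup_iff[of "{t. dominated t}" t] bdd r0 unfolding \<Lambda>_def by blast
      then show ?thesis using mono[of s t] t by simp
    qed
    have W0: "0 \<le> W \<Lambda> y" if y: "y \<noteq> 0" "norm y < \<Lambda>" for y
    proof (rule tendsto_lowerbound)
      have "isCont (\<lambda>\<mu>. W \<mu> y) \<Lambda>"
        unfolding W_def kelvin_def inversion_def using y \<Lambda>
        by (intro continuous_intros isCont_u_compose) auto
      then show "((\<lambda>\<mu>. W \<mu> y) \<longlongrightarrow> W \<Lambda> y) (at_left \<Lambda>)"
        unfolding isCont_def by (rule filterlim_mono[OF _ order_refl at_le]) simp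
      show "\<forall>\<^sub>F \<mu> in at_left \<Lambda>. 0 \<le> W \<mu> y"
      proof (rule eventually_at_leftI[OF _ y(2)])
        fix \<mu> assume "\<mu> \<in> {norm y<..<\<Lambda>}"
        then have "0 < \<mu>" "\<mu> < \<Lambda>" "norm y < \<mu>" using norm_ge_zero[of y] by (auto simp del: norm_ge_zero)
        then show "0 \<le> W \<mu> y" using below[of \<mu>] y by (auto simp: dominated_def)
      qed
    qed simp
    have "dominated \<Lambda>"
      unfolding dominated_def
    proof (intro conjI allI impI)
      fix \<mu> y assume "0 < \<mu>" "\<mu> \<le> \<Lambda>" "y \<noteq> (0::'a)" "norm y < \<mu>"
      then show "0 \<le> W \<mu> y"
        using below[of \<mu>] W0[of y] by (cases "\<mu> = \<Lambda>") (auto simp: dominated_def)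
    qed (rule \<Lambda>)
    moreover have "\<forall>z. z \<noteq> 0 \<longrightarrow> norm z < \<Lambda> \<longrightarrow> 0 < W \<Lambda> z"
      using W_dichotomy[OF \<Lambda> W0] no[OF \<Lambda>] by blast
    ultimately obtain r' where "\<Lambda> < r'" "dominated r'" using dominated_extend by blast
    then show False using up by fastforce
  qed
  show "\<forall>r>0. \<forall>y. y \<noteq> 0 \<longrightarrow> norm y < r \<longrightarrow> u y \<le> kelvin \<alpha> r u y"
    using all by (fastforce simp: dominated_def W_def)
qed

text \<open>If \<open>W r\<close> vanishes off the origin, so does its principal value; comparing
  the equations for \<open>u\<close> and for its transform forces the weight to be 1 at a point off
  the sphere, which a positive exponent excludes.\<close>

lemma kelvin_invariant_critical:
  assumes r: "0 < r" and inv: "\<And>y. y \<noteq> 0 \<Longrightarrow> kelvin \<alpha> r u y = u y"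
  shows "p * (real DIM('a) - \<alpha>) = real DIM('a) + \<alpha>"
proof (rule ccontr)
  assume "\<not> ?thesis"
  then have \<tau>: "0 < real DIM('a) + \<alpha> - p * (real DIM('a) - \<alpha>)" using p by simp
  obtain b :: 'a where b: "b \<in> Basis" using nonempty_Basis by blast
  define y where "y = (r / 2) *\<^sub>R b"
  have y: "y \<noteq> 0" "norm y = r / 2" using r b by (auto simp: y_def)
  obtain l where l: "pv \<alpha> (W r) y l"
    "l = ((r / norm y) powr (real DIM('a) + \<alpha> - p * (real DIM('a) - \<alpha>)) * kelvin \<alpha> r u y powr p - u y powr p) / C"
    using pv_W[OF r y(1)] by blast
  have "W r y = 0" using inv[OF y(1)] by (simp add: W_def)
  have "(LINT z:- ball y \<epsilon>|lborel. (W r y - W r z) * kern \<alpha> (y - z)) = 0" for \<epsilon>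
    unfolding set_lebesgue_integral_def
  proof (rule integral_eq_zero_AE)
    show "AE z in lborel. indicator (- ball y \<epsilon>) z *\<^sub>R ((W r y - W r z) * kern \<alpha> (y - z)) = 0"
      using AE_lborel_singleton[of "0::'a"]
      by eventually_elim (use inv \<open>W r y = 0\<close> in \<open>auto simp: W_def\<close>)
  qed
  then have "pv \<alpha> (W r) y 0" by (simp add: pv_def)
  then have "l = 0" using l(1) pv_unique by blast
  then have "(r / norm y) powr (real DIM('a) + \<alpha> - p * (real DIM('a) - \<alpha>)) * u y powr p = 1 * u y powr p"
    using l(2) C inv[OF y(1)] by simp
  then have "(r / norm y) powr (real DIM('a) + \<alpha> - p * (real DIM('a) - \<alpha>)) = 1"
    using pos[of y] by (simp only: mult_cancel_right) auto
  moreover have "1 < (r / norm y) powr (real DIM('a) + \<alpha> - p * (real DIM('a) - \<alpha>))"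
    using \<tau> r y by (intro gr_one_powr) auto
  ultimately show False by simp
qed

end

section \<open>Varying the centre\<close>

lemma weight_translate:
  fixes x z :: "'a::real_normed_vector"
  assumes "0 < s"
  shows "1 + norm z powr s \<le> (1 + (1 + norm x) powr s) * (1 + norm (z - x) powr s)"
proof -
  have "norm z \<le> (1 + norm x) * max 1 (norm (z - x))"
  proof -
    have "norm x * 1 \<le> norm x * max 1 (norm (z - x))" by (intro mult_left_mono) auto
    moreover have "norm z \<le> norm x + norm (z - x)" by (rule norm_triangle_sub)
    ultimately show ?thesis unfolding distrib_right by linarith
  qed
  then have "norm z powr s \<le> ((1 + norm x) * max 1 (norm (z - x))) powr s"
    using assms by (intro powr_mono2) auto
  also have "\<dots> = (1 + norm x) powr s * max 1 (norm (z - x)) powr s"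
    by (intro powr_mult)
  also have "\<dots> \<le> (1 + norm x) powr s * (1 + norm (z - x) powr s)"
    by (intro mult_left_mono) (auto simp: max_def)
  finally have "norm z powr s \<le> (1 + norm x) powr s * (1 + norm (z - x) powr s)" .
  moreover have "1 \<le> 1 * (1 + norm (z - x) powr s)" by simp
  ultimately show ?thesis by (simp only: distrib_right[of 1] add_mono)
qed

lemma integral_translate:
  fixes f :: "'a::euclidean_space \<Rightarrow> real"
  assumes [measurable]: "f \<in> borel_measurable borel"
  shows "(\<integral>z. f (x + z) \<partial>lborel) = (\<integral>z. f z \<partial>lborel)"
    and "integrable lborel (\<lambda>z. f (x + z)) \<longleftrightarrow> integrable lborel f"
proof -
  have d: "distr lborel borel ((+) x) = (lborel :: 'a measure)" by (rule lborel_distr_plus)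
  show "(\<integral>z. f (x + z) \<partial>lborel) = (\<integral>z. f z \<partial>lborel)"
    using integral_distr[of "(+) x" lborel borel f] by (simp add: d)
  show "integrable lborel (\<lambda>z. f (x + z)) \<longleftrightarrow> integrable lborel f"
    using integrable_distr_eq[of "(+) x" lborel borel f] by (simp add: d)
qed

lemma tail_integrable_translate:
  fixes u :: "'a::euclidean_space \<Rightarrow> real"
  assumes \<alpha>: "0 < \<alpha>" and u: "tail_integrable \<alpha> u"
  shows "tail_integrable \<alpha> (\<lambda>y. u (x + y))"
proof -
  let ?s = "real DIM('a) + \<alpha>"
  have [measurable]: "u \<in> borel_measurable borel" using u by measurable
  define q where "q = (\<lambda>z. (1 + norm z powr ?s) / (1 + norm (z - x) powr ?s))"
  have "\<bar>q z\<bar> \<le> 1 + (1 + norm x) powr ?s" for z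
    unfolding q_def using weight_translate[of ?s z x] \<alpha>
    by (simp add: abs_of_nonneg divide_le_eq)
  moreover have "q \<in> borel_measurable lborel" unfolding q_def by measurable
  ultimately have "integrable lborel (\<lambda>z. q z * (u z / (1 + norm z powr ?s)))"
    using u by (intro integrable_mult_bounded) (auto simp: tail_integrable_def)
  moreover have "(\<lambda>z. q z * (u z / (1 + norm z powr ?s))) = (\<lambda>z. u z / (1 + norm (z - x) powr ?s))"
    by (auto simp: q_def fun_eq_iff)
  ultimately have "integrable lborel (\<lambda>z. u z / (1 + norm (z - x) powr ?s))" by simp
  then have "integrable lborel (\<lambda>z. u (x + z) / (1 + norm ((x + z) - x) powr ?s))"
    by (subst integral_translate(2)) auto
  then show ?thesis by (simp add: tail_integrable_def)
qed

lemma pv_translate: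
  fixes u :: "'a::euclidean_space \<Rightarrow> real"
  assumes [measurable]: "u \<in> borel_measurable borel" and l: "pv \<alpha> u (x + y) l"
  shows "pv \<alpha> (\<lambda>y. u (x + y)) y l"
proof -
  have "(LINT z:- ball y \<epsilon>|lborel. (u (x + y) - u (x + z)) * kern \<alpha> (y - z))
     = (LINT z:- ball (x + y) \<epsilon>|lborel. (u (x + y) - u z) * kern \<alpha> (x + y - z))" for \<epsilon>
  proof -
    have "indicator (- ball (x + y) \<epsilon>) (x + z) = (indicator (- ball y \<epsilon>) z :: real)" for z
      by (simp add: indicator_def dist_norm)
    then show ?thesis
      unfolding set_lebesgue_integral_def
      by (subst integral_translate(1)[symmetric, of _ x]) auto
  qed
  then show ?thesis using l by (simp add: pv_def)
qed

text \<open>At a zero, which is a global minimum, the truncated integrals are nonpositive and grow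
  with the truncation radius. Their limit 0 as the radius shrinks forces them to vanish, and with a
  positive kernel so does \<open>u\<close>.\<close>

lemma pv_zero_min:
  fixes u :: "'a::euclidean_space \<Rightarrow> real"
  assumes \<alpha>: "0 < \<alpha>" and tail: "tail_integrable \<alpha> u" and cont: "\<And>x. isCont u x" and nonneg: "\<And>x. 0 \<le> u x"
    and zero: "u x = 0" and pv: "pv \<alpha> u x 0"
  shows "u z = 0"
proof (rule ccontr)
  assume "u z \<noteq> 0"
  then have uz: "0 < u z" using nonneg[of z] by simp
  have zx: "z \<noteq> x" using uz zero by auto
  define r where "r = dist x z / 2"
  have r: "0 < r" using zx by (simp add: r_def)
  let ?P = "\<lambda>\<epsilon>. LINT z:- ball x \<epsilon>|lborel. (u x - u z) * kern \<alpha> (x - z)"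
  have "?P \<epsilon> \<le> ?P r" if \<epsilon>: "0 < \<epsilon>" "\<epsilon> < r" for \<epsilon>
    unfolding set_lebesgue_integral_def
  proof (rule Bochner_Integration.integral_mono)
    show "integrable lborel (\<lambda>z. indicator (- ball x \<epsilon>) z *\<^sub>R ((u x - u z) * kern \<alpha> (x - z)))"
      "integrable lborel (\<lambda>z. indicator (- ball x r) z *\<^sub>R ((u x - u z) * kern \<alpha> (x - z)))"
      using set_integrable_pv[OF \<alpha> tail, of "- ball x \<epsilon>" \<epsilon> x] set_integrable_pv[OF \<alpha> tail, of "- ball x r" r x] \<epsilon> r
      by (auto simp: set_integrable_def)
    show "indicator (- ball x \<epsilon>) z *\<^sub>R ((u x - u z) * kern \<alpha> (x - z)) \<le> indicator (- ball x r) z *\<^sub>R ((u x - u z) * kern \<alpha> (x - z))" for z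
      using \<epsilon> zero nonneg[of z] by (auto simp: indicator_def)
  qed
  then have "\<forall>\<^sub>F \<epsilon> in at_right 0. ?P \<epsilon> \<le> ?P r"
    unfolding eventually_at_right_field using r by blast
  with pv[unfolded pv_def] have "0 \<le> ?P r" by (rule tendsto_upperbound) simp
  define h where "h = (\<lambda>z. indicator (- ball x r) z * (u z * kern \<alpha> (x - z)))"
  have hn: "AE z in lborel. 0 \<le> h z" using nonneg by (intro AE_I2) (simp add: h_def)
  have ih: "integrable lborel h"
    using set_integrable_tail_kern[OF \<alpha> tail _ r, of "- ball x r" x] by (simp add: h_def set_integrable_def)
  have "(\<integral>z. h z \<partial>lborel) = - ?P r" using zero by (simp add: h_def set_lebesgue_integral_def)
  then have "(\<integral>z. h z \<partial>lborel) = 0" using \<open>0 \<le> ?P r\<close> integral_nonneg_AE[OF hn] by linarith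
  then have ae: "AE z in lborel. h z = 0" using integral_nonneg_eq_0_iff_AE[OF ih hn] by simp
  obtain d where d: "0 < d" "\<And>w. dist w z < d \<Longrightarrow> 0 < u w"
    using isCont_pos_ball[OF cont uz] by blast
  show False
  proof (rule AE_zero_on_ball_False[OF ae, of "min d r" z])
    fix w assume w: "w \<in> ball z (min d r)"
    have "dist x z \<le> dist x w + dist w z" by (rule dist_triangle)
    then have "w \<notin> ball x r" using w by (auto simp: r_def dist_commute)
    moreover from this have "0 < kern \<alpha> (x - w)" using r by auto
    ultimately show "h w \<noteq> 0" using w d(2)[of w] by (auto simp: h_def dist_commute simp del: kern_pos)
  qed (use d r in simp)
qed

lemma gderiv_zero_constant:
  fixes f :: "'a::euclidean_space \<Rightarrow> real"
  assumes "\<And>x. GDERIV f x :> 0"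
  obtains c where "\<And>x. f x = c"
proof -
  have "(f has_derivative (\<lambda>h. 0)) (at x)" for x
    using assms[of x] by (simp add: gderiv_def)
  then have "\<exists>c. \<forall>x\<in>UNIV. f x = c"
    by (intro has_derivative_zero_constant) auto
  then show ?thesis using that by auto
qed

lemma gderiv_along_line:
  assumes "GDERIV u (x + t *\<^sub>R y) :> D"
  shows "((\<lambda>t. u (x + t *\<^sub>R y)) has_real_derivative (D \<bullet> y)) (at t)"
proof -
  have "((\<lambda>t. u (x + t *\<^sub>R y)) has_derivative (\<lambda>h. (h *\<^sub>R y) \<bullet> D)) (at t)"
    using assms unfolding gderiv_def
    by (rule has_derivative_compose[rotated]) (auto intro!: derivative_eq_intros)
  then show ?thesis
    unfolding has_field_derivative_def by (rule has_derivative_eq_rhs) (simp add: fun_eq_iff inner_commute)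
qed

lemma derivative_unique_right:
  fixes f :: "real \<Rightarrow> real"
  assumes "(f has_real_derivative D) (at 0 within {0..})" "(f has_real_derivative E) (at 0 within {0..})"
  shows "D = E"
  using assms unfolding has_field_derivative_iff at_within_Ici_at_right
  by (rule tendsto_unique[rotated]) simp

section \<open>Asymptotics at infinity\<close>

lemma norm_translate_at_top: "filterlim (\<lambda>w::'a::real_normed_vector. norm (w - x)) at_top at_infinity"
proof (rule filterlim_at_top_mono)
  show "filterlim (\<lambda>w::'a. - norm x + norm w) at_top at_infinity"
    by (intro filterlim_tendsto_add_at_top[OF tendsto_const] filterlim_norm_at_top)
  show "\<forall>\<^sub>F w in at_infinity. - norm x + norm w \<le> norm (w - x)"
    by (intro always_eventually allI) (use norm_triangle_ineq2 in \<open>simp add: diff_le_eq add.commute\<close>)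
qed

lemma divide_norm_translate_tendsto_0: "((\<lambda>w::'a::real_normed_vector. c / norm (w - x)) \<longlongrightarrow> (0::real)) at_infinity"
  by (intro tendsto_divide_0[OF tendsto_const] filterlim_at_top_imp_at_infinity norm_translate_at_top)

lemma norm_ratio_tendsto_1: "((\<lambda>w::'a::real_normed_vector. norm w / norm (w - x)) \<longlongrightarrow> 1) at_infinity"
proof -
  have "((\<lambda>w::'a. norm w / norm (w - x) - 1) \<longlongrightarrow> 0) at_infinity"
  proof (rule Lim_null_comparison)
    have "\<forall>\<^sub>F w::'a in at_infinity. 1 \<le> norm (w - x)"
      using norm_translate_at_top unfolding filterlim_at_top by blast
    then show "\<forall>\<^sub>F w::'a in at_infinity. norm (norm w / norm (w - x) - 1) \<le> norm x / norm (w - x)"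
    proof eventually_elim
      case (elim w)
      then have "w \<noteq> x" by auto
      then have "norm w / norm (w - x) - 1 = (norm w - norm (w - x)) / norm (w - x)"
        by (simp add: diff_divide_distrib)
      moreover have "\<bar>norm w - norm (w - x)\<bar> \<le> norm x"
        using norm_triangle_ineq3[of w "w - x"] by simp
      ultimately show ?case by (simp add: divide_right_mono)
    qed
  qed (rule divide_norm_translate_tendsto_0)
  then show ?thesis using tendsto_add[OF _ tendsto_const, of _ 0 at_infinity 1] by fastforce
qed

text \<open>The function is \<open>norm w powr A\<close> times the Kelvin transform about
  \<open>x\<close>, as \<open>kelvin_at\<close> shows for \<open>A = n - \<alpha>\<close>. When
  \<open>w\<close> goes to infinity its mirror image tends to the centre.\<close>

lemma inversion_expansion_tendsto:
  fixes u :: "'a::euclidean_space \<Rightarrow> real"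
  assumes "isCont u x"
  shows "((\<lambda>w. (norm w / norm (w - x)) powr A * (r powr A * u (x + inversion r (w - x)))) \<longlongrightarrow> r powr A * u x) at_infinity"
proof -
  have "((\<lambda>w. inversion r (w - x)) \<longlongrightarrow> 0) at_infinity"
    by (rule tendsto_norm_zero_cancel) (simp add: norm_inversion divide_norm_translate_tendsto_0)
  then have "((\<lambda>w. x + inversion r (w - x)) \<longlongrightarrow> x) at_infinity"
    using tendsto_add[OF tendsto_const, of _ 0 at_infinity x] by fastforce
  then have "((\<lambda>w. u (x + inversion r (w - x))) \<longlongrightarrow> u x) at_infinity"
    by (rule isCont_tendsto_compose[OF assms])
  moreover have "((\<lambda>w. (norm w / norm (w - x)) powr A) \<longlongrightarrow> 1 powr A) at_infinity"
    by (intro tendsto_powr norm_ratio_tendsto_1 tendsto_const) simp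
  ultimately have "((\<lambda>w. (norm w / norm (w - x)) powr A * (r powr A * u (x + inversion r (w - x)))) \<longlongrightarrow> 1 powr A * (r powr A * u x)) at_infinity"
    by (intro tendsto_mult tendsto_const)
  then show ?thesis by simp
qed

section \<open>Spheres about every centre, by translating the solution\<close>

locale frac_solution_all =
  fixes u :: "'a::euclidean_space \<Rightarrow> real" and g :: "'a \<Rightarrow> 'a" and \<alpha> p C :: real
  assumes sol: "\<And>x. frac_solution (\<lambda>y. u (x + y)) (\<lambda>y. g (x + y)) \<alpha> p C"
begin

lemma sol0: "frac_solution u g \<alpha> p C"
  using sol[of 0] by simp

lemmas \<alpha> = frac_solution.\<alpha>[OF sol0] and p = frac_solution.p[OF sol0] and C = frac_solution.C[OF sol0]
  and tail = frac_solution.tail[OF sol0] and pos = frac_solution.pos[OF sol0]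
  and grad = frac_solution.grad[OF sol0] and eq = frac_solution.eq[OF sol0]
  and isCont_u = frac_solution.isCont_u[OF sol0]

text \<open>The name refers to the radius, not to \<open>u\<close>: spheres about \<open>x\<close>
  can be enlarged without end, the first alternative of \<open>moving_spheres\<close>.\<close>

definition unbounded_at :: "'a \<Rightarrow> bool" where
  "unbounded_at x \<longleftrightarrow> (\<forall>r>0. \<forall>y. y \<noteq> 0 \<longrightarrow> norm y < r \<longrightarrow> u (x + y) \<le> kelvin \<alpha> r (\<lambda>y. u (x + y)) y)"

definition invariant_at :: "'a \<Rightarrow> real \<Rightarrow> bool" where
  "invariant_at x r \<longleftrightarrow> 0 < r \<and> (\<forall>y. y \<noteq> 0 \<longrightarrow> kelvin \<alpha> r (\<lambda>y. u (x + y)) y = u (x + y))"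

lemma centre_dichotomy: "unbounded_at x \<or> (\<exists>r. invariant_at x r)"
  using frac_solution.moving_spheres[OF sol[of x]] unfolding unbounded_at_def invariant_at_def by blast

lemma kelvin_at:
  assumes "w \<noteq> x"
  shows "norm w powr (real DIM('a) - \<alpha>) * kelvin \<alpha> r (\<lambda>y. u (x + y)) (w - x)
    = (norm w / norm (w - x)) powr (real DIM('a) - \<alpha>) * (r powr (real DIM('a) - \<alpha>) * u (x + inversion r (w - x)))"
  by (simp add: kelvin_def powr_divide)

text \<open>A point outside the sphere is the mirror image of one inside, and transforming the
  inequality there exchanges its two sides. This form gives information at infinity.\<close>

lemma unbounded_outside:
  assumes "unbounded_at x" "0 < r" "r < norm z"
  shows "kelvin \<alpha> r (\<lambda>y. u (x + y)) z \<le> u (x + z)"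
proof -
  let ?A = "real DIM('a) - \<alpha>"
  have z: "z \<noteq> 0" using assms by auto
  define y where "y = inversion r z"
  have y: "y \<noteq> 0" "norm y < r" "inversion r y = z"
    using assms z by (auto simp: y_def norm_inversion divide_less_eq power2_eq_square)
  have "u (x + y) \<le> (r / norm y) powr ?A * u (x + z)"
    using assms(1,2) y unfolding unbounded_at_def kelvin_def by metis
  then have "(r / norm z) powr ?A * u (x + y) \<le> (r / norm z) powr ?A * ((r / norm y) powr ?A * u (x + z))"
    by (intro mult_left_mono) auto
  also have "\<dots> = ((r / norm z) * (r / norm y)) powr ?A * u (x + z)" by (simp only: powr_mult mult.assoc)
  also have "(r / norm z) * (r / norm y) = 1" using z assms by (simp add: y_def norm_inversion power2_eq_square)
  finally show ?thesis by (simp add: kelvin_def y_def)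
qed

text \<open>For the centre \<open>z - y\<close>, comparing the points \<open>x + y\<close> and
  \<open>x + t *\<^sub>R y\<close> gives a minimum of \<open>\<phi>\<close> over
  \<open>t \<ge> 1\<close> at 1, and its derivative there yields \<open>key\<close>. As
  \<open>key\<close> is affine in \<open>y\<close> and holds for every nonzero \<open>y\<close>, the
  gradient must vanish.\<close>

lemma not_all_unbounded: "\<not> (\<forall>x. unbounded_at x)"
proof
  assume all: "\<forall>x. unbounded_at x"
  let ?A = "(real DIM('a) - \<alpha>) / 2"
  have key: "0 \<le> ?A * u z + g z \<bullet> y" if y: "y \<noteq> 0" for z y
  proof (rule ccontr)
    assume neg: "\<not> ?thesis"
    define x where "x = z - y"
    define \<phi> where "\<phi> = (\<lambda>t. t powr ?A * u (x + t *\<^sub>R y))"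
    have "((\<lambda>t. u (x + t *\<^sub>R y)) has_real_derivative g z \<bullet> y) (at 1)"
      by (rule gderiv_along_line) (simp add: x_def grad)
    moreover have "((\<lambda>t. t powr ?A) has_real_derivative ?A * 1 powr (?A - 1)) (at 1)"
      by (rule has_real_derivative_powr) simp
    ultimately have "(\<phi> has_real_derivative (?A * 1 powr (?A - 1) * u (x + 1 *\<^sub>R y) + (g z \<bullet> y) * 1 powr ?A)) (at 1)"
      unfolding \<phi>_def by (rule DERIV_mult[rotated])
    then have "(\<phi> has_real_derivative (?A * u z + g z \<bullet> y)) (at 1)" by (simp add: x_def)
    moreover have "?A * u z + g z \<bullet> y < 0" using neg by simp
    ultimately obtain d where d: "0 < d" "\<And>h. 0 < h \<Longrightarrow> h < d \<Longrightarrow> \<phi> (1 + h) < \<phi> 1"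
      using DERIV_neg_dec_right by blast
    define t where "t = 1 + d / 2"
    have t: "1 < t" using d by (simp add: t_def)
    have "\<phi> t < \<phi> 1" unfolding t_def using d by (intro d(2)) auto
    moreover have "\<phi> 1 \<le> \<phi> t"
    proof -
      \<comment> \<open>The radius for which \<open>y\<close> and \<open>t *\<^sub>R y\<close> are
        mirror images.\<close>
      define r where "r = sqrt t * norm y"
      have r: "0 < r" "norm y < r" using t y by (auto simp: r_def)
      have ry: "r / norm y = sqrt t" using y by (simp add: r_def)
      have "u (x + y) \<le> kelvin \<alpha> r (\<lambda>y. u (x + y)) y"
        using all r y unfolding unbounded_at_def by blast
      also have "\<dots> = sqrt t powr (real DIM('a) - \<alpha>) * u (x + t *\<^sub>R y)"
        using t by (simp add: kelvin_def inversion_def ry)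
      also have "sqrt t powr (real DIM('a) - \<alpha>) = t powr ?A"
        using t by (simp add: powr_half_sqrt[symmetric] powr_powr)
      finally show ?thesis by (simp add: \<phi>_def)
    qed
    ultimately show False by simp
  qed
  have "g z = 0" for z
  proof (rule ccontr)
    assume gz: "g z \<noteq> 0"
    \<comment> \<open>Chosen so that \<open>y = - k *\<^sub>R g z\<close> turns the affine
      expression into -1.\<close>
    define k where "k = (?A * u z + 1) / (g z \<bullet> g z)"
    have "0 < ?A * u z" using \<alpha> pos[of z] by simp
    then have "k \<noteq> 0" using gz by (simp add: k_def)
    then have "0 \<le> ?A * u z + g z \<bullet> ((- k) *\<^sub>R g z)" using gz by (intro key) auto
    moreover have "g z \<bullet> ((- k) *\<^sub>R g z) = - (?A * u z + 1)" using gz by (simp add: k_def)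
    ultimately show False by linarith
  qed
  then obtain c where c: "\<And>x. u x = c" using gderiv_zero_constant[of u] grad by metis
  then have "u = (\<lambda>_. c)" by auto
  then have "pv \<alpha> u 0 0" using pv_const by simp
  then have "u 0 powr p / C = 0" using eq[of 0] pv_unique by blast
  then show False using pos[of 0] C by simp
qed

text \<open>The function on the left does not mention the centre, so
  \<open>r powr (n - \<alpha>) * u x\<close> is the same number for all pairs with
  \<open>invariant_at x r\<close>.\<close>

lemma invariant_limit:
  assumes "invariant_at x r"
  shows "((\<lambda>w. norm w powr (real DIM('a) - \<alpha>) * u w) \<longlongrightarrow> r powr (real DIM('a) - \<alpha>) * u x) at_infinity"
proof (rule Lim_transform_eventually[OF inversion_expansion_tendsto[OF isCont_u]])
  have "\<forall>\<^sub>F w::'a in at_infinity. 1 \<le> norm (w - x)"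
    using norm_translate_at_top unfolding filterlim_at_top by blast
  then show "\<forall>\<^sub>F w in at_infinity. (norm w / norm (w - x)) powr (real DIM('a) - \<alpha>) * (r powr (real DIM('a) - \<alpha>) * u (x + inversion r (w - x)))
      = norm w powr (real DIM('a) - \<alpha>) * u w"
  proof eventually_elim
    case (elim w)
    then have "w \<noteq> x" by auto
    then show ?case using assms kelvin_at[of w x r] by (simp add: invariant_at_def)
  qed
qed

text \<open>An invariant sphere about \<open>x'\<close> gives
  \<open>norm w powr (n - \<alpha>) * u w\<close> the finite limit \<open>a\<close>. If spheres
  about \<open>x\<close> could grow forever, the same limit would be at least
  \<open>r powr (n - \<alpha>) * u x\<close> for every \<open>r\<close>.\<close>

lemma all_invariant: "\<exists>r. invariant_at x r"
proof (rule ccontr)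
  assume "\<not> ?thesis"
  then have ub: "unbounded_at x" using centre_dichotomy by blast
  let ?A = "real DIM('a) - \<alpha>"
  obtain x' r' where inv: "invariant_at x' r'" using not_all_unbounded centre_dichotomy by blast
  define a where "a = r' powr ?A * u x'"
  have le: "r powr ?A * u x \<le> a" if r: "0 < r" for r
  proof (rule tendsto_le[OF _ invariant_limit[OF inv, folded a_def] inversion_expansion_tendsto[OF isCont_u]])
    have "\<forall>\<^sub>F w::'a in at_infinity. r + 1 \<le> norm (w - x)"
      using norm_translate_at_top unfolding filterlim_at_top by blast
    then show "\<forall>\<^sub>F w in at_infinity. (norm w / norm (w - x)) powr ?A * (r powr ?A * u (x + inversion r (w - x))) \<le> norm w powr ?A * u w"
    proof eventually_elim
      case (elim w)
      then have wx: "w \<noteq> x" using r by auto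
      have "kelvin \<alpha> r (\<lambda>y. u (x + y)) (w - x) \<le> u (x + (w - x))"
        using ub r elim by (intro unbounded_outside) auto
      then show ?case unfolding kelvin_at[OF wx, symmetric] by (intro mult_left_mono) auto
    qed
  qed (rule trivial_limit_at_infinity)
  have A: "0 < ?A" using \<alpha> by simp
  \<comment> \<open>Solves \<open>r powr ?A * u x = \<bar>a\<bar> + u x\<close>, which exceeds
    \<open>a\<close>.\<close>
  define r where "r = (\<bar>a\<bar> / u x + 1) powr (1 / ?A)"
  have ux: "0 < u x" by (rule pos)
  have q: "0 < \<bar>a\<bar> / u x + 1" using ux by (intro add_nonneg_pos) auto
  then have r: "0 < r" by (simp add: r_def)
  have "r powr ?A = \<bar>a\<bar> / u x + 1" using A q by (simp add: r_def powr_powr)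
  then have "r powr ?A * u x = \<bar>a\<bar> + u x" using ux by (simp add: field_simps)
  then show False using le[OF r] ux by linarith
qed

text \<open>Substituting \<open>w = e/s\<close> turns the expansion of \<open>|w|\<^bsup>n-\<alpha>\<^esup> u(w)\<close> at infinity into a one-sided
  derivative at \<open>s = 0\<close> of a function in which the centre \<open>x\<close> no longer occurs, its value at
  \<open>0\<close> being independent of the centre by \<open>invariant_limit\<close>.\<close>

lemma invariant_gradient:
  assumes inv: "invariant_at x r" and e: "norm e = 1"
  shows "((\<lambda>s. if s = 0 then r powr (real DIM('a) - \<alpha>) * u x else s powr (- (real DIM('a) - \<alpha>)) * u ((1 / s) *\<^sub>R e))
     has_real_derivative r powr (real DIM('a) - \<alpha>) * ((real DIM('a) - \<alpha>) * (x \<bullet> e) * u x + r\<^sup>2 * (g x \<bullet> e))) (at 0 within {0..})"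
proof -
  let ?A = "real DIM('a) - \<alpha>"
  have r: "0 < r" using inv by (simp add: invariant_at_def)
  \<comment> \<open>For \<open>w = e / s\<close>, \<open>n s\<close> is \<open>s^2\<close> times the
    squared distance from \<open>w\<close> to \<open>x\<close>, and \<open>k s\<close> is the mirror
    image of \<open>w\<close> in the sphere about \<open>x\<close>. Both extend differentiably to
    \<open>s = 0\<close>, and for small \<open>s > 0\<close> invariance gives
    \<open>\<psi> s = s powr - ?A * u w\<close>.\<close>
  define n where "n = (\<lambda>s. (e - s *\<^sub>R x) \<bullet> (e - s *\<^sub>R x))"
  define k where "k = (\<lambda>s. x + (r\<^sup>2 * s / n s) *\<^sub>R (e - s *\<^sub>R x))"
  define \<psi> where "\<psi> = (\<lambda>s. r powr ?A * (n s powr (- ?A / 2) * u (k s)))"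
  have n0: "n 0 = 1" using e by (simp add: n_def power2_norm_eq_inner[symmetric])
  have dn: "(n has_real_derivative - 2 * (x \<bullet> e)) (at 0)"
  proof -
    have "n = (\<lambda>s. e \<bullet> e - 2 * s * (x \<bullet> e) + s * s * (x \<bullet> x))"
      by (auto simp: n_def fun_eq_iff inner_diff_left inner_diff_right inner_commute algebra_simps)
    then show ?thesis by (auto intro!: derivative_eq_intros)
  qed
  have dp: "((\<lambda>s. n s powr (- ?A / 2)) has_real_derivative ?A * (x \<bullet> e)) (at 0)"
    by (rule DERIV_cong[OF DERIV_fun_powr[OF dn]]) (use n0 in \<open>auto simp: field_simps\<close>)
  have k0: "k 0 = x" by (simp add: k_def)
  have "((\<lambda>s. r\<^sup>2 * s / n s) has_real_derivative r\<^sup>2) (at 0)"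
    using dn n0 by (auto intro!: derivative_eq_intros)
  then have "((\<lambda>s. r\<^sup>2 * s / n s) has_derivative (\<lambda>h. r\<^sup>2 * h)) (at 0)"
    by (simp add: has_field_derivative_def)
  moreover have "((\<lambda>s. e - s *\<^sub>R x) has_derivative (\<lambda>h. - (h *\<^sub>R x))) (at 0)"
    by (auto intro!: derivative_eq_intros)
  ultimately have "((\<lambda>s. (r\<^sup>2 * s / n s) *\<^sub>R (e - s *\<^sub>R x)) has_derivative
      (\<lambda>h. (r\<^sup>2 * 0 / n 0) *\<^sub>R (- (h *\<^sub>R x)) + (r\<^sup>2 * h) *\<^sub>R (e - 0 *\<^sub>R x))) (at 0)"
    by (rule has_derivative_scaleR)
  from has_derivative_add[OF has_derivative_const[of x] this]
  have "(k has_derivative (\<lambda>h. (r\<^sup>2 * h) *\<^sub>R e)) (at 0)"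
    unfolding k_def by simp
  moreover have "(u has_derivative (\<lambda>h. h \<bullet> g x)) (at (k 0))"
    using grad[of x] by (simp add: gderiv_def k0)
  ultimately have "((\<lambda>s. u (k s)) has_derivative (\<lambda>h. ((r\<^sup>2 * h) *\<^sub>R e) \<bullet> g x)) (at 0)"
    by (rule has_derivative_compose)
  then have du: "((\<lambda>s. u (k s)) has_real_derivative r\<^sup>2 * (g x \<bullet> e)) (at 0)"
    unfolding has_field_derivative_def by (rule has_derivative_eq_rhs) (simp add: fun_eq_iff inner_commute)
  have "(\<psi> has_real_derivative r powr ?A * (?A * (x \<bullet> e) * u (k 0) + (r\<^sup>2 * (g x \<bullet> e)) * n 0 powr (- ?A / 2))) (at 0)"
    unfolding \<psi>_def by (intro DERIV_cmult DERIV_mult dp du)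
  then have d\<psi>: "(\<psi> has_real_derivative r powr ?A * (?A * (x \<bullet> e) * u x + r\<^sup>2 * (g x \<bullet> e))) (at 0 within {0..})"
    by (simp add: n0 k0 has_field_derivative_at_within)
  \<comment> \<open>Ensures \<open>s * norm x < 1\<close>, so that \<open>w\<close> is not the
    centre.\<close>
  define d where "d = 1 / (norm x + 1)"
  have d: "0 < d" by (simp add: d_def add_nonneg_pos)
  show ?thesis
  proof (rule has_field_derivative_transform_within[OF d\<psi> d])
    fix s :: real assume s: "s \<in> {0..}" "dist s 0 < d"
    show "\<psi> s = (if s = 0 then r powr ?A * u x else s powr (- ?A) * u ((1 / s) *\<^sub>R e))"
    proof (cases "s = 0")
      case False
      then have s0: "0 < s" using s by simp
      have "s * (norm x + 1) < 1" using s by (simp add: d_def pos_less_divide_eq add_nonneg_pos dist_real_def)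
      then have "s * norm x < 1" using s0 by (simp add: distrib_left)
      then have "e - s *\<^sub>R x \<noteq> 0" using e s0 by auto
      define w where "w = (1 / s) *\<^sub>R e"
      have wx: "w - x = (1 / s) *\<^sub>R (e - s *\<^sub>R x)" using s0 by (simp add: w_def scaleR_diff_right)
      then have "w \<noteq> x" using \<open>e - s *\<^sub>R x \<noteq> 0\<close> s0 by auto
      have nw: "norm (w - x) = norm (e - s *\<^sub>R x) / s" using s0 by (simp add: wx)
      have ns: "n s = (norm (e - s *\<^sub>R x))\<^sup>2" by (simp add: n_def power2_norm_eq_inner)
      have "inversion r (w - x) = (r * s / norm (e - s *\<^sub>R x))\<^sup>2 *\<^sub>R ((1 / s) *\<^sub>R (e - s *\<^sub>R x))"
        by (simp add: inversion_def nw) (simp add: wx)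
      then have "x + inversion r (w - x) = k s"
        using s0 by (simp add: k_def ns power_divide power_mult_distrib power2_eq_square)
      then have "u w = (r / norm (w - x)) powr ?A * u (k s)"
        using inv \<open>w \<noteq> x\<close> unfolding invariant_at_def kelvin_def by (metis add.commute diff_add_cancel right_minus_eq)
      also have "r / norm (w - x) = r * (s * inverse (norm (e - s *\<^sub>R x)))" by (simp add: nw divide_inverse)
      also have "(r * (s * inverse (norm (e - s *\<^sub>R x)))) powr ?A = r powr ?A * (s powr ?A * inverse (norm (e - s *\<^sub>R x)) powr ?A)"
        by (simp only: powr_mult)
      also have "inverse (norm (e - s *\<^sub>R x)) powr ?A = n s powr (- ?A / 2)"
        using \<open>e - s *\<^sub>R x \<noteq> 0\<close> by (simp add: ns powr_def ln_inverse ln_realpow algebra_simps)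
      finally have "u w = s powr ?A * \<psi> s" by (simp add: \<psi>_def)
      then have "s powr (- ?A) * u w = (s powr (- ?A) * s powr ?A) * \<psi> s" by simp
      also have "s powr (- ?A) * s powr ?A = 1" using s0 by (simp add: powr_add[symmetric])
      finally show ?thesis using False by (simp add: w_def)
    qed (simp add: \<psi>_def n0 k0)
  qed simp
qed

text \<open>Each centre gives two identities: the limit at infinity,
  \<open>R x powr A * u x = a\<close>, and the first-order coefficient, which relates
  \<open>g x\<close> linearly to \<open>x\<close>. Eliminating \<open>R x\<close> leaves a
  first-order equation for \<open>u\<close> alone, and a suitable power of \<open>u\<close> has an
  affine gradient.\<close>

lemma radially_decreasing: "\<exists>x0. radially_decreasing_about x0 u"
proof -
  define A where "A = real DIM('a) - \<alpha>"
  have A: "0 < A" using \<alpha> by (simp add: A_def)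
  obtain R where R: "\<And>x. invariant_at x (R x)" using all_invariant by metis
  have R0: "0 < R x" for x using R[of x] by (simp add: invariant_at_def)
  define a where "a = R 0 powr A * u 0"
  have a: "0 < a" using R0[of 0] pos[of 0] by (simp add: a_def)
  have aR: "R x powr A * u x = a" for x
    using tendsto_unique[OF trivial_limit_at_infinity invariant_limit[OF R[of x], folded A_def] invariant_limit[OF R[of 0], folded A_def]] by (simp add: a_def)
  \<comment> \<open>The first-order coefficient as computed from the centre 0.\<close>
  define b where "b = (R 0 powr A * (R 0)\<^sup>2) *\<^sub>R g 0"
  have grad_eq: "(R x powr A * (R x)\<^sup>2) *\<^sub>R g x = b - (A * a) *\<^sub>R x" for x
  proof -
    have "(R x powr A * (R x)\<^sup>2) *\<^sub>R g x \<bullet> e = (b - (A * a) *\<^sub>R x) \<bullet> e" if "e \<in> Basis" for e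
    proof -
      have e: "norm e = 1" using that by simp
      have "R x powr A * (A * (x \<bullet> e) * u x + (R x)\<^sup>2 * (g x \<bullet> e)) = R 0 powr A * (A * (0 \<bullet> e) * u 0 + (R 0)\<^sup>2 * (g 0 \<bullet> e))"
      proof (rule derivative_unique_right)
        show "((\<lambda>s. if s = 0 then a else s powr (- A) * u ((1 / s) *\<^sub>R e)) has_real_derivative
           R x powr A * (A * (x \<bullet> e) * u x + (R x)\<^sup>2 * (g x \<bullet> e))) (at 0 within {0..})"
          by (rule invariant_gradient[OF R[of x] e, folded A_def, unfolded aR])
        show "((\<lambda>s. if s = 0 then a else s powr (- A) * u ((1 / s) *\<^sub>R e)) has_real_derivative
           R 0 powr A * (A * (0 \<bullet> e) * u 0 + (R 0)\<^sup>2 * (g 0 \<bullet> e))) (at 0 within {0..})"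
          by (rule invariant_gradient[OF R[of 0] e, folded A_def, unfolded aR])
      qed
      moreover have "R x powr A * (A * (x \<bullet> e) * u x + (R x)\<^sup>2 * (g x \<bullet> e))
          = A * (x \<bullet> e) * (R x powr A * u x) + R x powr A * (R x)\<^sup>2 * (g x \<bullet> e)"
        by (simp add: algebra_simps)
      ultimately have "A * (x \<bullet> e) * a + R x powr A * (R x)\<^sup>2 * (g x \<bullet> e) = R 0 powr A * (R 0)\<^sup>2 * (g 0 \<bullet> e)"
        unfolding aR by simp
      then show ?thesis by (simp add: b_def inner_diff_left algebra_simps)
    qed
    then show ?thesis by (rule euclidean_eqI)
  qed
  \<comment> \<open>The zero of \<open>b - (A * a) *\<^sub>R x\<close>, that is, the critical point
    of \<open>u\<close>.\<close>
  define x0 where "x0 = (1 / (A * a)) *\<^sub>R b"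
  have Rp: "R x powr A * (R x)\<^sup>2 = a powr (1 + 2 / A) * u x powr - (1 + 2 / A)" for x
  proof -
    have RA: "R x powr A = a / u x" using aR[of x] pos[of x] by (simp add: field_simps)
    have "A * (2 / A) = 2" using A by simp
    then have "(R x)\<^sup>2 = (R x powr A) powr (2 / A)" using R0[of x] by (simp only: powr_powr) simp
    then have "R x powr A * (R x)\<^sup>2 = (a / u x) powr 1 * (a / u x) powr (2 / A)" using a pos[of x] by (simp add: RA)
    also have "\<dots> = (a / u x) powr (1 + 2 / A)" by (simp only: powr_add)
    also have "\<dots> = a powr (1 + 2 / A) * u x powr - (1 + 2 / A)"
      using a pos[of x] by (simp only: powr_divide powr_minus_divide) simp
    finally show ?thesis .
  qed
  \<comment> \<open>By \<open>Rp\<close> the factor of \<open>g x\<close> in \<open>grad_eq\<close>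
    is a constant times \<open>u x powr - (1 + 2 / A)\<close>, which up to the factor
    \<open>- 2 / A\<close> is the derivative of \<open>t powr (- 2 / A)\<close> at
    \<open>u x\<close>.\<close>
  define v where "v = (\<lambda>x. u x powr (- 2 / A))"
  define c where "c = a powr (- 2 / A)"
  have c: "0 < c" using a by (simp add: c_def)
  have dv: "GDERIV v x :> (2 * c) *\<^sub>R (x - x0)" for x
  proof -
    have "((\<lambda>t. t powr (- 2 / A)) has_real_derivative (- 2 / A) * u x powr (- 2 / A - 1)) (at (u x))"
      using pos by (intro has_real_derivative_powr)
    then have "((\<lambda>t. t powr (- 2 / A)) has_derivative (\<lambda>h. ((- 2 / A) * u x powr (- 2 / A - 1)) * h)) (at (u x))"
      by (simp only: has_field_derivative_def)
    from has_derivative_compose[OF grad[of x, unfolded gderiv_def] this]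
    have 1: "(v has_derivative (\<lambda>h. ((- 2 / A) * u x powr (- 2 / A - 1)) * (h \<bullet> g x))) (at x)"
      by (simp add: v_def)
    have e: "- 2 / A - 1 = - (1 + 2 / A)" by simp
    have "a powr (1 + 2 / A) *\<^sub>R (u x powr (- 2 / A - 1) *\<^sub>R g x) = b - (A * a) *\<^sub>R x"
      using grad_eq[of x] unfolding Rp e by (simp only: scaleR_scaleR)
    also have "\<dots> = - (A * a) *\<^sub>R (x - x0)" using A a by (simp add: x0_def scaleR_diff_right)
    finally have "a powr - (1 + 2 / A) *\<^sub>R (a powr (1 + 2 / A) *\<^sub>R (u x powr (- 2 / A - 1) *\<^sub>R g x))
       = a powr - (1 + 2 / A) *\<^sub>R (- (A * a) *\<^sub>R (x - x0))" by (rule arg_cong)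
    moreover have "a powr - (1 + 2 / A) * a powr (1 + 2 / A) = 1"
      unfolding powr_add[symmetric] using a by simp
    ultimately have 2: "u x powr (- 2 / A - 1) *\<^sub>R g x = (a powr - (1 + 2 / A) * (- (A * a))) *\<^sub>R (x - x0)"
      by (simp only: scaleR_scaleR mult.assoc[symmetric] mult_1_left)
    have 3: "a powr - (1 + 2 / A) * a = c"
    proof -
      have "a powr - (1 + 2 / A) * a powr 1 = c" unfolding powr_add[symmetric] c_def by simp
      then show ?thesis using a by simp
    qed
    have "((- 2 / A) * u x powr (- 2 / A - 1)) *\<^sub>R g x = (2 * c) *\<^sub>R (x - x0)"
    proof -
      have "((- 2 / A) * u x powr (- 2 / A - 1)) *\<^sub>R g x = (- 2 / A) *\<^sub>R (u x powr (- 2 / A - 1) *\<^sub>R g x)" by simp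
      also have "\<dots> = ((- 2 / A) * (- A) * (a powr - (1 + 2 / A) * a)) *\<^sub>R (x - x0)"
        unfolding 2 by (simp only: scaleR_scaleR mult_ac mult_minus_left mult_minus_right)
      also have "\<dots> = (2 * c) *\<^sub>R (x - x0)" unfolding 3 using A by simp
      finally show ?thesis .
    qed
    then have "((- 2 / A) * u x powr (- 2 / A - 1)) * (h \<bullet> g x) = h \<bullet> ((2 * c) *\<^sub>R (x - x0))" for h
      by (metis inner_scaleR_right)
    with 1 show ?thesis by (simp add: gderiv_def)
  qed
  have "GDERIV (\<lambda>x. v x - c * ((x - x0) \<bullet> (x - x0))) x :> 0" for x
  proof -
    have "((\<lambda>x. v x - c * ((x - x0) \<bullet> (x - x0))) has_derivative
       (\<lambda>h. h \<bullet> ((2 * c) *\<^sub>R (x - x0)) - c * ((x - x0) \<bullet> h + h \<bullet> (x - x0)))) (at x)"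
      using dv[of x] unfolding gderiv_def
      by (auto intro!: derivative_eq_intros)
    moreover have "(\<lambda>h. h \<bullet> ((2 * c) *\<^sub>R (x - x0)) - c * ((x - x0) \<bullet> h + h \<bullet> (x - x0))) = (\<lambda>h. h \<bullet> 0)"
      by (auto simp: fun_eq_iff inner_commute[of "x - x0"])
    ultimately show ?thesis by (simp add: gderiv_def)
  qed
  then obtain k where k: "\<And>x. v x - c * ((x - x0) \<bullet> (x - x0)) = k" using gderiv_zero_constant by blast
  then have v: "v x = c * (norm (x - x0))\<^sup>2 + k" for x
    using k[of x] unfolding power2_norm_eq_inner by linarith
  define \<phi> where "\<phi> = (\<lambda>\<rho>. (c * \<rho>\<^sup>2 + k) powr - (A / 2))"
  have "u x = \<phi> (norm (x - x0))" for x
  proof -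
    have "\<phi> (norm (x - x0)) = v x powr - (A / 2)" by (simp add: \<phi>_def v)
    also have "\<dots> = u x powr ((- 2 / A) * - (A / 2))" by (simp only: v_def powr_powr)
    also have "(- 2 / A) * - (A / 2) = 1" using A by simp
    finally show ?thesis using pos[of x] by simp
  qed
  moreover have "antimono_on {0..} \<phi>"
  proof (rule monotone_onI)
    fix \<rho> \<sigma> :: real assume \<rho>: "\<rho> \<in> {0..}" "\<rho> \<le> \<sigma>"
    obtain e :: 'a where e: "e \<in> Basis" using nonempty_Basis by blast
    \<comment> \<open>No sign of \<open>k\<close> is used: the quadratic is positive at every radius
      because it equals \<open>v\<close> at a point at that distance from \<open>x0\<close>.\<close>
    have "0 < v (x0 + \<rho> *\<^sub>R e)" using pos[of "x0 + \<rho> *\<^sub>R e"] by (simp add: v_def)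
    then have "0 < c * \<rho>\<^sup>2 + k" using e \<rho> by (simp add: v)
    moreover have "c * \<rho>\<^sup>2 \<le> c * \<sigma>\<^sup>2" using \<rho> c by (intro mult_left_mono power_mono) auto
    ultimately show "\<phi> \<sigma> \<le> \<phi> \<rho>" unfolding \<phi>_def using A by (intro powr_mono2') auto
  qed
  ultimately show ?thesis unfolding radially_decreasing_about_def by blast
qed

lemma critical: "p * (real DIM('a) - \<alpha>) = real DIM('a) + \<alpha>"
proof -
  obtain r where "invariant_at 0 r" using all_invariant by blast
  then show ?thesis
    using frac_solution.kelvin_invariant_critical[OF sol[of 0], of r] by (simp add: invariant_at_def)
qed

end

section \<open>Classification\<close>

lemma has_frac_laplacian_imp_pv:
  fixes u :: "'a::euclidean_space \<Rightarrow> real"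
  assumes [measurable]: "u \<in> borel_measurable borel" and "C > 0" and "has_frac_laplacian C \<alpha> u x l"
  shows "pv \<alpha> u x (l / C)"
proof -
  let ?s = "real DIM('a) + \<alpha>"
  have "(LINT z : - ball x \<epsilon> | lebesgue. (u x - u z) / norm (x - z) powr ?s)
     = (LINT z:- ball x \<epsilon>|lborel. (u x - u z) * kern \<alpha> (x - z))" for \<epsilon>
  proof -
    have "(LINT z : - ball x \<epsilon> | lebesgue. (u x - u z) / norm (x - z) powr ?s)
       = (LINT z:- ball x \<epsilon>|lborel. (u x - u z) / norm (x - z) powr ?s)"
      unfolding set_lebesgue_integral_def by (rule integral_completion) measurable
    then show ?thesis by (simp only: kern_def powr_minus_divide) simp
  qed
  then have "((\<lambda>\<epsilon>. C * (LINT z:- ball x \<epsilon>|lborel. (u x - u z) * kern \<alpha> (x - z))) \<longlongrightarrow> l) (at_right 0)"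
    using assms(3) by (simp add: has_frac_laplacian_def)
  from tendsto_divide[OF this tendsto_const, of C] show ?thesis
    using \<open>C > 0\<close> by (simp add: pv_def)
qed

theorem theorem4:
  fixes u :: "'a::euclidean_space \<Rightarrow> real" and \<alpha> p C :: real
  assumes "0 < \<alpha>" "\<alpha> < 2"
    and "\<alpha> < real DIM('a)"
    and "C > 0"
    and "u \<in> L_space \<alpha> \<inter> C11_loc"
    and "\<And>x. 0 \<le> u x"
    and "\<And>x. has_frac_laplacian C \<alpha> u x (u x powr p)"
  shows "(p = (real DIM('a) + \<alpha>) / (real DIM('a) - \<alpha>) \<longrightarrow>
            (\<exists>x0. radially_decreasing_about x0 u)) \<and>
         (1 < p \<and> p < (real DIM('a) + \<alpha>) / (real DIM('a) - \<alpha>) \<longrightarrow>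
            (\<forall>x. u x = 0))"
proof -
  let ?A = "real DIM('a) - \<alpha>"
  have A: "0 < ?A" using assms(3) by simp
  obtain g :: "'a \<Rightarrow> 'a" where g: "\<And>x. GDERIV u x :> g x"
    and lip: "\<And>x. \<exists>r>0. \<exists>K. K-lipschitz_on (ball x r) g"
    using assms(5) by (auto simp: C11_loc_def)
  have cont_g: "isCont g x" for x
  proof -
    obtain r K where "r > 0" "K-lipschitz_on (ball x r) g" using lip by blast
    then have "continuous_on (ball x r) g" by (auto intro: lipschitz_on_continuous_on)
    then show ?thesis using \<open>r > 0\<close> by (auto simp: continuous_on_eq_continuous_at)
  qed
  have cont: "isCont u x" for x
    using g[of x] unfolding gderiv_def by (rule has_derivative_continuous)
  have [measurable]: "u \<in> borel_measurable borel"
    by (intro borel_measurable_continuous_onI continuous_at_imp_continuous_on ballI cont)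
  have "integrable lebesgue (\<lambda>x. \<bar>u x\<bar> / (1 + norm x powr (real DIM('a) + \<alpha>)))"
    using assms(5) by (simp add: L_space_def)
  then have "integrable lborel (\<lambda>x. \<bar>u x\<bar> / (1 + norm x powr (real DIM('a) + \<alpha>)))"
    by (subst (asm) integrable_completion) auto
  then have tail: "tail_integrable \<alpha> u"
    using assms(6) by (simp add: tail_integrable_def)
  have pv: "pv \<alpha> u x (u x powr p / C)" for x
    by (rule has_frac_laplacian_imp_pv) (use assms in auto)
  show ?thesis
  proof (cases "\<exists>x. u x = 0")
    case True
    then obtain x where x: "u x = 0" by blast
    \<comment> \<open>As \<open>0 powr p = 0\<close>, the principal value at the zero
      \<open>x\<close> is 0, the hypothesis of \<open>pv_zero_min\<close>. The positive case is left
      for the moving spheres.\<close>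
    then have "u z = 0" for z
      using pv[of x] by (intro pv_zero_min[OF assms(1) tail cont assms(6) x]) simp
    moreover from this have "radially_decreasing_about 0 u"
      unfolding radially_decreasing_about_def by (intro exI[of _ "\<lambda>_. 0"]) (auto intro: monotone_onI)
    ultimately show ?thesis by blast
  next
    case False
    then have pos: "0 < u x" for x using assms(6)[of x] by (metis less_le)
    have all: "frac_solution_all u g \<alpha> p C" if "1 < p" "p * ?A \<le> real DIM('a) + \<alpha>"
    proof (unfold_locales)
      show "GDERIV (\<lambda>y. u (x + y)) y :> g (x + y)" for x y
      proof -
        have "((\<lambda>y. u (x + y)) has_derivative (\<lambda>h. h \<bullet> g (x + y))) (at y)"
          using g[of "x + y"] unfolding gderiv_def
          by (rule has_derivative_compose[rotated]) (auto intro!: derivative_eq_intros)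
        then show ?thesis by (simp add: gderiv_def)
      qed
      show "isCont (\<lambda>y. g (x + y)) y" for x y
        by (rule isCont_o2[OF _ cont_g]) (auto intro!: continuous_intros)
      show "pv \<alpha> (\<lambda>y. u (x + y)) y (u (x + y) powr p / C)" for x y
        by (rule pv_translate[OF _ pv]) measurable
    qed (use assms that pos tail in \<open>auto intro: tail_integrable_translate\<close>)
    have "\<exists>x0. radially_decreasing_about x0 u" if "p = (real DIM('a) + \<alpha>) / ?A"
    proof (rule frac_solution_all.radially_decreasing[OF all])
      show "1 < p" using that assms(1) A by (simp add: less_divide_eq)
      show "p * ?A \<le> real DIM('a) + \<alpha>" using that A by simp
    qed
    \<comment> \<open>A positive solution has an invariant sphere, and such a sphere exists only for
      the critical exponent; below it positivity is therefore contradictory.\<close>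
    moreover have False if "1 < p" "p < (real DIM('a) + \<alpha>) / ?A"
    proof -
      have lt: "p * ?A < real DIM('a) + \<alpha>" using that(2) A by (simp only: pos_less_divide_eq)
      have "p * ?A = real DIM('a) + \<alpha>"
        by (rule frac_solution_all.critical[OF all]) (use that lt in auto)
      with lt show False by simp
    qed
    ultimately show ?thesis by blast
  qed
qed

end
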